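(* For every $\alpha\in\overline{\mathbb{Q}}^{\times}$, $M_\infty(\alpha) = 1$ if and only if $\alpha$ is a root of unity.
   Context: For a number field $K$ and a place $v$ of $K$ dividing the place $p$ of $\mathbb{Q}$ (including $p=\infty$), let $\|\cdot\|_v$ be the unique absolute value on the completion $K_v$ extending the $p$-adic (usual, if $p=\infty$) absolute value on $\mathbb{Q}_p$, and put $|\alpha|_v = \|\alpha\|_v^{[K_v:\mathbb{Q}_p]/[K:\mathbb{Q}]}$ for $\alpha\in K$. The (absolute, multiplicative) Weil height of $\alpha \in K$ is $H(\alpha) = \prod_v \max\{1,|\alpha|_v\}$, the product being over all places $v$ of $K$; it does not depend on the choice of $K$ containing $\alpha$, so $H$ is a function on $\overline{\mathbb{Q}}$. The Mahler measure of $\alpha\in\overline{\mathbb{Q}}$ is $M(\alpha) = H(\alpha)^{\deg\alpha}$, where $\deg\alpha = [\mathbb{Q}(\alpha):\mathbb{Q}]$. Let $\mathcal{X}(\overline{\mathbb{Q}}^{\times})$ be the group of sequences $(\alpha_1,\alpha_2,\ldots)$ with $\alpha_n\in\overline{\mathbb{Q}}^{\times}$ and $\alpha_n = 1$ for all but finitely many $n$, and let $\tau:\mathcal{X}(\overline{\mathbb{Q}}^{\times})\to\overline{\mathbb{Q}}^{\times}$ be $\tau(\alpha_1,\alpha_2,\ldots) = \alpha_1\alpha_2\cdots$. For $\alpha\in\overline{\mathbb{Q}}^{\times}$ define the non-Archimedean (strong) metric Mahler measure $$M_\infty(\alpha) = \inf\left\{\max_{n\geq 1} M(\alpha_n) :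 (\alpha_1,\alpha_2,\ldots)\in\tau^{-1}(\alpha)\right\}.$$ *)

theory Defs
  imports "HOL-Algebra.Algebraic_Closure_Type" "HOL-Algebra.Generated_Fields"
begin

text \<open>
  The field \<open>\<rat>\<close>-bar is the set of algebraic complex numbers, and number fields are subfields of
  the complex numbers.
\<close>

abbreviation complex_ring :: "complex ring" where
  "complex_ring \<equiv> ring_of_type_algebra"

definition adjoin_rat :: "complex \<Rightarrow> complex set" where
  "adjoin_rat \<alpha> = generate_field complex_ring {\<alpha>}"

definition field_degree :: "complex set \<Rightarrow> nat" where
  "field_degree K = ring.dim complex_ring \<rat> K"

definition padic_abs :: "nat \<Rightarrow> rat \<Rightarrow> real" where
  "padic_abs p q = (if q = 0 then 0 else
     real p powi (int (multiplicity (int p) (snd (quotient_of q)))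
                - int (multiplicity (int p) (fst (quotient_of q)))))"

definition abs_value_on :: "complex set \<Rightarrow> (complex \<Rightarrow> real) \<Rightarrow> bool" where
  "abs_value_on K v \<longleftrightarrow>
     (\<forall>x\<in>K. v x \<ge> 0) \<and> (\<forall>x\<in>K. v x = 0 \<longleftrightarrow> x = 0) \<and>
     (\<forall>x\<in>K. \<forall>y\<in>K. v (x * y) = v x * v y) \<and>
     (\<forall>x\<in>K. \<forall>y\<in>K. v (x + y) \<le> v x + v y)"

text \<open>
  A place of \<open>K\<close> is represented by the restriction to \<open>K\<close> of \<open>\<parallel>\<cdot>\<parallel>\<^sub>v\<close>, which is the unique member
  of its equivalence class that extends the usual or a \<open>p\<close>-adic absolute value of \<open>\<rat>\<close>.
  Membership in \<^const>\<open>extensional\<close> fixes the irrelevant values outside \<open>K\<close>, so that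
  each place is counted exactly once.
\<close>

definition places :: "complex set \<Rightarrow> (complex \<Rightarrow> real) set" where
  "places K = {v \<in> extensional K. abs_value_on K v \<and>
     ((\<forall>q::rat. v (of_rat q) = \<bar>of_rat q\<bar>) \<or>
      (\<exists>p::nat. prime p \<and> (\<forall>q::rat. v (of_rat q) = padic_abs p q)))}"

text \<open>
  The completion \<open>K\<^sub>v\<close> is the ring of \<open>v\<close>-Cauchy sequences in \<open>K\<close> modulo the null sequences.
  Its subfield \<open>\<rat>\<^sub>p\<close>, for the place \<open>p\<close> below \<open>v\<close>, consists of the classes of Cauchy sequences
  of rational numbers.
\<close>

definition cauchy_seqs :: "complex set \<Rightarrow> (complex \<Rightarrow> real) \<Rightarrow> (nat \<Rightarrow> complex) set" where
  "cauchy_seqs K v =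
     {s. range s \<subseteq> K \<and> (\<forall>e>0. \<exists>N. \<forall>m\<ge>N. \<forall>n\<ge>N. v (s m - s n) < e)}"

definition cauchy_ring :: "complex set \<Rightarrow> (complex \<Rightarrow> real) \<Rightarrow> (nat \<Rightarrow> complex) ring" where
  "cauchy_ring K v = \<lparr>carrier = cauchy_seqs K v,
     monoid.mult = (\<lambda>s t n. s n * t n), one = (\<lambda>_. 1),
     ring.zero = (\<lambda>_. 0), add = (\<lambda>s t n. s n + t n)\<rparr>"

definition null_seqs :: "complex set \<Rightarrow> (complex \<Rightarrow> real) \<Rightarrow> (nat \<Rightarrow> complex) set" where
  "null_seqs K v = {s \<in> cauchy_seqs K v. (\<lambda>n. v (s n)) \<longlonglongrightarrow> 0}"

definition completion :: "complex set \<Rightarrow> (complex \<Rightarrow> real) \<Rightarrow> (nat \<Rightarrow> complex) set ring" where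
  "completion K v = cauchy_ring K v Quot null_seqs K v"

definition completion_rat :: "complex set \<Rightarrow> (complex \<Rightarrow> real) \<Rightarrow> (nat \<Rightarrow> complex) set set" where
  "completion_rat K v = (\<lambda>s. null_seqs K v +>\<^bsub>cauchy_ring K v\<^esub> s) ` cauchy_seqs \<rat> v"

definition local_degree :: "complex set \<Rightarrow> (complex \<Rightarrow> real) \<Rightarrow> nat" where
  "local_degree K v =
     ring.dim (completion K v) (completion_rat K v) (carrier (completion K v))"

definition normalized_abs :: "complex set \<Rightarrow> (complex \<Rightarrow> real) \<Rightarrow> complex \<Rightarrow> real" where
  "normalized_abs K v \<alpha> = v \<alpha> powr (real (local_degree K v) / real (field_degree K))"

text \<open>Only finitely many factors of the height differ from 1; the product ranges over those.\<close>

definition height_over :: "complex set \<Rightarrow> complex \<Rightarrow> real" where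
  "height_over K \<alpha> =
     (\<Prod>v | v \<in> places K \<and> max 1 (normalized_abs K v \<alpha>) \<noteq> 1. max 1 (normalized_abs K v \<alpha>))"

text \<open>
  The height does not depend on the number field containing \<open>\<alpha>\<close>; we take the smallest one.
\<close>

definition weil_height :: "complex \<Rightarrow> real" where
  "weil_height \<alpha> = height_over (adjoin_rat \<alpha>) \<alpha>"

definition mahler_measure :: "complex \<Rightarrow> real" where
  "mahler_measure \<alpha> = weil_height \<alpha> ^ field_degree (adjoin_rat \<alpha>)"

text \<open>Sequences are indexed from 0.\<close>

definition finite_seqs :: "(nat \<Rightarrow> complex) set" where
  "finite_seqs = {a. (\<forall>n. algebraic (a n) \<and> a n \<noteq> 0) \<and> finite {n. a n \<noteq> 1}}"

definition seq_prod :: "(nat \<Rightarrow> complex) \<Rightarrow> complex" where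
  "seq_prod a = (\<Prod>n | a n \<noteq> 1. a n)"

text \<open>The maximum exists because a sequence in \<open>finite_seqs\<close> takes only finitely many values.\<close>

definition metric_mahler :: "complex \<Rightarrow> real" where
  "metric_mahler \<alpha> =
     Inf {Max (range (\<lambda>n. mahler_measure (a n))) | a. a \<in> finite_seqs \<and> seq_prod a = \<alpha>}"

end

(*
  If metric_mahler \<alpha> = 1, then \<alpha> is a product of algebraic numbers a_i of Mahler measure below
  any given c > 1. A number that is not an algebraic integer has a p-adic place of Q(a) with
  |a|_v > 1, and the contribution of that place to the Mahler measure is a positive power of p; so
  for c \<le> 2 all a_i are algebraic integers. The archimedean places show that every product of
  distinct conjugates of a_i has modulus at most the Mahler measure of a_i.

  In a finite Galois extension of Q containing all conjugates of \<alpha> and of the a_i, let H be the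
  stabilizer of \<alpha> and b_i the product of the H-orbit of a_i. Then \<alpha> ^ |H| is a product of powers
  of the b_i. The number b_i lies in Q(\<alpha>), so its degree is bounded by that of \<alpha>, and its
  conjugates are products of distinct conjugates of a_i, hence of modulus below c. If c is close
  enough to 1 in terms of the degree of \<alpha> alone, Northcott's finiteness theorem forces two powers
  of b_i to coincide, so that b_i, and therefore \<alpha>, is a root of unity.
*)
theory Submission
  imports Defs
begin

hide_const (open) Polynomials.degree Polynomials.lead_coeff

section \<open>Conjugates and fields generated by one algebraic number\<close>

text \<open>Neither the number of the factors a_i nor their degrees are bounded along the infimum,
  so Northcott's theorem cannot be applied to the a_i themselves. The orbit product moves each
  factor into Q(\<alpha>), where degrees are bounded, and each b_i is treated separately, so that
  the number of factors never enters. The price is that a conjugate of b_i is a product of many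
  conjugates of a_i; the Mahler measure bounds all such products at once. If N is the size of the
  finite set that Northcott's argument provides for the degree of \<alpha> and conjugates of modulus
  at most 2, the condition on c is c ^ N \<le> 2: it keeps the powers of b_i with exponents 0 to N,
  one too many to be distinct, in that set. Apart from roots of unity, Mahler measures are only
  bounded from below, so lower bounds on local degrees suffice. Two default values call for
  finiteness proofs: \<open>ring.dim\<close> has a meaning only in finite dimension, and a product
  over an infinite set is 1, so that a height with infinitely many factors different from 1 would
  collapse.\<close>

definition ev :: "rat poly \<Rightarrow> complex \<Rightarrow> complex" where
  "ev p x = poly (map_poly of_rat p) x"

lemma ev_pCons [simp]: "ev (pCons a p) x = of_rat a + x * ev p x"
  by (simp add: ev_def map_poly_pCons)

lemma ev_0 [simp]: "ev 0 x = 0"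
  by (simp add: ev_def)

lemma ev_1 [simp]: "ev 1 x = 1"
  by (simp add: ev_def)

lemma ev_add [simp]: "ev (p + q) x = ev p x + ev q x"
  by (induction p q rule: poly_induct2) (simp_all add: of_rat_add algebra_simps)

lemma ev_smult [simp]: "ev (smult c p) x = of_rat c * ev p x"
  by (induction p) (simp_all add: of_rat_mult algebra_simps)

lemma ev_minus [simp]: "ev (- p) x = - ev p x"
  using ev_smult[of "-1" p x] by (simp add: of_rat_minus)

lemma ev_diff [simp]: "ev (p - q) x = ev p x - ev q x"
  using ev_add[of p "- q" x] by simp

lemma ev_mult [simp]: "ev (p * q) x = ev p x * ev q x"
  by (induction p) (simp_all add: algebra_simps)

lemma ev_power [simp]: "ev (p ^ n) x = ev p x ^ n"
  by (induction n) simp_all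

lemma ev_pcompose [simp]: "ev (pcompose p q) x = ev p (ev q x)"
  by (induction p) (simp_all add: pcompose_pCons)

lemma ev_of_rat [simp]: "ev p (of_rat r) = of_rat (poly p r)"
  by (induction p) (simp_all add: of_rat_add of_rat_mult)

lemma ev_altdef: "ev p x = (\<Sum>i\<le>degree p. of_rat (coeff p i) * x ^ i)"
  by (simp add: ev_def poly_altdef degree_map_poly coeff_map_poly)

lemma algebraic_iff_ev: "algebraic x \<longleftrightarrow> (\<exists>p. p \<noteq> 0 \<and> ev p x = 0)"
proof
  assume "algebraic x"
  then obtain p where p: "p \<noteq> 0" "poly (map_poly of_int p) x = 0" by (rule algebraicE')
  have "map_poly of_rat (map_poly of_int p) = (map_poly of_int p :: complex poly)"
    by (simp add: map_poly_map_poly o_def)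
  moreover have "map_poly of_int p \<noteq> (0 :: rat poly)" using p(1) by (simp add: map_poly_eq_0_iff)
  ultimately show "\<exists>p. p \<noteq> 0 \<and> ev p x = 0" using p(2) by (metis ev_def)
next
  assume "\<exists>p. p \<noteq> 0 \<and> ev p x = 0"
  then obtain p where "p \<noteq> 0" "ev p x = 0" by blast
  thus "algebraic x"
    by (intro algebraicI'[of "map_poly of_rat p"]) (auto simp: coeff_map_poly map_poly_eq_0_iff ev_def)
qed

text \<open>The common zeros of the whole annihilating ideal of \<open>x\<close>, so that no minimal
  polynomial has to be chosen. For algebraic \<open>x\<close> they are the roots of any
  \<open>m\<close> with \<open>is_minpoly m x\<close>.\<close>

definition conjs :: "complex \<Rightarrow> complex set" where
  "conjs x = {z. \<forall>p. ev p x = 0 \<longrightarrow> ev p z = 0}"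

text \<open>As it stands this is the ring Q[x]; for algebraic \<open>x\<close> it is the field Q(x),
  by \<open>Qadj_inverse\<close>.\<close>

definition Qadj :: "complex \<Rightarrow> complex set" where
  "Qadj x = range (\<lambda>p. ev p x)"

definition is_minpoly :: "rat poly \<Rightarrow> complex \<Rightarrow> bool" where
  "is_minpoly m x \<longleftrightarrow> lead_coeff m = 1 \<and> (\<forall>p. ev p x = 0 \<longleftrightarrow> m dvd p)"

lemma conjs_self [simp]: "x \<in> conjs x"
  by (simp add: conjs_def)

lemma conjs_trans: "y \<in> conjs x \<Longrightarrow> z \<in> conjs y \<Longrightarrow> z \<in> conjs x"
  by (auto simp: conjs_def)

lemma minpoly_exists:
  assumes "algebraic x"
  obtains m where "is_minpoly m x"
proof -
  define P where "P = (\<lambda>p. p \<noteq> 0 \<and> ev p x = 0)"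
  obtain p0 where "P p0" using assms by (auto simp: algebraic_iff_ev P_def)
  define m0 where "m0 = (ARG_MIN degree p. P p)"
  have m0: "P m0" and min: "\<And>q. P q \<Longrightarrow> degree m0 \<le> degree q"
    using arg_min_nat_lemma[of P p0 degree] \<open>P p0\<close> by (auto simp: m0_def)
  define m where "m = smult (inverse (lead_coeff m0)) m0"
  have "lead_coeff m = 1" using m0 by (simp add: m_def P_def)
  moreover have "ev m x = 0" using m0 by (simp add: m_def P_def)
  moreover have "m dvd p" if "ev p x = 0" for p
  proof -
    have "ev (p mod m) x = 0" using that \<open>ev m x = 0\<close> ev_add[of "m * (p div m)" "p mod m" x] by simp
    moreover have "degree m = degree m0" using m0 by (simp add: m_def P_def)
    moreover have "m \<noteq> 0" using m0 by (simp add: m_def P_def)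
    ultimately have "p mod m = 0"
      using min[of "p mod m"] degree_mod_less[of m p] by (force simp: P_def)
    thus ?thesis by auto
  qed
  ultimately have "is_minpoly m x" by (auto simp: is_minpoly_def)
  thus thesis by (rule that)
qed

lemma minpoly_root: "is_minpoly m x \<Longrightarrow> ev m x = 0"
  by (simp add: is_minpoly_def)

lemma minpoly_nonzero: "is_minpoly m x \<Longrightarrow> m \<noteq> 0"
  by (auto simp: is_minpoly_def)

lemma minpoly_degree_pos: "is_minpoly m x \<Longrightarrow> degree m > 0"
  by (metis degree_eq_zeroE gr0I is_minpoly_def lead_coeff_pCons(2) minpoly_root ev_1 one_pCons pCons_0_0 zero_neq_one coeff_pCons_0 degree_pCons_0)

lemma conjs_eq_roots: "is_minpoly m x \<Longrightarrow> conjs x = {z. ev m z = 0}"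
  by (auto simp: conjs_def is_minpoly_def dvd_def)

lemma finite_ev_roots: "p \<noteq> 0 \<Longrightarrow> finite {z. ev p z = 0}"
  unfolding ev_def by (intro poly_roots_finite) (simp add: map_poly_eq_0_iff)

lemma finite_conjs: "algebraic x \<Longrightarrow> finite (conjs x)"
  by (metis minpoly_exists conjs_eq_roots minpoly_nonzero finite_ev_roots)

lemma conjs_algebraic: "algebraic x \<Longrightarrow> z \<in> conjs x \<Longrightarrow> algebraic z"
  by (auto simp: conjs_def algebraic_iff_ev)

text \<open>Irreducibility in disguise. The minimal polynomial m' of \<open>z\<close> divides
  \<open>m\<close>, say m = m' k, and \<open>x\<close> is a root of m' or of k. The latter is
  impossible since k has smaller degree than \<open>m\<close>; hence \<open>m\<close> divides m' and
  the two agree. This makes conjugacy a symmetric relation.\<close>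

lemma minpoly_conj:
  assumes "is_minpoly m x" "z \<in> conjs x"
  shows "is_minpoly m z"
proof -
  have "algebraic x" using assms(1) algebraic_iff_ev minpoly_nonzero minpoly_root by blast
  then obtain m' where m': "is_minpoly m' z" using minpoly_exists conjs_algebraic assms(2) by metis
  have "ev m z = 0" using assms by (simp add: conjs_eq_roots)
  then obtain k where k: "m = m' * k" using m' by (auto simp: is_minpoly_def)
  have "ev m' x * ev k x = 0" using minpoly_root[OF assms(1)] k by simp
  moreover have "ev k x \<noteq> 0"
  proof
    assume "ev k x = 0"
    hence "m dvd k" using assms(1) by (simp add: is_minpoly_def)
    moreover have "k \<noteq> 0" using k minpoly_nonzero[OF assms(1)] by auto
    ultimately have "degree m \<le> degree k" by (rule dvd_imp_degree_le)
    moreover have "degree m = degree m' + degree k"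
      using \<open>k \<noteq> 0\<close> minpoly_nonzero[OF m'] k by (simp add: degree_mult_eq)
    ultimately show False using minpoly_degree_pos[OF m'] by simp
  qed
  ultimately have "m dvd m'" using assms(1) by (auto simp: is_minpoly_def)
  hence "degree m \<le> degree m'" using minpoly_nonzero[OF m'] by (rule dvd_imp_degree_le)
  moreover have "k \<noteq> 0" using k minpoly_nonzero[OF assms(1)] by auto
  ultimately have "degree k = 0" using k minpoly_nonzero[OF m'] by (simp add: degree_mult_eq)
  moreover have "lead_coeff k = 1" using k assms(1) m' by (simp add: is_minpoly_def lead_coeff_mult)
  ultimately have "k = 1" by (metis degree_eq_zeroE lead_coeff_pCons(2) one_pCons)
  hence "m = m'" using k by simp
  thus ?thesis using m' by simp
qed

lemma conjs_eq: "algebraic x \<Longrightarrow> z \<in> conjs x \<Longrightarrow> conjs z = conjs x"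
  by (metis conjs_eq_roots minpoly_conj minpoly_exists)

lemma map_poly_pderiv_of_rat: "pderiv (map_poly of_rat p) = (map_poly of_rat (pderiv p) :: complex poly)"
  by (simp add: poly_eq_iff coeff_pderiv coeff_map_poly of_rat_mult of_rat_add)

text \<open>A double root is conjugate to \<open>x\<close>, so \<open>m\<close> is its minimal
  polynomial too and would divide the derivative of \<open>m\<close>, which is nonzero and of
  smaller degree.\<close>

lemma minpoly_rsquarefree:
  assumes "is_minpoly m x"
  shows "rsquarefree (map_poly of_rat m :: complex poly)"
  unfolding rsquarefree_roots
proof (intro allI notI, elim conjE)
  fix a :: complex
  assume "poly (map_poly of_rat m) a = 0" "poly (pderiv (map_poly of_rat m)) a = 0"
  hence a: "ev m a = 0" "ev (pderiv m) a = 0" by (simp_all add: ev_def map_poly_pderiv_of_rat)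
  hence "is_minpoly m a" using assms minpoly_conj conjs_eq_roots by blast
  hence "m dvd pderiv m" using a by (simp add: is_minpoly_def)
  moreover have "pderiv m \<noteq> 0" using minpoly_degree_pos[OF assms] by (simp add: pderiv_eq_0_iff)
  ultimately have "degree m \<le> degree (pderiv m)" by (rule dvd_imp_degree_le)
  thus False using minpoly_degree_pos[OF assms] by (simp add: degree_pderiv)
qed

lemma card_conjs:
  assumes "is_minpoly m x"
  shows "card (conjs x) = degree m"
proof -
  let ?p = "map_poly of_rat m :: complex poly"
  have "?p = smult (lead_coeff ?p) (\<Prod>z|poly ?p z = 0. [:-z, 1:])"
    using complex_poly_decompose_rsquarefree[OF minpoly_rsquarefree[OF assms]] by simp
  moreover have "lead_coeff ?p \<noteq> 0" using minpoly_nonzero[OF assms] by (simp add: map_poly_eq_0_iff)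
  ultimately have "degree ?p = degree (\<Prod>z|poly ?p z = 0. [:-z, 1:])" by (metis degree_smult_eq)
  also have "\<dots> = card {z. poly ?p z = 0}" by (subst degree_prod_eq_sum_degree) auto
  finally show ?thesis using conjs_eq_roots[OF assms] by (simp add: ev_def degree_map_poly)
qed

lemma QadjI [simp, intro]: "ev p x \<in> Qadj x"
  by (simp add: Qadj_def)

lemma QadjE: assumes "y \<in> Qadj x" obtains p where "y = ev p x"
  using assms by (auto simp: Qadj_def)

lemma Qadj_self [simp]: "x \<in> Qadj x"
  using QadjI[of "[:0, 1:]" x] by (simp del: QadjI)

lemma Qadj_of_rat [simp]: "of_rat q \<in> Qadj x"
  using QadjI[of "[:q:]" x] by (simp del: QadjI)

lemma Qadj_0 [simp]: "0 \<in> Qadj x" and Qadj_1 [simp]: "1 \<in> Qadj x"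
  using Qadj_of_rat[of 0 x] Qadj_of_rat[of 1 x] by (simp_all del: Qadj_of_rat)

lemma Qadj_of_int: "of_int k \<in> Qadj x"
  using Qadj_of_rat[of "of_int k" x] by (simp del: Qadj_of_rat)

lemma Qadj_of_nat [simp]: "of_nat n \<in> Qadj x"
  using Qadj_of_rat[of "of_nat n" x] by (simp del: Qadj_of_rat)

lemma Qadj_add [intro]: "y \<in> Qadj x \<Longrightarrow> z \<in> Qadj x \<Longrightarrow> y + z \<in> Qadj x"
  by (elim QadjE) (metis QadjI ev_add)

lemma Qadj_mult [intro]: "y \<in> Qadj x \<Longrightarrow> z \<in> Qadj x \<Longrightarrow> y * z \<in> Qadj x"
  by (elim QadjE) (metis QadjI ev_mult)

lemma Qadj_minus [intro]: "y \<in> Qadj x \<Longrightarrow> - y \<in> Qadj x"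
  by (elim QadjE) (metis QadjI ev_minus)

lemma Qadj_diff [intro]: "y \<in> Qadj x \<Longrightarrow> z \<in> Qadj x \<Longrightarrow> y - z \<in> Qadj x"
  by (elim QadjE) (metis QadjI ev_diff)

lemma Qadj_power [intro]: "y \<in> Qadj x \<Longrightarrow> y ^ n \<in> Qadj x"
  by (elim QadjE) (metis QadjI ev_power)

lemma Qadj_sum [intro]: "(\<And>i. i \<in> I \<Longrightarrow> f i \<in> Qadj x) \<Longrightarrow> sum f I \<in> Qadj x"
  by (induction I rule: infinite_finite_induct) auto

lemma Qadj_prod [intro]: "(\<And>i. i \<in> I \<Longrightarrow> f i \<in> Qadj x) \<Longrightarrow> prod f I \<in> Qadj x"
  by (induction I rule: infinite_finite_induct) auto

lemma Qadj_ev [intro]: "y \<in> Qadj x \<Longrightarrow> ev p y \<in> Qadj x"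
  by (elim QadjE) (metis QadjI ev_pcompose)

lemma Qadj_subset: "y \<in> Qadj x \<Longrightarrow> Qadj y \<subseteq> Qadj x"
  by (auto elim!: QadjE[of _ y])

text \<open>For y = p(x) nonzero, the gcd g of the minimal polynomial and p does not vanish at
  \<open>x\<close>, so the cofactor of g does and has full degree. Hence g is constant, and Bezout's
  identity gives the inverse of y up to a scalar.\<close>

lemma Qadj_inverse:
  assumes "algebraic x" "y \<in> Qadj x"
  shows "inverse y \<in> Qadj x"
proof (cases "y = 0")
  case False
  obtain m where m: "is_minpoly m x" using minpoly_exists[OF assms(1)] .
  obtain p where p: "y = ev p x" using assms(2) by (rule QadjE)
  define g where "g = gcd m p"
  obtain a b where ab: "a * m + b * p = g" using bezout_coefficients_fst_snd[of m p] g_def by metis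
  have gm: "g dvd m" and gp: "g dvd p" by (simp_all add: g_def)
  have gx: "ev g x = ev b x * y"
    using ab minpoly_root[OF m] p by (metis add_0 ev_add ev_mult mult_zero_right)
  have "ev g x \<noteq> 0"
  proof
    assume "ev g x = 0"
    hence "m dvd p" using m gp by (metis dvd_trans is_minpoly_def)
    thus False using m False p by (simp add: is_minpoly_def)
  qed
  obtain k where k: "m = g * k" using gm by auto
  have "ev k x = 0" using minpoly_root[OF m] k \<open>ev g x \<noteq> 0\<close> by simp
  hence "m dvd k" using m by (simp add: is_minpoly_def)
  moreover have "k \<noteq> 0" "g \<noteq> 0" using k minpoly_nonzero[OF m] by auto
  ultimately have "degree g = 0" using k dvd_imp_degree_le[of m k] by (simp add: degree_mult_eq)
  then obtain c where c: "g = [:c:]" "c \<noteq> 0" using \<open>g \<noteq> 0\<close> by (metis degree_eq_zeroE pCons_0_0)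
  have "inverse y = ev (smult (inverse c) b) x"
  proof (rule inverse_unique)
    have "of_rat c = ev b x * y" using gx c by simp
    thus "y * ev (smult (inverse c) b) x = 1"
      using c(2) False by (auto simp: of_rat_divide field_simps)
  qed
  thus ?thesis by (metis QadjI)
qed simp

lemma Qadj_divide: "algebraic x \<Longrightarrow> y \<in> Qadj x \<Longrightarrow> z \<in> Qadj x \<Longrightarrow> y / z \<in> Qadj x"
  by (simp add: divide_inverse Qadj_inverse Qadj_mult)

section \<open>Valuation rings and algebraic integers\<close>

definition csubring :: "complex set \<Rightarrow> bool" where
  "csubring V \<longleftrightarrow> 1 \<in> V \<and> (\<forall>x\<in>V. - x \<in> V) \<and> (\<forall>x\<in>V. \<forall>y\<in>V. x + y \<in> V) \<and> (\<forall>x\<in>V. \<forall>y\<in>V. x * y \<in> V)"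

text \<open>Valuation rings of the whole complex field. They serve twice: their intersection is the
  ring of algebraic integers, and one that does not contain 1 / p carries an extension of the p-adic
  absolute value.\<close>

definition valring :: "complex set \<Rightarrow> bool" where
  "valring V \<longleftrightarrow> csubring V \<and> (\<forall>y. y \<in> V \<or> inverse y \<in> V)"

lemma csubring_0: "csubring V \<Longrightarrow> 0 \<in> V"
  by (metis ab_group_add_class.ab_left_minus csubring_def)

lemma csubring_diff: "csubring V \<Longrightarrow> x \<in> V \<Longrightarrow> y \<in> V \<Longrightarrow> x - y \<in> V"
  by (metis csubring_def diff_conv_add_uminus)

lemma csubring_power: "csubring V \<Longrightarrow> x \<in> V \<Longrightarrow> x ^ n \<in> V"
  by (induction n) (auto simp: csubring_def)

lemma csubring_sum: "csubring V \<Longrightarrow> (\<And>i. i \<in> I \<Longrightarrow> f i \<in> V) \<Longrightarrow> sum f I \<in> V"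
  by (induction I rule: infinite_finite_induct) (auto simp: csubring_0 csubring_def)

lemma csubring_of_nat: "csubring V \<Longrightarrow> of_nat n \<in> V"
  by (induction n) (auto simp: csubring_0 csubring_def)

lemma csubring_of_int: "csubring V \<Longrightarrow> of_int n \<in> V"
  by (cases n) (auto simp: csubring_of_nat csubring_def simp del: of_nat_Suc)

lemma csubring_Ints: "csubring V \<Longrightarrow> x \<in> \<int> \<Longrightarrow> x \<in> V"
  by (auto elim!: Ints_cases simp: csubring_of_int)

definition cpoly_over :: "complex set \<Rightarrow> complex poly set" where
  "cpoly_over V = {p. \<forall>i. coeff p i \<in> V}"

lemma cpoly_over_add: "csubring V \<Longrightarrow> p \<in> cpoly_over V \<Longrightarrow> q \<in> cpoly_over V \<Longrightarrow> p + q \<in> cpoly_over V"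
  by (auto simp: cpoly_over_def csubring_def)

lemma cpoly_over_diff: "csubring V \<Longrightarrow> p \<in> cpoly_over V \<Longrightarrow> q \<in> cpoly_over V \<Longrightarrow> p - q \<in> cpoly_over V"
  by (auto simp: cpoly_over_def csubring_diff)

lemma cpoly_over_smult: "csubring V \<Longrightarrow> c \<in> V \<Longrightarrow> p \<in> cpoly_over V \<Longrightarrow> smult c p \<in> cpoly_over V"
  by (auto simp: cpoly_over_def csubring_def)

lemma cpoly_over_monom: "csubring V \<Longrightarrow> c \<in> V \<Longrightarrow> monom c n \<in> cpoly_over V"
  by (auto simp: cpoly_over_def csubring_0)

lemma cpoly_over_sum: "csubring V \<Longrightarrow> (\<And>i. i \<in> I \<Longrightarrow> f i \<in> cpoly_over V) \<Longrightarrow> sum f I \<in> cpoly_over V"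
  by (auto simp: cpoly_over_def coeff_sum intro!: csubring_sum)

lemma poly_in_csubring: "csubring V \<Longrightarrow> p \<in> cpoly_over V \<Longrightarrow> x \<in> V \<Longrightarrow> poly p x \<in> V"
  unfolding poly_altdef cpoly_over_def
  by (intro csubring_sum) (auto simp: csubring_power csubring_def)

lemma cpoly_over_mult:
  assumes "csubring V" "p \<in> cpoly_over V" "q \<in> cpoly_over V"
  shows "p * q \<in> cpoly_over V"
proof -
  have "coeff (p * q) i \<in> V" for i unfolding Polynomial.coeff_mult
    using assms by (intro csubring_sum) (auto simp: cpoly_over_def csubring_def)
  thus ?thesis by (simp add: cpoly_over_def)
qed

definition ring_adjoin :: "complex set \<Rightarrow> complex \<Rightarrow> complex set" where
  "ring_adjoin V y = (\<lambda>p. poly p y) ` cpoly_over V"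

lemma csubring_ring_adjoin:
  assumes "csubring V"
  shows "csubring (ring_adjoin V y)" "V \<subseteq> ring_adjoin V y" "y \<in> ring_adjoin V y"
proof -
  have mon: "monom c n \<in> cpoly_over V" if "c \<in> V" for c n
    using assms that by (rule cpoly_over_monom)
  have 1: "1 \<in> V" using assms by (simp add: csubring_def)
  show "y \<in> ring_adjoin V y"
    unfolding ring_adjoin_def by (rule image_eqI[OF _ mon[OF 1, of 1]]) (simp add: poly_monom)
  show "V \<subseteq> ring_adjoin V y" unfolding ring_adjoin_def
  proof
    fix x assume "x \<in> V"
    thus "x \<in> (\<lambda>p. poly p y) ` cpoly_over V"
      by (intro image_eqI[OF _ mon[of x 0]]) (simp_all add: poly_monom)
  qed
  have "- p \<in> cpoly_over V" if "p \<in> cpoly_over V" for p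
    using that assms by (auto simp: cpoly_over_def csubring_def)
  moreover have "1 \<in> cpoly_over V" using mon[OF 1, of 0] by (simp add: monom_0 one_pCons)
  ultimately show "csubring (ring_adjoin V y)"
    using cpoly_over_add[OF assms] cpoly_over_mult[OF assms] unfolding csubring_def ring_adjoin_def
    by (auto simp flip: poly_add poly_mult poly_minus intro!: imageI)
       (metis image_eqI poly_1)
qed

text \<open>Multiplying x = p(1 / x) by x ^ n, where n is the degree of p, makes \<open>x\<close> a
  root of the monic integer polynomial X ^ (n + 1) minus the reversal of p.\<close>

lemma not_algebraic_int_imp_not_in_ring_adjoin:
  assumes "\<not> algebraic_int x"
  shows "x \<notin> ring_adjoin \<int> (inverse x)"
proof
  assume "x \<in> ring_adjoin \<int> (inverse x)"
  then obtain p where p: "p \<in> cpoly_over \<int>" "x = poly p (inverse x)" by (auto simp: ring_adjoin_def)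
  have "x \<noteq> 0" using assms by auto
  define n where "n = degree p"
  define q where "q = monom 1 (Suc n) - reflect_poly p"
  have deg: "degree (reflect_poly p) < Suc n"
    using degree_reflect_poly_le[of p] by (simp add: n_def)
  have "coeff q (Suc n) = 1" using deg by (simp add: q_def coeff_eq_0)
  moreover have "degree q \<le> Suc n"
    using deg unfolding q_def by (intro degree_diff_le degree_monom_le) simp
  ultimately have "lead_coeff q = 1" by (metis le_antisym le_degree zero_neq_one)
  moreover have "coeff q i \<in> \<int>" for i
    using p(1) by (auto simp: q_def cpoly_over_def coeff_reflect_poly)
  moreover have "poly q x = 0"
    using \<open>x \<noteq> 0\<close> p(2) by (simp add: q_def poly_monom poly_reflect_poly_nz n_def)
  ultimately have "algebraic_int x" by (intro algebraic_int.intros) auto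
  thus False using assms by simp
qed

lemma csubring_Ints_set: "csubring \<int>"
  by (auto simp: csubring_def)

lemma csubring_Union_chain:
  assumes "subset.chain A C" "C \<noteq> {}" "\<And>V. V \<in> A \<Longrightarrow> csubring V"
  shows "csubring (\<Union>C)"
proof -
  have sub: "csubring V" if "V \<in> C" for V using that assms by (auto simp: subset_chain_def)
  have common: "\<exists>V\<in>C. x \<in> V \<and> y \<in> V" if "x \<in> \<Union>C" "y \<in> \<Union>C" for x y
    using that assms(1) unfolding subset_chain_def by blast
  show ?thesis unfolding csubring_def
  proof (intro conjI ballI)
    show "1 \<in> \<Union>C" using assms(2) sub by (auto simp: csubring_def)
  next
    fix x assume "x \<in> \<Union>C"
    then obtain V where "V \<in> C" "x \<in> V" by blast
    thus "- x \<in> \<Union>C" using sub[of V] by (auto simp: csubring_def)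
  next
    fix x y assume "x \<in> \<Union>C" "y \<in> \<Union>C"
    then obtain V where "V \<in> C" "x \<in> V" "y \<in> V" using common by blast
    moreover from this have "x + y \<in> V" "x * y \<in> V" using sub[of V] unfolding csubring_def by blast+
    ultimately show "x + y \<in> \<Union>C" "x * y \<in> \<Union>C" by (blast intro: UnionI)+
  qed
qed

text \<open>A subring maximal among those that contain \<open>1 / x\<close> but not \<open>x\<close> is a valuation ring:
  otherwise \<open>x\<close> would be a polynomial both in \<open>y\<close> and in \<open>1 / y\<close>, and the polynomial of
  larger degree could be reduced by the other one.\<close>
lemma valring_excluding:
  assumes "\<not> algebraic_int x"
  obtains V where "valring V" "x \<notin> V" "inverse x \<in> V"
proof -
  have x0: "x \<noteq> 0" using assms by auto
  define R0 where "R0 = ring_adjoin \<int> (inverse x)"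
  have R0: "csubring R0" "inverse x \<in> R0" "x \<notin> R0"
    using csubring_ring_adjoin[OF csubring_Ints_set] not_algebraic_int_imp_not_in_ring_adjoin[OF assms]
    by (auto simp: R0_def)
  define A where "A = {V. csubring V \<and> R0 \<subseteq> V \<and> x \<notin> V}"
  have "\<exists>M\<in>A. \<forall>S\<in>A. M \<subseteq> S \<longrightarrow> S = M"
  proof (rule subset_Zorn_nonempty)
    show "A \<noteq> {}" using R0 by (auto simp: A_def)
  next
    fix C assume C: "C \<noteq> {}" "subset.chain A C"
    have "csubring (\<Union>C)" by (rule csubring_Union_chain[OF C(2,1)]) (simp add: A_def)
    moreover have "C \<subseteq> A" using C(2) by (simp add: subset_chain_def)
    ultimately show "\<Union>C \<in> A" using C(1) unfolding A_def by blast
  qed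
  then obtain M where M: "M \<in> A" and max: "\<And>S. S \<in> A \<Longrightarrow> M \<subseteq> S \<Longrightarrow> S = M" by blast
  define t where "t = inverse x"
  have Msub: "csubring M" and xM: "x \<notin> M" and tM: "t \<in> M" using M R0 by (auto simp: A_def t_def)
  have xt: "x * t = 1" "t * x = 1" using x0 by (simp_all add: t_def)
  \<comment> \<open>Maximality of M: adjoining any element outside M brings in x.\<close>
  have adj: "\<exists>p\<in>cpoly_over M. x = poly p y" if "y \<notin> M" for y
  proof (rule ccontr)
    assume "\<not> (\<exists>p\<in>cpoly_over M. x = poly p y)"
    hence "x \<notin> ring_adjoin M y" by (auto simp: ring_adjoin_def)
    hence "ring_adjoin M y \<in> A" using csubring_ring_adjoin[OF Msub, of y] M by (auto simp: A_def)
    hence "ring_adjoin M y = M" using max csubring_ring_adjoin[OF Msub] by blast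
    thus False using csubring_ring_adjoin(3)[OF Msub, of y] that by simp
  qed
  \<comment> \<open>t lies in the Jacobson radical of M. If x is a polynomial of degree k in the
    inverse of w = 1 - t a, then x w ^ k is in M; as w ^ k is 1 modulo t M and x t = 1, it differs
    from x by an element of M.\<close>
  have unit: "inverse (1 - t * a) \<in> M" if a: "a \<in> M" for a
  proof (rule ccontr)
    assume "inverse (1 - t * a) \<notin> M"
    then obtain h where h: "h \<in> cpoly_over M" "x = poly h (inverse (1 - t * a))" using adj by blast
    define w where "w = 1 - t * a"
    have "w \<noteq> 0"
    proof
      assume "w = 0"
      hence "a = x" using xt by (metis w_def eq_iff_diff_eq_0 mult.left_commute mult.right_neutral)
      thus False using a xM by simp
    qed
    define k where "k = degree h"
    have "w \<in> M" using a tM Msub csubring_diff by (simp add: w_def csubring_def)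
    have "x * w ^ k = poly (reflect_poly h) w"
      using h(2) \<open>w \<noteq> 0\<close> by (simp add: poly_reflect_poly_nz k_def w_def mult.commute)
    also have "\<dots> \<in> M"
    proof (rule poly_in_csubring[OF Msub _ \<open>w \<in> M\<close>])
      show "reflect_poly h \<in> cpoly_over M"
        using h(1) csubring_0[OF Msub] by (auto simp: cpoly_over_def coeff_reflect_poly)
    qed
    finally have xw: "x * w ^ k \<in> M" .
    have "\<exists>b\<in>M. w ^ k = 1 - t * b" for k
    proof (induction k)
      case 0
      show ?case using csubring_0[OF Msub] by (intro bexI[of _ 0]) auto
    next
      case (Suc k)
      then obtain b where b: "b \<in> M" "w ^ k = 1 - t * b" by blast
      have "w ^ Suc k = 1 - t * (a + b - t * a * b)"
        by (simp only: power_Suc b(2)) (simp add: w_def algebra_simps)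
      moreover have "a + b - t * a * b \<in> M"
        using a b tM Msub by (intro csubring_diff) (auto simp: csubring_def)
      ultimately show ?case by blast
    qed
    then obtain b where b: "b \<in> M" "w ^ k = 1 - t * b" by blast
    have "x * w ^ k = x * (1 - t * b)" using b by simp
    also have "\<dots> = x - (x * t) * b" by (simp add: algebra_simps)
    finally have "x * w ^ k = x - b" using xt by simp
    hence "x = x * w ^ k + b" by simp
    hence "x \<in> M" using xw b(1) Msub by (metis csubring_def)
    thus False using xM by simp
  qed
  define Q where "Q = (\<lambda>y n. \<exists>p\<in>cpoly_over M. degree p \<le> n \<and> x = poly p y)"
  have reduce: "\<exists>n'<n. Q y n'" if "Q y n" "Q (inverse y) m" "m \<le> n" "y \<noteq> 0" for y n m
  proof -
    obtain f where f: "f \<in> cpoly_over M" "degree f \<le> n" "x = poly f y"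
      using \<open>Q y n\<close> by (auto simp: Q_def)
    obtain g where g: "g \<in> cpoly_over M" "degree g \<le> m" "x = poly g (inverse y)"
      using \<open>Q (inverse y) m\<close> by (auto simp: Q_def)
    have "n \<noteq> 0"
    proof
      assume "n = 0"
      hence "f = [:coeff f 0:]" using f(2) by (simp add: degree_0_id)
      hence "x = coeff f 0" using f(3) by (metis mult_zero_right poly_pCons poly_0 add.right_neutral)
      thus False using f(1) xM by (auto simp: cpoly_over_def)
    qed
    \<comment> \<open>Multiplied by t, the relation x = g(1 / y) reads 1 - t g_0 = t (g_1 / y + ...
      + g_m / y ^ m). The left side is a unit by \<open>unit\<close>, so y ^ n is a combination of
      lower powers of y, and the top term of f can be replaced.\<close>
    define u where "u = inverse (1 - t * coeff g 0)"
    have uM: "u \<in> M" using unit g(1) by (auto simp: u_def cpoly_over_def)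
    have "1 - t * coeff g 0 \<noteq> 0"
    proof
      assume "1 - t * coeff g 0 = 0"
      hence "coeff g 0 = x" using xt by (metis eq_iff_diff_eq_0 mult.left_commute mult.right_neutral)
      thus False using g(1) xM by (auto simp: cpoly_over_def)
    qed
    hence u: "u * (1 - t * coeff g 0) = 1" by (simp add: u_def)
    define r where "r = (\<Sum>j=1..m. monom (t * u * coeff g j) (n - j))"
    have rM: "r \<in> cpoly_over M" unfolding r_def using g(1) tM uM Msub
      by (intro cpoly_over_sum cpoly_over_monom) (auto simp: cpoly_over_def csubring_def)
    have rdeg: "degree r \<le> n - 1" unfolding r_def using \<open>n \<noteq> 0\<close>
      by (intro degree_sum_le) (auto intro!: order.trans[OF degree_monom_le])
    have "x = (\<Sum>j\<le>m. coeff g j * inverse y ^ j)" using g(2,3) poly_altdef[of g "inverse y"]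
      by (subst g(3), subst poly_altdef, intro sum.mono_neutral_left) (auto simp: coeff_eq_0)
    also have "\<dots> = coeff g 0 + (\<Sum>j=1..m. coeff g j * inverse y ^ j)"
      by (simp add: atMost_atLeast0 sum.atLeast_Suc_atMost)
    finally have "t * x = t * coeff g 0 + t * (\<Sum>j=1..m. coeff g j * inverse y ^ j)"
      by (metis distrib_left)
    hence "1 - t * coeff g 0 = t * (\<Sum>j=1..m. coeff g j * inverse y ^ j)"
      using xt by (simp add: diff_eq_eq add.commute)
    hence "u * (1 - t * coeff g 0) = t * u * (\<Sum>j=1..m. coeff g j * inverse y ^ j)"
      by (simp add: mult.assoc)
    hence "y ^ n = y ^ n * (t * u * (\<Sum>j=1..m. coeff g j * inverse y ^ j))" using u by simp
    also have "\<dots> = (\<Sum>j=1..m. t * u * coeff g j * (y ^ n * inverse y ^ j))"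
      by (simp add: sum_distrib_left mult_ac)
    also have "\<dots> = (\<Sum>j=1..m. t * u * coeff g j * y ^ (n - j))"
      using \<open>y \<noteq> 0\<close> \<open>m \<le> n\<close> by (intro sum.cong refl) (auto simp: power_diff field_simps)
    also have "\<dots> = poly r y" by (simp add: r_def poly_sum poly_monom)
    finally have yn: "y ^ n = poly r y" .
    define f' where "f' = f - monom (coeff f n) n + smult (coeff f n) r"
    have "f' \<in> cpoly_over M" unfolding f'_def using f(1) rM Msub
      by (intro cpoly_over_add cpoly_over_diff cpoly_over_smult cpoly_over_monom) (auto simp: cpoly_over_def)
    moreover have "poly f' y = x" using f(3) yn by (simp add: f'_def poly_monom)
    moreover have "degree f' \<le> n - 1"
    proof -
      have "degree (f - monom (coeff f n) n) \<le> n - 1"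
      proof (rule degree_le, intro allI impI)
        fix i assume "n - 1 < i"
        thus "coeff (f - monom (coeff f n) n) i = 0"
          using f(2) \<open>n \<noteq> 0\<close> by (cases "i = n") (auto simp: coeff_eq_0)
      qed
      thus ?thesis unfolding f'_def
        using rdeg by (intro degree_add_le) (auto intro: order.trans[OF degree_smult_le])
    qed
    ultimately have "Q y (n - 1)" by (auto simp: Q_def)
    thus ?thesis using \<open>n \<noteq> 0\<close> by (intro exI[of _ "n - 1"]) auto
  qed
  have "y \<in> M \<or> inverse y \<in> M" for y
  proof (rule ccontr)
    assume *: "\<not> (y \<in> M \<or> inverse y \<in> M)"
    hence "y \<noteq> 0" using csubring_0[OF Msub] by auto
    have ex: "\<exists>n. Q y n" "\<exists>m. Q (inverse y) m" using * adj unfolding Q_def by blast+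
    define n where "n = (LEAST n. Q y n)"
    define m where "m = (LEAST m. Q (inverse y) m)"
    have n: "Q y n" "\<And>k. k < n \<Longrightarrow> \<not> Q y k"
      using ex(1) unfolding n_def by (auto intro: LeastI_ex dest: not_less_Least)
    have m: "Q (inverse y) m" "\<And>k. k < m \<Longrightarrow> \<not> Q (inverse y) k"
      using ex(2) unfolding m_def by (auto intro: LeastI_ex dest: not_less_Least)
    show False
    proof (cases "m \<le> n")
      case True
      thus False using reduce[OF n(1) m(1)] n(2) \<open>y \<noteq> 0\<close> by blast
    next
      case False
      thus False using reduce[of "inverse y" m n] n(1) m \<open>y \<noteq> 0\<close> by force
    qed
  qed
  hence "valring M" using Msub by (simp add: valring_def)
  thus thesis using that xM tM by (simp add: t_def)
qed

text \<open>If \<open>x\<close> is outside \<open>V\<close>, then 1 / x is inside, and multiplying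
  the equation by (1 / x) ^ (n - 1) expresses the product as a polynomial in 1 / x. Keeping the
  leading coefficient covers monic polynomials and the clearing of denominators alike.\<close>

lemma lead_coeff_mult_root_in_valring:
  assumes V: "valring V" and p: "poly p x = 0" "p \<noteq> 0" "\<forall>i. coeff p i \<in> \<int>"
  shows "lead_coeff p * x \<in> V"
proof (cases "x \<in> V")
  case True
  thus ?thesis using V p(3) csubring_Ints by (metis csubring_def valring_def)
next
  case False
  have Vs: "csubring V" and y: "inverse x \<in> V" and x0: "x \<noteq> 0"
    using V False csubring_0 by (auto simp: valring_def)
  define n where "n = degree p"
  have "n \<noteq> 0"
  proof
    assume "n = 0"
    then obtain c where "p = [:c:]" by (metis n_def degree_eq_zeroE)
    thus False using p by auto
  qed
  then obtain k where k: "n = Suc k" by (cases n) auto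
  have "0 = (\<Sum>i\<le>n. coeff p i * x ^ i)" using p(1) by (simp add: poly_altdef n_def)
  also have "\<dots> = coeff p n * x ^ n + (\<Sum>i\<le>k. coeff p i * x ^ i)" by (simp add: k)
  finally have "coeff p n * x ^ n = - (\<Sum>i\<le>k. coeff p i * x ^ i)" by (simp add: eq_neg_iff_add_eq_0)
  hence main: "coeff p n * x ^ n * inverse x ^ k = - (\<Sum>i\<le>k. coeff p i * x ^ i) * inverse x ^ k"
    by simp
  have pow: "x ^ i * inverse x ^ k = inverse x ^ (k - i)" if "i \<le> k" for i
  proof -
    have "inverse x ^ k = inverse x ^ i * inverse x ^ (k - i)" using that by (simp flip: power_add)
    moreover have "x ^ i * inverse x ^ i = 1" using x0 by (simp flip: power_mult_distrib)
    ultimately show ?thesis by (metis mult.assoc mult.left_neutral)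
  qed
  have "coeff p n * x ^ n * inverse x ^ k = coeff p n * x"
    using pow[of k] by (simp add: k mult.assoc)
  moreover have "(\<Sum>i\<le>k. coeff p i * x ^ i) * inverse x ^ k = (\<Sum>i\<le>k. coeff p i * inverse x ^ (k - i))"
    unfolding sum_distrib_right by (intro sum.cong refl) (simp add: pow mult.assoc)
  ultimately have "coeff p n * x = - (\<Sum>i\<le>k. coeff p i * inverse x ^ (k - i))"
    using main by (metis minus_mult_left)
  hence "lead_coeff p * x = - (\<Sum>i\<le>k. coeff p i * inverse x ^ (k - i))" by (simp only: n_def)
  moreover have "(\<Sum>i\<le>k. coeff p i * inverse x ^ (k - i)) \<in> V"
  proof (rule csubring_sum[OF Vs])
    fix i
    have "coeff p i \<in> V" "inverse x ^ (k - i) \<in> V"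
      using Vs y p(3) csubring_Ints csubring_power by blast+
    thus "coeff p i * inverse x ^ (k - i) \<in> V" using Vs by (simp add: csubring_def)
  qed
  ultimately show ?thesis using Vs by (simp add: csubring_def)
qed

text \<open>One direction is integral closedness, the other is \<open>valring_excluding\<close>.
  Membership in all valuation rings is visibly preserved by sums and products, which is how
  algebraic integers are seen to form a ring.\<close>

lemma algebraic_int_iff_valring: "algebraic_int x \<longleftrightarrow> (\<forall>V. valring V \<longrightarrow> x \<in> V)"
proof
  assume "algebraic_int x"
  then obtain p where p: "lead_coeff p = 1" "\<forall>i. coeff p i \<in> \<int>" "poly p x = 0"
    by (auto elim: algebraic_int.cases)
  moreover have "p \<noteq> 0" using p(1) by auto
  ultimately show "\<forall>V. valring V \<longrightarrow> x \<in> V" using lead_coeff_mult_root_in_valring[of _ p x] by simp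
next
  assume "\<forall>V. valring V \<longrightarrow> x \<in> V"
  thus "algebraic_int x" using valring_excluding by metis
qed

lemma algebraic_int_add: "algebraic_int x \<Longrightarrow> algebraic_int y \<Longrightarrow> algebraic_int (x + y :: complex)"
  and algebraic_int_mult: "algebraic_int x \<Longrightarrow> algebraic_int y \<Longrightarrow> algebraic_int (x * y :: complex)"
  unfolding algebraic_int_iff_valring by (auto simp: valring_def csubring_def)

lemma algebraic_int_power: "algebraic_int x \<Longrightarrow> algebraic_int (x ^ n :: complex)"
  by (induction n) (auto intro: algebraic_int_mult)

lemma algebraic_int_prod: "(\<And>i. i \<in> I \<Longrightarrow> algebraic_int (f i)) \<Longrightarrow> algebraic_int (prod f I :: complex)"
  by (induction I rule: infinite_finite_induct) (auto intro: algebraic_int_mult)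

text \<open>With denominators cleared, closure of the algebraic numbers under sums and products
  reduces to that of the algebraic integers.\<close>

lemma algebraic_int_multiple:
  assumes "algebraic (x :: complex)"
  obtains c :: int where "c \<noteq> 0" "algebraic_int (of_int c * x)"
proof -
  obtain p where p: "p \<noteq> 0" "poly (map_poly of_int p) x = 0" using assms by (rule algebraicE')
  have "algebraic_int (lead_coeff (map_poly of_int p) * x)" unfolding algebraic_int_iff_valring
    using p by (intro allI impI lead_coeff_mult_root_in_valring) (auto simp: map_poly_eq_0_iff coeff_map_poly)
  thus thesis using p(1) by (intro that[of "lead_coeff p"]) (auto simp: coeff_map_poly degree_map_poly)
qed

lemma algebraic_of_int_mult:
  assumes "algebraic (of_int c * x)" "c \<noteq> 0"
  shows "algebraic (x :: complex)"
proof -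
  obtain p where p: "p \<noteq> 0" "ev p (of_int c * x) = 0"
    using assms(1) by (auto simp: algebraic_iff_ev)
  have "ev (pcompose p [:0, of_int c:]) x = 0" using p(2) by (simp add: mult.commute)
  moreover have "pcompose p [:0, of_int c:] \<noteq> 0"
    using p(1) assms(2) pcompose_eq_0[of p "[:0, of_int c:]"] by auto
  ultimately show ?thesis by (auto simp: algebraic_iff_ev)
qed

lemma algebraic_add:
  assumes "algebraic x" "algebraic (y :: complex)"
  shows "algebraic (x + y)"
proof -
  obtain c where c: "c \<noteq> 0" "algebraic_int (of_int c * x)"
    using algebraic_int_multiple[OF assms(1)] .
  obtain d where d: "d \<noteq> 0" "algebraic_int (of_int d * y)"
    using algebraic_int_multiple[OF assms(2)] .
  have "algebraic_int (of_int d * (of_int c * x) + of_int c * (of_int d * y))"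
    by (rule algebraic_int_add[OF algebraic_int_mult[OF algebraic_int_of_int c(2)] algebraic_int_mult[OF algebraic_int_of_int d(2)]])
  moreover have "of_int d * (of_int c * x) + of_int c * (of_int d * y) = of_int (c * d) * (x + y)"
    by (simp add: algebra_simps)
  ultimately have "algebraic (of_int (c * d) * (x + y))" by (metis algebraic_int_imp_algebraic)
  thus ?thesis using c(1) d(1) by (metis algebraic_of_int_mult mult_eq_0_iff)
qed

lemma algebraic_of_nat_mult:
  assumes "algebraic (x :: complex)"
  shows "algebraic (of_nat k * x)"
proof -
  obtain c where c: "c \<noteq> 0" "algebraic_int (of_int c * x)" using algebraic_int_multiple[OF assms] .
  have "algebraic_int (of_nat k * (of_int c * x))"
    by (rule algebraic_int_mult[OF algebraic_int_of_nat c(2)])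
  hence "algebraic (of_int c * (of_nat k * x))"
    by (metis algebraic_int_imp_algebraic mult.left_commute)
  thus ?thesis using c(1) algebraic_of_int_mult by blast
qed

section \<open>Primitive elements and Galois conjugation\<close>

lemma csubring_Qadj: "csubring (Qadj x)"
  by (auto simp: csubring_def)

lemma map_poly_of_rat_over_Qadj: "map_poly of_rat p \<in> cpoly_over (Qadj x)"
  by (auto simp: cpoly_over_def coeff_map_poly)

lemma cpoly_over_const: "csubring V \<Longrightarrow> c \<in> V \<Longrightarrow> [:c:] \<in> cpoly_over V"
  using cpoly_over_monom[of V c 0] by (simp add: monom_0)

lemma cpoly_over_pcompose:
  assumes "csubring V" "p \<in> cpoly_over V" "q \<in> cpoly_over V"
  shows "pcompose p q \<in> cpoly_over V"
  using assms(2)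
proof (induction p)
  case 0
  thus ?case by simp
next
  case (pCons a p)
  hence "a \<in> V" "p \<in> cpoly_over V" by (force simp: cpoly_over_def coeff_pCons split: nat.splits)+
  thus ?case
    using pCons.IH assms by (simp add: pcompose_pCons cpoly_over_add cpoly_over_mult cpoly_over_const)
qed

text \<open>Long division, where only the leading coefficient of \<open>d\<close> is inverted. What
  matters is that the remainder stays over \<open>F\<close>, so that a polynomial of least degree
  over \<open>F\<close> with a given root divides all others with that root.\<close>

lemma cpoly_over_division:
  assumes F: "csubring F" "\<And>x. x \<in> F \<Longrightarrow> inverse x \<in> F"
    and d: "d \<in> cpoly_over F" "d \<noteq> 0"
    and p: "p \<in> cpoly_over F"
  shows "\<exists>q r. r \<in> cpoly_over F \<and> p = q * d + r \<and> (r = 0 \<or> degree r < degree d)"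
  using p
proof (induction "degree p" arbitrary: p rule: less_induct)
  case less
  show ?case
  proof (cases "p = 0 \<or> degree p < degree d")
    case True
    thus ?thesis using less.prems by (intro exI[of _ 0] exI[of _ p]) auto
  next
    case False
    define c where "c = monom (lead_coeff p * inverse (lead_coeff d)) (degree p - degree d)"
    define p' where "p' = p - c * d"
    have c: "c \<in> cpoly_over F"
      unfolding c_def using F d less.prems by (intro cpoly_over_monom) (auto simp: cpoly_over_def csubring_def)
    hence p': "p' \<in> cpoly_over F"
      unfolding p'_def using F d less.prems by (intro cpoly_over_diff cpoly_over_mult) auto
    have "degree d \<le> degree p" using False by simp
    hence "degree (c * d) \<le> degree p"
      using degree_monom_le[of "lead_coeff p * inverse (lead_coeff d)" "degree p - degree d"]
      unfolding c_def by (intro order.trans[OF degree_mult_le]) simp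
    hence "degree p' \<le> degree p" unfolding p'_def by (intro degree_diff_le) auto
    moreover have "coeff p' (degree p) = 0"
      using False d(2) by (simp add: p'_def c_def coeff_monom_mult)
    ultimately have "p' = 0 \<or> degree p' < degree p" by (rule eq_zero_or_degree_less)
    thus ?thesis
    proof
      assume "p' = 0"
      hence "p = c * d + 0" by (simp add: p'_def)
      thus ?thesis using csubring_0[OF F(1)] by (intro exI[of _ c] exI[of _ 0]) (auto simp: cpoly_over_def)
    next
      assume "degree p' < degree p"
      then obtain q r where qr: "r \<in> cpoly_over F" "p' = q * d + r" "r = 0 \<or> degree r < degree d"
        using less.hyps p' by blast
      have "p = (c + q) * d + r" using qr(2) by (simp add: p'_def algebra_simps)
      thus ?thesis using qr by blast
    qed
  qed
qed

text \<open>For all but finitely many \<open>k\<close>, \<open>b\<close> is the only common root of the minimal polynomial of \<open>b\<close>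
  and of \<open>P (\<theta> - k X)\<close>, where \<open>P\<close> is the minimal polynomial of \<open>a\<close> and \<open>\<theta> = a + k b\<close>.\<close>
lemma primitive_element_two:
  assumes a: "algebraic a" and b: "algebraic b"
  obtains k :: nat where "a \<in> Qadj (a + of_nat k * b)" "b \<in> Qadj (a + of_nat k * b)"
proof -
  obtain ma where ma: "is_minpoly ma a" using minpoly_exists[OF a] .
  obtain mb where mb: "is_minpoly mb b" using minpoly_exists[OF b] .
  \<comment> \<open>\<theta> - k z is a conjugate a' of a, for some z \<noteq> b, only if k = (a' -
    a) / (b - z). The pairs with z = b contribute the value 0 of division by zero, which merely
    excludes k = 0.\<close>
  define bad where "bad = (\<lambda>(a', z). (a' - a) / (b - z)) ` (conjs a \<times> conjs b)"
  have "finite bad" unfolding bad_def using a b finite_conjs by blast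
  hence "finite ((of_nat :: nat \<Rightarrow> complex) -` bad)"
    by (intro finite_vimageI) (auto simp: inj_on_def)
  then obtain k :: nat where "k \<notin> of_nat -` bad" using ex_new_if_finite infinite_UNIV_nat by blast
  hence k: "of_nat k \<notin> bad" by simp
  define \<theta> where "\<theta> = a + of_nat k * b"
  have \<theta>: "algebraic \<theta>" unfolding \<theta>_def using a b by (intro algebraic_add algebraic_of_nat_mult)
  define F where "F = Qadj \<theta>"
  have F: "csubring F" "\<And>x. x \<in> F \<Longrightarrow> inverse x \<in> F"
    using \<theta> by (auto simp: F_def csubring_Qadj Qadj_inverse)
  define p where "p = pcompose (map_poly of_rat ma) [:\<theta>, - of_nat k:]"
  define q where "q = (map_poly of_rat mb :: complex poly)"
  have "[:\<theta>, - of_nat k:] \<in> cpoly_over F"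
    by (auto simp: F_def cpoly_over_def coeff_pCons Qadj_minus split: nat.splits)
  hence pF: "p \<in> cpoly_over F"
    unfolding p_def using F(1) map_poly_of_rat_over_Qadj by (intro cpoly_over_pcompose) (auto simp: F_def)
  have qF: "q \<in> cpoly_over F" using map_poly_of_rat_over_Qadj by (auto simp: F_def q_def)
  have pb: "poly p b = 0"
    using minpoly_root[OF ma] by (simp add: p_def poly_pcompose \<theta>_def ev_def algebra_simps)
  have qb: "poly q b = 0" using minpoly_root[OF mb] by (simp add: q_def ev_def)
  have q0: "q \<noteq> 0" using minpoly_nonzero[OF mb] by (simp add: q_def map_poly_eq_0_iff)
  have common: "z = b" if "poly p z = 0" "poly q z = 0" for z
  proof (rule ccontr)
    assume "z \<noteq> b"
    have "z \<in> conjs b" using that mb by (simp add: q_def ev_def conjs_eq_roots)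
    moreover have "\<theta> - of_nat k * z \<in> conjs a"
      using that ma by (simp add: p_def poly_pcompose ev_def conjs_eq_roots algebra_simps)
    ultimately have "(\<theta> - of_nat k * z - a) / (b - z) \<in> bad"
      unfolding bad_def by (force intro: image_eqI)
    moreover have "(\<theta> - of_nat k * z - a) / (b - z) = of_nat k"
      using \<open>z \<noteq> b\<close> by (simp add: \<theta>_def field_simps)
    ultimately show False using k by simp
  qed
  \<comment> \<open>d is, up to a scalar, the minimal polynomial of b over F = Q(\<theta>), so it
    divides both p and q.\<close>
  define R where "R = (\<lambda>d. d \<in> cpoly_over F \<and> d \<noteq> 0 \<and> poly d b = 0)"
  define d where "d = (ARG_MIN degree d. R d)"
  have "R q" using qF q0 qb by (simp add: R_def)
  hence d: "R d" and dmin: "\<And>e. R e \<Longrightarrow> degree d \<le> degree e"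
    using arg_min_nat_lemma[of R q degree] by (auto simp: d_def)
  have dvd: "d dvd f" if "f \<in> cpoly_over F" "poly f b = 0" for f
  proof -
    have "\<exists>u r. r \<in> cpoly_over F \<and> f = u * d + r \<and> (r = 0 \<or> degree r < degree d)"
      using F d that(1) by (intro cpoly_over_division) (auto simp: R_def)
    then obtain u r where ur: "r \<in> cpoly_over F" "f = u * d + r" "r = 0 \<or> degree r < degree d"
      by blast
    have "poly r b = 0" using ur(2) that d by (simp add: R_def)
    hence "r = 0" using dmin[of r] ur by (force simp: R_def)
    thus ?thesis using ur(2) by simp
  qed
  have "[:-b, 1:] dvd d" using d by (simp add: R_def poly_eq_0_iff_dvd)
  then obtain e where e: "d = [:-b, 1:] * e" by auto
  \<comment> \<open>A root z of e would be a common root of p and q, hence b itself, and b would be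
    a double root of the squarefree q. So d is a multiple of X - b, and its coefficients give b in
    F.\<close>
  have "degree e = 0"
  proof (rule ccontr)
    assume "degree e \<noteq> 0"
    hence "\<not> constant (poly e)" by (simp add: constant_degree)
    then obtain z where z: "poly e z = 0" using fundamental_theorem_of_algebra by blast
    have "poly d z = 0" using z e by simp
    hence "poly p z = 0" "poly q z = 0" using dvd[OF pF pb] dvd[OF qF qb] by (auto elim!: dvdE)
    hence "z = b" by (rule common)
    hence "[:-b, 1:] dvd e" using z by (simp add: poly_eq_0_iff_dvd)
    then obtain e' where "e = [:-b, 1:] * e'" by auto
    moreover obtain f where "q = d * f" using dvd[OF qF qb] by auto
    ultimately have "q = [:-b, 1:] * ([:-b, 1:] * (e' * f))" using e by (simp only: mult_ac)
    hence "poly (pderiv q) b = 0" by (simp only: pderiv_mult) simp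
    thus False using qb minpoly_rsquarefree[OF mb] by (auto simp: q_def rsquarefree_roots)
  qed
  then obtain c where c: "e = [:c:]" by (metis degree_eq_zeroE)
  have "c \<noteq> 0" using c e d by (auto simp: R_def)
  have "coeff d 0 = - b * c" "coeff d 1 = c" by (simp_all add: e c)
  moreover have "coeff d 0 \<in> F" "coeff d 1 \<in> F" using d by (auto simp: R_def cpoly_over_def)
  ultimately have "- (- b * c) * inverse c \<in> F" using F by (metis csubring_def)
  hence bF: "b \<in> F" using \<open>c \<noteq> 0\<close> by (simp add: mult.assoc)
  have "\<theta> - of_nat k * b \<in> F" using bF unfolding F_def by (intro Qadj_diff Qadj_mult) auto
  hence "a \<in> F" by (simp add: \<theta>_def)
  thus thesis using that bF by (simp add: F_def \<theta>_def)
qed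

text \<open>The generator is kept as an explicit combination with natural coefficients: an embedding
  then sends it to the same combination of conjugates, which makes the generated field normal when
  \<open>A\<close> is closed under conjugation.\<close>

lemma primitive_element:
  assumes "finite A" "\<And>x. x \<in> A \<Longrightarrow> algebraic x"
  obtains k :: "complex \<Rightarrow> nat" where "algebraic (\<Sum>x\<in>A. of_nat (k x) * x)" "A \<subseteq> Qadj (\<Sum>x\<in>A. of_nat (k x) * x)"
proof -
  have "\<exists>k :: complex \<Rightarrow> nat. algebraic (\<Sum>x\<in>A. of_nat (k x) * x) \<and> A \<subseteq> Qadj (\<Sum>x\<in>A. of_nat (k x) * x)"
    using assms
  proof (induction A rule: finite_induct)
    case (insert b A)
    then obtain k :: "complex \<Rightarrow> nat" where
      k: "algebraic (\<Sum>x\<in>A. of_nat (k x) * x)" "A \<subseteq> Qadj (\<Sum>x\<in>A. of_nat (k x) * x)" by auto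
    define \<theta> where "\<theta> = (\<Sum>x\<in>A. of_nat (k x) * x)"
    have b: "algebraic b" using insert by auto
    obtain l :: nat where l: "\<theta> \<in> Qadj (\<theta> + of_nat l * b)" "b \<in> Qadj (\<theta> + of_nat l * b)"
      using primitive_element_two[of \<theta> b] k(1) b by (auto simp: \<theta>_def)
    have eq: "(\<Sum>x\<in>insert b A. of_nat ((k(b := l)) x) * x) = \<theta> + of_nat l * b"
      using insert.hyps by (auto simp: \<theta>_def add.commute intro!: arg_cong2[of _ _ _ _ "(+)"] sum.cong)
    have "algebraic (\<theta> + of_nat l * b)"
      using k(1) b unfolding \<theta>_def by (intro algebraic_add algebraic_of_nat_mult)
    moreover have "insert b A \<subseteq> Qadj (\<theta> + of_nat l * b)"
      using l k(2) Qadj_subset[OF l(1)] by (auto simp: \<theta>_def)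
    ultimately show ?case unfolding eq[symmetric] by blast
  qed auto
  thus thesis using that by blast
qed

text \<open>Off \<open>\<rat>(\<theta>)\<close> the map is the identity, so that the conjugations of a normal field form a
  group under composition of total functions.\<close>
definition conj_map :: "complex \<Rightarrow> complex \<Rightarrow> complex \<Rightarrow> complex" where
  "conj_map \<theta> t x = (if x \<in> Qadj \<theta> then ev (SOME p. ev p \<theta> = x) t else x)"

text \<open>The choice of a polynomial is harmless: two with the same value at \<theta> differ by
  one that annihilates \<theta>, hence also its conjugate \<open>t\<close>.\<close>

lemma conj_map_ev:
  assumes "t \<in> conjs \<theta>"
  shows "conj_map \<theta> t (ev p \<theta>) = ev p t"
proof -
  define q where "q = (SOME q. ev q \<theta> = ev p \<theta>)"
  have "ev q \<theta> = ev p \<theta>" unfolding q_def by (rule someI_ex) auto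
  hence "ev (q - p) \<theta> = 0" by simp
  hence "ev (q - p) t = 0" using assms unfolding conjs_def by blast
  thus ?thesis by (simp add: conj_map_def q_def)
qed

lemma conj_map_add:
  "t \<in> conjs \<theta> \<Longrightarrow> x \<in> Qadj \<theta> \<Longrightarrow> y \<in> Qadj \<theta> \<Longrightarrow> conj_map \<theta> t (x + y) = conj_map \<theta> t x + conj_map \<theta> t y"
  by (elim QadjE) (simp add: conj_map_ev del: ev_add flip: ev_add)

lemma conj_map_mult:
  "t \<in> conjs \<theta> \<Longrightarrow> x \<in> Qadj \<theta> \<Longrightarrow> y \<in> Qadj \<theta> \<Longrightarrow> conj_map \<theta> t (x * y) = conj_map \<theta> t x * conj_map \<theta> t y"
  by (elim QadjE) (simp add: conj_map_ev del: ev_mult flip: ev_mult)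

lemma conj_map_of_rat: "t \<in> conjs \<theta> \<Longrightarrow> conj_map \<theta> t (of_rat q) = of_rat q"
  using conj_map_ev[of t \<theta> "[:q:]"] by simp

lemma conj_map_ev_comp:
  "t \<in> conjs \<theta> \<Longrightarrow> x \<in> Qadj \<theta> \<Longrightarrow> conj_map \<theta> t (ev p x) = ev p (conj_map \<theta> t x)"
  by (elim QadjE) (simp add: conj_map_ev del: ev_pcompose flip: ev_pcompose)

lemma conj_map_in_conjs:
  assumes "t \<in> conjs \<theta>" "x \<in> Qadj \<theta>"
  shows "conj_map \<theta> t x \<in> conjs x"
  using conj_map_ev_comp[OF assms] conj_map_of_rat[OF assms(1), of 0]
  by (auto simp: conjs_def) (metis)

lemma conj_map_inj_on:
  assumes "algebraic \<theta>" "t \<in> conjs \<theta>"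
  shows "inj_on (conj_map \<theta> t) (Qadj \<theta>)"
proof (rule inj_onI, elim QadjE)
  fix x y p q
  assume *: "conj_map \<theta> t x = conj_map \<theta> t y" "x = ev p \<theta>" "y = ev q \<theta>"
  hence "ev (p - q) t = 0" using assms by (simp add: conj_map_ev)
  moreover have "\<theta> \<in> conjs t" using conjs_eq[OF assms] by simp
  ultimately have "ev (p - q) \<theta> = 0" unfolding conjs_def by blast
  thus "x = y" using * by simp
qed

section \<open>The Galois group of a normal number field\<close>

locale normal_generator =
  fixes \<theta> :: complex
  assumes alg: "algebraic \<theta>" and normal: "conjs \<theta> \<subseteq> Qadj \<theta>"
begin

definition G :: "(complex \<Rightarrow> complex) set" where
  "G = conj_map \<theta> ` conjs \<theta>"

lemma finite_G: "finite G"
  using finite_conjs[OF alg] by (simp add: G_def)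

lemma G_add: "\<sigma> \<in> G \<Longrightarrow> x \<in> Qadj \<theta> \<Longrightarrow> y \<in> Qadj \<theta> \<Longrightarrow> \<sigma> (x + y) = \<sigma> x + \<sigma> y"
  by (auto simp: G_def conj_map_add)

lemma G_mult: "\<sigma> \<in> G \<Longrightarrow> x \<in> Qadj \<theta> \<Longrightarrow> y \<in> Qadj \<theta> \<Longrightarrow> \<sigma> (x * y) = \<sigma> x * \<sigma> y"
  by (auto simp: G_def conj_map_mult)

lemma G_of_rat: "\<sigma> \<in> G \<Longrightarrow> \<sigma> (of_rat q) = of_rat q"
  by (auto simp: G_def conj_map_of_rat)

lemma G_01: "\<sigma> \<in> G \<Longrightarrow> \<sigma> 0 = 0" "\<sigma> \<in> G \<Longrightarrow> \<sigma> 1 = 1"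
  using G_of_rat[of \<sigma> 0] G_of_rat[of \<sigma> 1] by simp_all

lemma G_minus: "\<sigma> \<in> G \<Longrightarrow> x \<in> Qadj \<theta> \<Longrightarrow> \<sigma> (- x) = - \<sigma> x"
  using G_mult[of \<sigma> "of_rat (-1)" x] G_of_rat[of \<sigma> "-1"] by (simp add: of_rat_minus Qadj_minus)

lemma G_conjs: "\<sigma> \<in> G \<Longrightarrow> x \<in> Qadj \<theta> \<Longrightarrow> \<sigma> x \<in> conjs x"
  by (auto simp: G_def conj_map_in_conjs)

lemma G_closed: "\<sigma> \<in> G \<Longrightarrow> x \<in> Qadj \<theta> \<Longrightarrow> \<sigma> x \<in> Qadj \<theta>"
  using normal by (elim QadjE) (auto simp: G_def conj_map_ev intro!: Qadj_ev)

lemma G_inj: "\<sigma> \<in> G \<Longrightarrow> inj \<sigma>"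
proof (rule injI)
  fix x y assume *: "\<sigma> \<in> G" "\<sigma> x = \<sigma> y"
  have off: "\<sigma> z = z" if "z \<notin> Qadj \<theta>" for z using that * by (auto simp: G_def conj_map_def)
  have "inj_on \<sigma> (Qadj \<theta>)" using * conj_map_inj_on[OF alg] by (auto simp: G_def)
  thus "x = y" using * off G_closed by (metis inj_onD)
qed

lemma G_prod: "\<sigma> \<in> G \<Longrightarrow> (\<And>i. i \<in> I \<Longrightarrow> f i \<in> Qadj \<theta>) \<Longrightarrow> \<sigma> (prod f I) = (\<Prod>i\<in>I. \<sigma> (f i))"
  by (induction I rule: infinite_finite_induct) (auto simp: G_01 G_mult Qadj_prod)

lemma G_power: "\<sigma> \<in> G \<Longrightarrow> x \<in> Qadj \<theta> \<Longrightarrow> \<sigma> (x ^ n) = \<sigma> x ^ n"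
  by (induction n) (auto simp: G_01 G_mult Qadj_power)

lemma G_id: "id \<in> G"
proof -
  have "conj_map \<theta> \<theta> = id"
  proof
    fix x show "conj_map \<theta> \<theta> x = id x"
      by (cases "x \<in> Qadj \<theta>") (auto elim!: QadjE simp: conj_map_ev, simp add: conj_map_def)
  qed
  thus ?thesis unfolding G_def by (metis conjs_self image_eqI)
qed

lemma G_comp:
  assumes "\<sigma> \<in> G" "\<tau> \<in> G"
  shows "\<sigma> \<circ> \<tau> \<in> G"
proof -
  obtain s t where st: "s \<in> conjs \<theta>" "t \<in> conjs \<theta>" "\<sigma> = conj_map \<theta> s" "\<tau> = conj_map \<theta> t"
    using assms by (auto simp: G_def)
  have t: "t \<in> Qadj \<theta>" using st normal by auto
  have u: "conj_map \<theta> s t \<in> conjs \<theta>" using conj_map_in_conjs[OF st(1) t] conjs_trans st(2) by blast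
  have "\<sigma> \<circ> \<tau> = conj_map \<theta> (conj_map \<theta> s t)"
  proof
    fix x show "(\<sigma> \<circ> \<tau>) x = conj_map \<theta> (conj_map \<theta> s t) x"
    proof (cases "x \<in> Qadj \<theta>")
      case True
      then obtain p where "x = ev p \<theta>" by (rule QadjE)
      thus ?thesis using st u t by (simp add: conj_map_ev conj_map_ev_comp)
    next
      case False
      thus ?thesis using st by (simp add: conj_map_def)
    qed
  qed
  thus ?thesis using u by (simp add: G_def)
qed

text \<open>Left translation by \<sigma> is injective on the finite set \<open>G\<close>, hence
  surjective, and so reaches the identity.\<close>

lemma G_inv:
  assumes "\<sigma> \<in> G"
  obtains \<tau> where "\<tau> \<in> G" "\<And>x. \<sigma> (\<tau> x) = x" "\<And>x. \<tau> (\<sigma> x) = x"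
proof -
  have inj: "inj \<sigma>" using G_inj[OF assms] .
  have "inj_on (\<lambda>\<tau>. \<sigma> \<circ> \<tau>) G" using inj by (auto simp: inj_on_def fun_eq_iff)
  moreover have "(\<lambda>\<tau>. \<sigma> \<circ> \<tau>) ` G \<subseteq> G" using G_comp assms by auto
  ultimately have "(\<lambda>\<tau>. \<sigma> \<circ> \<tau>) ` G = G" using endo_inj_surj finite_G by metis
  then obtain \<tau> where \<tau>: "\<tau> \<in> G" "\<sigma> \<circ> \<tau> = id" using G_id by (metis imageE)
  have 1: "\<sigma> (\<tau> x) = x" for x using \<tau>(2) by (metis comp_apply id_apply)
  have "\<tau> (\<sigma> x) = x" for x using 1[of "\<sigma> x"] inj by (simp add: inj_eq)
  thus thesis using that \<tau>(1) 1 by blast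
qed

text \<open>Write x = p(\<theta>) with p of degree below that of the minimal polynomial. Invariance
  says that p - x vanishes at every conjugate of \<theta>; these are more points than its degree
  allows, so p is the constant x.\<close>

lemma G_fixed_imp_rational:
  assumes "x \<in> Qadj \<theta>" "\<And>\<sigma>. \<sigma> \<in> G \<Longrightarrow> \<sigma> x = x"
  shows "x \<in> \<rat>"
proof -
  obtain m where m: "is_minpoly m \<theta>" using minpoly_exists[OF alg] .
  obtain p0 where p0: "x = ev p0 \<theta>" using assms(1) by (rule QadjE)
  define p where "p = p0 mod m"
  have "x = ev p \<theta>"
    using p0 minpoly_root[OF m] ev_add[of "m * (p0 div m)" "p0 mod m" \<theta>] by (simp add: p_def)
  have deg: "degree p < degree m"
    using minpoly_degree_pos[OF m] minpoly_nonzero[OF m] degree_mod_less[of m p0] by (auto simp: p_def)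
  define q where "q = (map_poly of_rat p :: complex poly) - [:x:]"
  have "poly q t = 0" if "t \<in> conjs \<theta>" for t
  proof -
    have "ev p t = x"
      using assms(2)[of "conj_map \<theta> t"] that \<open>x = ev p \<theta>\<close> by (simp add: G_def conj_map_ev)
    thus ?thesis by (simp add: q_def flip: ev_def)
  qed
  hence sub: "conjs \<theta> \<subseteq> {t. poly q t = 0}" by auto
  have "q = 0"
  proof (rule ccontr)
    assume "q \<noteq> 0"
    have "degree m \<le> card {t. poly q t = 0}"
      using card_mono[OF poly_roots_finite[OF \<open>q \<noteq> 0\<close>] sub] card_conjs[OF m] by simp
    also have "\<dots> \<le> degree q" by (rule card_poly_roots_bound[OF \<open>q \<noteq> 0\<close>])
    also have "\<dots> \<le> degree p" unfolding q_def by (intro degree_diff_le) (auto simp: degree_map_poly)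
    finally show False using deg by simp
  qed
  hence "map_poly of_rat p = [:x:]" by (simp add: q_def)
  hence "x = of_rat (coeff p 0)" by (metis coeff_pCons_0 coeff_map_poly of_rat_0)
  thus ?thesis by simp
qed

text \<open>Four properties that pass together through one induction, by the recursion for a further
  factor X - b(s). A root of modulus at most 2 multiplies the coefficient bound by 2 + 1, the origin
  of the base 3. The roots are indexed by \<open>S\<close> since \<open>b\<close> may repeat
  values.\<close>

lemma coeff_prod_root_factors:
  assumes "finite S" "\<And>s. s \<in> S \<Longrightarrow> b s \<in> Qadj \<theta>" "\<And>s. s \<in> S \<Longrightarrow> algebraic_int (b s)"
    and "\<And>s. s \<in> S \<Longrightarrow> norm (b s) \<le> 2"
  shows "coeff (\<Prod>s\<in>S. [:- b s, 1:]) i \<in> Qadj \<theta>"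
    and "algebraic_int (coeff (\<Prod>s\<in>S. [:- b s, 1:]) i)"
    and "norm (coeff (\<Prod>s\<in>S. [:- b s, 1:]) i) \<le> 3 ^ card S"
    and "\<sigma> \<in> G \<Longrightarrow> \<sigma> (coeff (\<Prod>s\<in>S. [:- b s, 1:]) i) = coeff (\<Prod>s\<in>S. [:- \<sigma> (b s), 1:]) i"
proof -
  let ?P = "\<lambda>S b. \<Prod>s\<in>S. [:- b s, 1:]"
  have step: "coeff ([:- z, 1:] * q) i = - z * coeff q i + (case i of 0 \<Rightarrow> 0 | Suc j \<Rightarrow> coeff q j)" for z :: complex and q i
    by (simp add: coeff_pCons split: nat.splits)
  have "\<forall>i. coeff (?P S b) i \<in> Qadj \<theta> \<and> algebraic_int (coeff (?P S b) i) \<and> norm (coeff (?P S b) i) \<le> 3 ^ card S \<and>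
     (\<sigma> \<in> G \<longrightarrow> \<sigma> (coeff (?P S b) i) = coeff (?P S (\<lambda>s. \<sigma> (b s))) i)" for \<sigma> using assms
  proof (induction S rule: finite_induct)
    case empty
    show ?case by (auto simp: G_01 coeff_1)
  next
    case (insert s S)
    have IH: "coeff (?P S b) i \<in> Qadj \<theta>" "algebraic_int (coeff (?P S b) i)" "norm (coeff (?P S b) i) \<le> 3 ^ card S"
      "\<sigma> \<in> G \<Longrightarrow> \<sigma> (coeff (?P S b) i) = coeff (?P S (\<lambda>s. \<sigma> (b s))) i" for i
      using insert.IH insert.prems by auto
    have s: "b s \<in> Qadj \<theta>" "algebraic_int (b s)" "norm (b s) \<le> 2" using insert.prems by auto
    show ?case
    proof (intro allI conjI impI)
      fix i
      define c where "c = (case i of 0 \<Rightarrow> 0 | Suc j \<Rightarrow> coeff (?P S b) j)"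
      have c: "c \<in> Qadj \<theta>" "algebraic_int c" "norm c \<le> 3 ^ card S"
        using IH by (auto simp: c_def split: nat.splits)
      have eq: "coeff (?P (insert s S) b) i = - b s * coeff (?P S b) i + c"
        using insert.hyps by (simp only: prod.insert not_False_eq_True step c_def)
      show "coeff (?P (insert s S) b) i \<in> Qadj \<theta>"
        unfolding eq using c s IH by (intro Qadj_add Qadj_mult Qadj_minus)
      show "algebraic_int (coeff (?P (insert s S) b) i)"
        unfolding eq using c s IH by (intro algebraic_int_add algebraic_int_mult algebraic_int_minus)
      have "norm (- b s * coeff (?P S b) i + c) \<le> norm (b s) * norm (coeff (?P S b) i) + norm c"
        by (metis norm_minus_cancel norm_mult norm_triangle_ineq)
      also have "\<dots> \<le> 2 * 3 ^ card S + 3 ^ card S" using c s IH by (intro add_mono mult_mono) auto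
      finally show "norm (coeff (?P (insert s S) b) i) \<le> 3 ^ card (insert s S)"
        unfolding eq using insert.hyps by simp
      assume \<sigma>: "\<sigma> \<in> G"
      have "\<sigma> (- b s * coeff (?P S b) i + c) = - \<sigma> (b s) * \<sigma> (coeff (?P S b) i) + \<sigma> c"
        using \<sigma> c s IH by (simp add: G_add G_mult G_minus Qadj_minus Qadj_mult del: mult_minus_left)
      moreover have "\<sigma> c = (case i of 0 \<Rightarrow> 0 | Suc j \<Rightarrow> coeff (?P S (\<lambda>s. \<sigma> (b s))) j)"
        using IH(4)[OF \<sigma>] G_01[OF \<sigma>] by (simp add: c_def split: nat.splits)
      ultimately show "\<sigma> (coeff (?P (insert s S) b) i) = coeff (?P (insert s S) (\<lambda>s. \<sigma> (b s))) i"
        unfolding eq using insert.hyps IH(4)[OF \<sigma>]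
        by (simp only: prod.insert not_False_eq_True step)
    qed
  qed
  thus "coeff (\<Prod>s\<in>S. [:- b s, 1:]) i \<in> Qadj \<theta>"
    "algebraic_int (coeff (\<Prod>s\<in>S. [:- b s, 1:]) i)"
    "norm (coeff (\<Prod>s\<in>S. [:- b s, 1:]) i) \<le> 3 ^ card S"
    "\<sigma> \<in> G \<Longrightarrow> \<sigma> (coeff (\<Prod>s\<in>S. [:- b s, 1:]) i) = coeff (\<Prod>s\<in>S. [:- \<sigma> (b s), 1:]) i" by blast+
qed

end

section \<open>Products of algebraic integers with small conjugates\<close>

text \<open>The bound 3 ^ D is the one of \<open>coeff_prod_root_factors\<close> for at most D roots
  of modulus at most 2.\<close>

definition small_polys :: "nat \<Rightarrow> complex poly set" where
  "small_polys D = {p. p \<noteq> 0 \<and> degree p \<le> D \<and> (\<forall>i. coeff p i \<in> of_int ` {-(3 ^ D)..3 ^ D})}"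

definition small_ints :: "nat \<Rightarrow> complex set" where
  "small_ints D = (\<Union>p\<in>small_polys D. {z. poly p z = 0})"

lemma finite_small_polys: "finite (small_polys D)"
proof (rule finite_subset)
  let ?A = "of_int ` {-(3 ^ D)..3 ^ D} :: complex set"
  show "small_polys D \<subseteq> Poly ` {xs. set xs \<subseteq> ?A \<and> length xs \<le> Suc D}"
  proof
    fix p assume p: "p \<in> small_polys D"
    have "set (coeffs p) \<subseteq> range (coeff p)" by (auto simp: coeffs_def)
    hence "set (coeffs p) \<subseteq> ?A" using p by (auto simp: small_polys_def)
    moreover have "length (coeffs p) \<le> Suc D" using p by (auto simp: small_polys_def length_coeffs)
    ultimately show "p \<in> Poly ` {xs. set xs \<subseteq> ?A \<and> length xs \<le> Suc D}"
      by (intro image_eqI[of _ _ "coeffs p"]) auto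
  qed
  show "finite (Poly ` {xs. set xs \<subseteq> ?A \<and> length xs \<le> Suc D})"
    by (intro finite_imageI finite_lists_length_le) auto
qed

lemma finite_small_ints: "finite (small_ints D)"
  unfolding small_ints_def
  by (intro finite_UN_I finite_small_polys poly_roots_finite) (auto simp: small_polys_def)

lemma algebraic_int_conj:
  assumes "algebraic_int x" "z \<in> conjs x"
  shows "algebraic_int z"
proof -
  obtain p where p: "poly (map_poly of_int p) x = 0" "lead_coeff p = 1"
    using assms(1) by (auto simp: algebraic_int_altdef_ipoly)
  have "map_poly of_int p = (map_poly of_rat (map_poly of_int p) :: complex poly)"
    by (simp add: map_poly_map_poly o_def)
  hence "ev (map_poly of_int p) x = 0" using p(1) by (simp add: ev_def)
  hence "ev (map_poly of_int p) z = 0" using assms(2) unfolding conjs_def by blast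
  hence "poly (map_poly of_int p) z = 0" by (simp add: ev_def map_poly_map_poly o_def)
  thus ?thesis using p(2) by (auto simp: algebraic_int_altdef_ipoly)
qed

context normal_generator begin

text \<open>By the hypothesis \<open>fixed\<close>, \<sigma> x depends on \<sigma> \<alpha> alone.
  The product of the factors X - \<sigma> x, one for each value of \<sigma> \<alpha>, therefore has
  degree at most that of \<alpha>; its coefficients are invariant under \<open>G\<close>, hence
  rational, and integral, hence integers.\<close>

lemma fixed_small_int:
  assumes x: "x \<in> Qadj \<theta>" "algebraic_int x" and \<alpha>: "\<alpha> \<in> Qadj \<theta>" "algebraic \<alpha>"
    and fixed: "\<And>\<sigma>. \<sigma> \<in> G \<Longrightarrow> \<sigma> \<alpha> = \<alpha> \<Longrightarrow> \<sigma> x = x"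
    and bound: "\<And>\<sigma>. \<sigma> \<in> G \<Longrightarrow> norm (\<sigma> x) \<le> 2"
  shows "x \<in> small_ints (card (conjs \<alpha>))"
proof -
  define S where "S = (\<lambda>\<sigma>. \<sigma> \<alpha>) ` G"
  have "finite S" using finite_G by (simp add: S_def)
  have "S \<subseteq> conjs \<alpha>" using G_conjs \<alpha>(1) by (auto simp: S_def)
  hence card: "card S \<le> card (conjs \<alpha>)" using finite_conjs[OF \<alpha>(2)] card_mono by blast
  \<comment> \<open>Any automorphism that sends \<alpha> to \<gamma> will do: two of them differ by
    an element of the stabilizer of \<alpha>, which fixes x.\<close>
  define b where "b = (\<lambda>\<gamma>. (SOME \<sigma>. \<sigma> \<in> G \<and> \<sigma> \<alpha> = \<gamma>) x)"
  have b: "b (\<sigma> \<alpha>) = \<sigma> x" if \<sigma>: "\<sigma> \<in> G" for \<sigma>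
  proof -
    define \<tau> where "\<tau> = (SOME \<tau>. \<tau> \<in> G \<and> \<tau> \<alpha> = \<sigma> \<alpha>)"
    have \<tau>: "\<tau> \<in> G" "\<tau> \<alpha> = \<sigma> \<alpha>" using someI[of "\<lambda>\<tau>. \<tau> \<in> G \<and> \<tau> \<alpha> = \<sigma> \<alpha>" \<sigma>] \<sigma> by (auto simp: \<tau>_def)
    obtain \<rho> where \<rho>: "\<rho> \<in> G" "\<And>x. \<sigma> (\<rho> x) = x" "\<And>x. \<rho> (\<sigma> x) = x" using G_inv[OF \<sigma>] by blast
    have "(\<rho> \<circ> \<tau>) x = x" using \<rho> \<tau> by (intro fixed G_comp) auto
    hence "\<tau> x = \<sigma> x" using \<rho>(2)[of "\<tau> x"] by simp
    thus ?thesis by (simp add: b_def \<tau>_def)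
  qed
  have bS: "b s \<in> Qadj \<theta>" "algebraic_int (b s)" "norm (b s) \<le> 2" if "s \<in> S" for s
    using that b bound G_closed x algebraic_int_conj[OF x(2) G_conjs] by (auto simp: S_def)
  define p where "p = (\<Prod>s\<in>S. [:- b s, 1:])"
  have inv: "\<sigma> (coeff p i) = coeff p i" if \<sigma>: "\<sigma> \<in> G" for \<sigma> i
  proof -
    \<comment> \<open>\<sigma> permutes the orbit S of \<alpha> and thereby only permutes the
      factors of p.\<close>
    have "\<sigma> ` S \<subseteq> S"
    proof
      fix y assume "y \<in> \<sigma> ` S"
      then obtain \<tau> where "\<tau> \<in> G" "y = (\<sigma> \<circ> \<tau>) \<alpha>" by (auto simp: S_def)
      thus "y \<in> S" unfolding S_def using G_comp[OF \<sigma>] by blast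
    qed
    moreover have inj: "inj_on \<sigma> S" using G_inj[OF \<sigma>] by (auto simp: inj_on_def inj_def)
    ultimately have im: "\<sigma> ` S = S" using endo_inj_surj \<open>finite S\<close> by metis
    have "\<sigma> (coeff p i) = coeff (\<Prod>s\<in>S. [:- \<sigma> (b s), 1:]) i"
      unfolding p_def using bS \<open>finite S\<close> \<sigma> by (intro coeff_prod_root_factors) auto
    also have "(\<Prod>s\<in>S. [:- \<sigma> (b s), 1:]) = (\<Prod>s\<in>S. [:- b (\<sigma> s), 1:])"
    proof (intro prod.cong refl)
      fix s assume "s \<in> S"
      then obtain \<tau> where \<tau>: "\<tau> \<in> G" "s = \<tau> \<alpha>" by (auto simp: S_def)
      thus "[:- \<sigma> (b s), 1:] = [:- b (\<sigma> s), 1:]" using b[OF \<tau>(1)] b[OF G_comp[OF \<sigma> \<tau>(1)]] by simp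
    qed
    also have "\<dots> = (\<Prod>s\<in>\<sigma> ` S. [:- b s, 1:])" using inj by (simp add: prod.reindex)
    finally show ?thesis using im by (simp add: p_def)
  qed
  have coeffs: "coeff p i \<in> Qadj \<theta>" "algebraic_int (coeff p i)" "norm (coeff p i) \<le> 3 ^ card S" for i
    unfolding p_def using bS \<open>finite S\<close> by (intro coeff_prod_root_factors; auto)+
  have "coeff p i \<in> of_int ` {-(3 ^ card (conjs \<alpha>))..3 ^ card (conjs \<alpha>)}" for i
  proof -
    have "coeff p i \<in> \<rat>" using inv coeffs by (intro G_fixed_imp_rational) auto
    hence "coeff p i \<in> \<int>" using coeffs rational_algebraic_int_is_int by blast
    then obtain k where k: "coeff p i = of_int k" by (auto elim: Ints_cases)
    have "\<bar>real_of_int k\<bar> \<le> 3 ^ card S" using coeffs(3)[of i] k by simp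
    also have "\<dots> \<le> 3 ^ card (conjs \<alpha>)" using card by (intro power_increasing) auto
    finally have "\<bar>k\<bar> \<le> 3 ^ card (conjs \<alpha>)"
      by (metis of_int_abs of_int_le_iff of_int_numeral of_int_power)
    hence "k \<in> {-(3 ^ card (conjs \<alpha>))..3 ^ card (conjs \<alpha>)}" by auto
    thus ?thesis using k by blast
  qed
  moreover have "p \<noteq> 0" using \<open>finite S\<close> by (simp add: p_def)
  moreover have "degree p = card S" unfolding p_def by (subst degree_prod_eq_sum_degree) auto
  ultimately have "p \<in> small_polys (card (conjs \<alpha>))" using card by (auto simp: small_polys_def)
  moreover have "poly p x = 0"
  proof -
    have "\<alpha> \<in> S" using G_id unfolding S_def by (intro image_eqI[of _ _ id]) auto
    moreover have "b \<alpha> = x" using b[OF G_id] by simp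
    ultimately show ?thesis using \<open>finite S\<close> by (auto simp: p_def poly_prod prod_zero_iff)
  qed
  ultimately show ?thesis by (auto simp: small_ints_def)
qed

text \<open>All powers of \<open>x\<close> up to a large exponent lie in one finite set, so two of them coincide.\<close>
lemma fixed_root_of_unity:
  assumes x: "x \<in> Qadj \<theta>" "algebraic_int x" "x \<noteq> 0" and \<alpha>: "\<alpha> \<in> Qadj \<theta>" "algebraic \<alpha>"
    and fixed: "\<And>\<sigma>. \<sigma> \<in> G \<Longrightarrow> \<sigma> \<alpha> = \<alpha> \<Longrightarrow> \<sigma> x = x"
    and bound: "\<And>\<sigma>. \<sigma> \<in> G \<Longrightarrow> norm (\<sigma> x) \<le> c"
    and c: "c \<ge> 1" "c ^ card (small_ints (card (conjs \<alpha>))) \<le> 2"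
  shows "\<exists>n>0. x ^ n = 1"
proof -
  define T where "T = small_ints (card (conjs \<alpha>))"
  have "x ^ k \<in> T" if "k \<le> card T" for k unfolding T_def
  proof (rule fixed_small_int)
    fix \<sigma> assume \<sigma>: "\<sigma> \<in> G"
    have "norm (\<sigma> x) ^ k \<le> c ^ k" using bound[OF \<sigma>] by (intro power_mono) auto
    also have "\<dots> \<le> c ^ card T" using that c by (intro power_increasing) auto
    finally show "norm (\<sigma> (x ^ k)) \<le> 2" using c \<sigma> x by (simp add: G_power norm_power T_def)
  next
    fix \<sigma> assume "\<sigma> \<in> G" "\<sigma> \<alpha> = \<alpha>"
    thus "\<sigma> (x ^ k) = x ^ k" using fixed x by (metis G_power)
  qed (use x \<alpha> in \<open>auto intro: algebraic_int_power\<close>)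
  hence "(\<lambda>k. x ^ k) ` {..card T} \<subseteq> T" by auto
  moreover have "finite T" by (simp add: T_def finite_small_ints)
  \<comment> \<open>The exponents from 0 to card T are one more than T has elements.\<close>
  ultimately have "card ((\<lambda>k. x ^ k) ` {..card T}) < card {..card T}"
    by (metis card_atMost card_mono le_imp_less_Suc)
  hence "\<not> inj_on (\<lambda>k. x ^ k) {..card T}" using card_image by force
  then obtain i j where ij: "x ^ i = x ^ j" "i < j" by (metis inj_onI linorder_neqE_nat)
  have "x ^ j = x ^ i * x ^ (j - i)" using ij(2) by (simp flip: power_add)
  hence "x ^ (j - i) = 1" using ij(1) x(3) by simp
  thus ?thesis using ij(2) by (intro exI[of _ "j - i"]) auto
qed

end

lemma prod_root_of_unity:
  assumes "finite I" "\<And>i. i \<in> I \<Longrightarrow> \<exists>n>0. (f i :: complex) ^ n = 1"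
  shows "\<exists>n>0. prod f I ^ n = 1"
  using assms
proof (induction I rule: finite_induct)
  case (insert i I)
  obtain n where "n > 0" "f i ^ n = 1" using insert.prems by blast
  moreover obtain m where "m > 0" "prod f I ^ m = 1" using insert by blast
  ultimately have mn: "m > 0" "prod f I ^ m = 1" "n > 0" "f i ^ n = 1" by auto
  have "(f i * prod f I) ^ (n * m) = (f i ^ n) ^ m * (prod f I ^ m) ^ n"
    by (simp add: power_mult_distrib flip: power_mult) (simp add: mult.commute)
  also have "\<dots> = 1" using mn by simp
  finally show ?case using mn insert.hyps by (intro exI[of _ "n * m"]) auto
qed (auto intro: exI[of _ 1])

text \<open>The constant depends on \<alpha> alone, while number and degrees of the factors are
  arbitrary. The bound concerns products over sets of conjugates because the conjugates of an orbit
  product have this form.\<close>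

theorem root_of_unity_of_small_factors:
  assumes \<alpha>: "algebraic \<alpha>" "\<alpha> \<noteq> 0"
  obtains c :: real where "c > 1"
    "\<And>(I :: nat set) a. finite I \<Longrightarrow> (\<And>i. i \<in> I \<Longrightarrow> algebraic_int (a i)) \<Longrightarrow>
       (\<And>i S. i \<in> I \<Longrightarrow> S \<subseteq> conjs (a i) \<Longrightarrow> (\<Prod>z\<in>S. norm z) \<le> c) \<Longrightarrow>
       (\<Prod>i\<in>I. a i) = \<alpha> \<Longrightarrow> \<exists>n>0. \<alpha> ^ n = 1"
proof -
  define N where "N = card (small_ints (card (conjs \<alpha>)))"
  \<comment> \<open>The root of order \<open>Suc N\<close> exceeds 1 also for N = 0, and its N-th
    power is still at most 2.\<close>
  define c where "c = root (Suc N) 2"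
  have c1: "c > 1" by (simp add: c_def)
  have "c ^ Suc N = 2" unfolding c_def by (rule real_root_pow_pos2) auto
  moreover have "c ^ N \<le> c ^ Suc N" using c1 by (intro power_increasing) auto
  ultimately have cN: "c ^ N \<le> 2" by simp
  have "\<exists>n>0. \<alpha> ^ n = 1" if I: "finite I" and int: "\<And>i. i \<in> I \<Longrightarrow> algebraic_int (a i)"
    and small: "\<And>i S. i \<in> I \<Longrightarrow> S \<subseteq> conjs (a i) \<Longrightarrow> (\<Prod>z\<in>S. norm z) \<le> c"
    and prod: "(\<Prod>i\<in>I. a i) = \<alpha>" for I :: "nat set" and a
  proof -
    \<comment> \<open>A is finite and closed under conjugation, so it generates a normal
      field.\<close>
    define A where "A = conjs \<alpha> \<union> (\<Union>i\<in>I. conjs (a i))"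
    have A: "finite A" "\<And>x. x \<in> A \<Longrightarrow> algebraic x"
      using I int \<alpha> finite_conjs conjs_algebraic algebraic_int_imp_algebraic unfolding A_def by blast+
    obtain k :: "complex \<Rightarrow> nat" where k: "algebraic (\<Sum>x\<in>A. of_nat (k x) * x)" "A \<subseteq> Qadj (\<Sum>x\<in>A. of_nat (k x) * x)"
      using primitive_element[OF A] by blast
    define \<theta> where "\<theta> = (\<Sum>x\<in>A. of_nat (k x) * x)"
    have "conjs \<theta> \<subseteq> Qadj \<theta>"
    proof
      fix t assume t: "t \<in> conjs \<theta>"
      have A\<theta>: "x \<in> Qadj \<theta>" if "x \<in> A" for x using that k(2) by (auto simp: \<theta>_def)
      have sum: "conj_map \<theta> t (sum f B) = (\<Sum>x\<in>B. conj_map \<theta> t (f x))"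
        if "\<And>x. x \<in> B \<Longrightarrow> f x \<in> Qadj \<theta>" for f :: "complex \<Rightarrow> complex" and B using that
      proof (induction B rule: infinite_finite_induct)
        case (insert x B)
        thus ?case using conj_map_add[OF t] by (simp add: Qadj_sum)
      qed (use conj_map_of_rat[OF t, of 0] in auto)
      \<comment> \<open>An embedding maps the combination \<theta> of elements of A to the same
        combination of conjugates, which are again in A.\<close>
      have "t = conj_map \<theta> t \<theta>" using conj_map_ev[OF t, of "[:0, 1:]"] by simp
      also have "\<dots> = conj_map \<theta> t (\<Sum>x\<in>A. of_nat (k x) * x)" by (simp add: \<theta>_def)
      also have "\<dots> = (\<Sum>x\<in>A. conj_map \<theta> t (of_nat (k x) * x))" using A\<theta> by (intro sum Qadj_mult) auto
      also have "\<dots> = (\<Sum>x\<in>A. of_nat (k x) * conj_map \<theta> t x)"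
        using A\<theta> conj_map_mult[OF t] conj_map_of_rat[OF t, of "of_nat _"] by simp
      also have "\<dots> \<in> Qadj \<theta>"
      proof (intro Qadj_sum Qadj_mult)
        fix x assume x: "x \<in> A"
        have "conj_map \<theta> t x \<in> conjs x" using conj_map_in_conjs[OF t A\<theta>[OF x]] .
        hence "conj_map \<theta> t x \<in> A" using x unfolding A_def by (blast intro: conjs_trans)
        thus "conj_map \<theta> t x \<in> Qadj \<theta>" by (rule A\<theta>)
      qed auto
      finally show "t \<in> Qadj \<theta>" .
    qed
    then interpret normal_generator \<theta> using k(1) by unfold_locales (auto simp: \<theta>_def)
    have in\<theta>: "\<alpha> \<in> Qadj \<theta>" "\<And>i. i \<in> I \<Longrightarrow> a i \<in> Qadj \<theta>"
    proof -
      have "A \<subseteq> Qadj \<theta>" using k(2) by (simp add: \<theta>_def)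
      moreover have "\<alpha> \<in> A" "\<And>i. i \<in> I \<Longrightarrow> a i \<in> A" by (auto simp: A_def intro: conjs_self)
      ultimately show "\<alpha> \<in> Qadj \<theta>" "\<And>i. i \<in> I \<Longrightarrow> a i \<in> Qadj \<theta>" by auto
    qed
    define H where "H = {\<sigma>\<in>G. \<sigma> \<alpha> = \<alpha>}"
    have H: "finite H" "id \<in> H" "H \<subseteq> G" using finite_G G_id by (auto simp: H_def)
    have H_comp: "\<sigma> \<circ> \<tau> \<in> H" if "\<sigma> \<in> H" "\<tau> \<in> H" for \<sigma> \<tau> using that G_comp by (auto simp: H_def)
    define orb where "orb = (\<lambda>i. (\<lambda>\<sigma>. \<sigma> (a i)) ` H)"
    define \<beta> where "\<beta> = (\<lambda>i. \<Prod>(orb i))"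
    \<comment> \<open>The order of the stabilizer of a_i in H. The automorphisms in H with a
      prescribed value at a_i form a coset of it, so each orbit element occurs with this
      multiplicity.\<close>
    define e where "e = (\<lambda>i. card {\<sigma>\<in>H. \<sigma> (a i) = a i})"
    have fin_orb: "finite (orb i)" for i using H by (simp add: orb_def)
    have orb_conjs: "orb i \<subseteq> conjs (a i)" if "i \<in> I" for i
      using that H G_conjs in\<theta> by (auto simp: orb_def)
    have orb\<theta>: "orb i \<subseteq> Qadj \<theta>" if "i \<in> I" for i using that H G_closed in\<theta> by (auto simp: orb_def)
    have fiber: "card {\<sigma>\<in>H. \<sigma> (a i) = \<gamma>} = e i" if \<gamma>: "\<gamma> \<in> orb i" for i \<gamma>
    proof -
      obtain h where h: "h \<in> H" "\<gamma> = h (a i)" using \<gamma> by (auto simp: orb_def)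
      obtain h' where h': "h' \<in> G" "\<And>x. h (h' x) = x" "\<And>x. h' (h x) = x" using G_inv H h by blast
      have "h' \<alpha> = h' (h \<alpha>)" using h by (simp add: H_def)
      hence h'H: "h' \<in> H" using h' by (simp add: H_def)
      have "bij_betw (\<lambda>\<sigma>. h \<circ> \<sigma>) {\<sigma>\<in>H. \<sigma> (a i) = a i} {\<sigma>\<in>H. \<sigma> (a i) = \<gamma>}"
      proof (rule bij_betwI[where g = "\<lambda>\<sigma>. h' \<circ> \<sigma>"])
        show "(\<lambda>\<sigma>. h \<circ> \<sigma>) \<in> {\<sigma>\<in>H. \<sigma> (a i) = a i} \<rightarrow> {\<sigma>\<in>H. \<sigma> (a i) = \<gamma>}"
          using H_comp[OF h(1)] h(2) by simp
        show "(\<lambda>\<sigma>. h' \<circ> \<sigma>) \<in> {\<sigma>\<in>H. \<sigma> (a i) = \<gamma>} \<rightarrow> {\<sigma>\<in>H. \<sigma> (a i) = a i}"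
          using H_comp[OF h'H] h'(3) by (simp add: h(2))
      qed (simp_all add: fun_eq_iff h')
      from bij_betw_same_card[OF this] show ?thesis by (simp add: e_def)
    qed
    \<comment> \<open>The relative norm from Q(\<theta>) to Q(\<alpha>), computed for \<alpha>
      itself and for the product of the a_i.\<close>
    have "\<alpha> ^ card H = (\<Prod>\<sigma>\<in>H. \<sigma> \<alpha>)" by (simp add: H_def)
    also have "\<dots> = (\<Prod>\<sigma>\<in>H. \<Prod>i\<in>I. \<sigma> (a i))"
      unfolding prod[symmetric] using H in\<theta> by (intro prod.cong refl G_prod) auto
    also have "\<dots> = (\<Prod>i\<in>I. \<Prod>\<sigma>\<in>H. \<sigma> (a i))" by (rule prod.swap)
    also have "\<dots> = (\<Prod>i\<in>I. \<beta> i ^ e i)"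
    proof (intro prod.cong refl)
      fix i assume "i \<in> I"
      have "(\<Prod>\<sigma>\<in>H. \<sigma> (a i)) = (\<Prod>\<gamma>\<in>orb i. \<Prod>\<sigma>\<in>{\<sigma>\<in>H. \<sigma> (a i) = \<gamma>}. \<sigma> (a i))"
        unfolding orb_def using prod.image_gen[OF H(1), of "\<lambda>\<sigma>. \<sigma> (a i)" "\<lambda>\<sigma>. \<sigma> (a i)"] .
      also have "\<dots> = (\<Prod>\<gamma>\<in>orb i. \<gamma> ^ e i)" by (intro prod.cong refl) (simp flip: fiber)
      finally show "(\<Prod>\<sigma>\<in>H. \<sigma> (a i)) = \<beta> i ^ e i" by (simp add: \<beta>_def prod_power_distrib)
    qed
    finally have \<alpha>H: "\<alpha> ^ card H = (\<Prod>i\<in>I. \<beta> i ^ e i)" .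
    have "\<exists>n>0. \<beta> i ^ n = 1" if i: "i \<in> I" for i
    proof (rule fixed_root_of_unity[where c = c and \<alpha> = \<alpha>])
      show "\<beta> i \<in> Qadj \<theta>" unfolding \<beta>_def using orb\<theta>[OF i] by (intro Qadj_prod) auto
      show "algebraic_int (\<beta> i)"
        unfolding \<beta>_def using orb_conjs[OF i] int[OF i] by (intro algebraic_int_prod) (auto intro: algebraic_int_conj)
      have "a i \<noteq> 0" using prod \<alpha>(2) i I by auto
      have "0 \<notin> orb i"
      proof
        assume "0 \<in> orb i"
        then obtain \<sigma> where "\<sigma> \<in> H" "\<sigma> (a i) = 0" by (auto simp: orb_def)
        hence "\<sigma> (a i) = \<sigma> 0" "inj \<sigma>" using G_01 G_inj H by auto
        thus False using \<open>a i \<noteq> 0\<close> by (simp add: inj_eq)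
      qed
      thus "\<beta> i \<noteq> 0" using fin_orb by (simp add: \<beta>_def prod_zero_iff)
    next
      fix \<sigma> assume \<sigma>: "\<sigma> \<in> G"
      \<comment> \<open>Injectivity of \<sigma> keeps the factors distinct, so the image is again a
        product over a set of conjugates of a_i, to which \<open>small\<close> applies.\<close>
      have im: "\<sigma> (\<beta> i) = \<Prod>(\<sigma> ` orb i)"
      proof -
        have "inj_on \<sigma> (orb i)" using G_inj[OF \<sigma>] by (auto simp: inj_on_def inj_def)
        moreover have "\<sigma> (\<beta> i) = (\<Prod>\<gamma>\<in>orb i. \<sigma> \<gamma>)"
          unfolding \<beta>_def using orb\<theta>[OF i] \<sigma> by (intro G_prod) auto
        ultimately show ?thesis by (simp add: prod.reindex)
      qed
      have "\<sigma> ` orb i \<subseteq> conjs (a i)"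
        using orb_conjs[OF i] orb\<theta>[OF i] G_conjs[OF \<sigma>] conjs_trans by blast
      hence "(\<Prod>z\<in>\<sigma> ` orb i. norm z) \<le> c" using small[OF i] by blast
      thus "norm (\<sigma> (\<beta> i)) \<le> c" by (simp add: im prod_norm)
      assume "\<sigma> \<alpha> = \<alpha>"
      hence "\<sigma> \<in> H" using \<sigma> by (simp add: H_def)
      have "\<sigma> ` orb i \<subseteq> orb i"
      proof
        fix y assume "y \<in> \<sigma> ` orb i"
        then obtain \<tau> where "\<tau> \<in> H" "y = (\<sigma> \<circ> \<tau>) (a i)" by (auto simp: orb_def)
        thus "y \<in> orb i" unfolding orb_def using H_comp[OF \<open>\<sigma> \<in> H\<close>] by blast
      qed
      hence "\<sigma> ` orb i = orb i"
        using endo_inj_surj[OF fin_orb] G_inj[OF \<sigma>] by (metis inj_on_subset subset_UNIV)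
      thus "\<sigma> (\<beta> i) = \<beta> i" using im by (simp add: \<beta>_def)
    qed (use \<alpha> in\<theta> c1 cN in \<open>auto simp: N_def\<close>)
    note \<beta>_root = this
    have rou: "\<exists>n>0. (\<beta> i ^ e i) ^ n = 1" if i: "i \<in> I" for i
    proof -
      obtain n where n: "n > 0" "\<beta> i ^ n = 1" using \<beta>_root[OF i] by blast
      have "(\<beta> i ^ e i) ^ n = (\<beta> i ^ n) ^ e i"
        by (simp only: power_mult[symmetric] mult.commute[of n])
      thus ?thesis using n by (intro exI[of _ n]) simp
    qed
    have "\<exists>n>0. (\<Prod>i\<in>I. \<beta> i ^ e i) ^ n = 1" by (rule prod_root_of_unity[OF I rou])
    then obtain n where "n > 0" "(\<alpha> ^ card H) ^ n = 1" by (auto simp: \<alpha>H)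
    moreover have "card H > 0" using H by (auto simp: card_gt_0_iff)
    ultimately show ?thesis by (intro exI[of _ "card H * n"]) (simp add: power_mult)
  qed
  thus thesis using that c1 by blast
qed

section \<open>Existence of p-adic places\<close>

lemma algebraic_of_rat [simp]: "algebraic (of_rat q :: complex)"
  unfolding algebraic_iff_ev by (intro exI[of _ "[:- q, 1:]"]) (simp add: of_rat_minus)

lemma algebraic_mult:
  assumes "algebraic x" "algebraic (y :: complex)"
  shows "algebraic (x * y)"
proof -
  obtain c where c: "c \<noteq> 0" "algebraic_int (of_int c * x)"
    using algebraic_int_multiple[OF assms(1)] .
  obtain d where d: "d \<noteq> 0" "algebraic_int (of_int d * y)"
    using algebraic_int_multiple[OF assms(2)] .
  have "algebraic_int ((of_int c * x) * (of_int d * y))" by (rule algebraic_int_mult[OF c(2) d(2)])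
  moreover have "(of_int c * x) * (of_int d * y) = of_int (c * d) * (x * y)"
    by (simp add: algebra_simps)
  ultimately have "algebraic (of_int (c * d) * (x * y))" by (metis algebraic_int_imp_algebraic)
  thus ?thesis using c(1) d(1) by (metis algebraic_of_int_mult mult_eq_0_iff)
qed

lemma algebraic_Qadj:
  assumes "algebraic \<alpha>" "x \<in> Qadj \<alpha>"
  shows "algebraic x"
proof -
  have "algebraic (ev p \<alpha>)" for p
  proof (induction p)
    case (pCons a p)
    thus ?case using assms(1) by (simp add: algebraic_add algebraic_mult)
  qed simp
  thus ?thesis using assms(2) by (auto elim: QadjE)
qed

lemma padic_abs_quotient:
  assumes p: "prime p" and q: "q \<noteq> 0"
  obtains k :: int and a b :: int where "a \<noteq> 0" "b \<noteq> 0" "\<not> int p dvd a" "\<not> int p dvd b"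
    "q * of_int b = of_nat p powi k * of_int a" "padic_abs p q = real p powi (- k)"
proof -
  obtain n d where nd: "quotient_of q = (n, d)" by force
  have d: "d > 0" using nd by (rule quotient_of_denom_pos)
  have qnd: "q = of_int n / of_int d" using nd by (rule quotient_of_div)
  have n: "n \<noteq> 0" using q qnd by auto
  have p1: "\<not> is_unit (int p)" using p by (auto dest: prime_gt_1_nat)
  obtain a where a: "n = int p ^ multiplicity (int p) n * a" "\<not> int p dvd a"
    using multiplicity_decompose'[of n "int p"] n p1 by blast
  obtain b where b: "d = int p ^ multiplicity (int p) d * b" "\<not> int p dvd b"
    using multiplicity_decompose'[of d "int p"] d p1 by auto
  define i where "i = multiplicity (int p) n"
  define j where "j = multiplicity (int p) d"
  have p0: "(of_nat p :: rat) \<noteq> 0" using p by (auto dest: prime_gt_0_nat)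
  have "q * (of_nat p ^ j * of_int b) = of_nat p ^ i * of_int a"
  proof -
    have "q * of_int d = of_int n" using qnd d by simp
    thus ?thesis using a(1) b(1) unfolding i_def[symmetric] j_def[symmetric]
      by (metis of_int_mult of_int_of_nat_eq of_int_power)
  qed
  hence "q * of_int b = of_nat p powi (int i - int j) * of_int a"
    using p0 by (simp add: power_int_diff field_simps)
  moreover have "padic_abs p q = real p powi (- (int i - int j))"
    using q nd by (simp add: padic_abs_def i_def j_def)
  moreover have "a \<noteq> 0" "b \<noteq> 0" using a b by auto
  ultimately show thesis using that a b by blast
qed

section \<open>The p-adic absolute value carried by a valuation ring without 1 / p\<close>

locale padic_valring =
  fixes V :: "complex set" and p :: nat
  assumes V: "valring V" and p: "prime p" and pV: "inverse (of_nat p) \<notin> V"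
begin

abbreviation P :: complex where "P \<equiv> of_nat p"

definition U :: "complex set" where "U = {x\<in>V. inverse x \<in> V \<and> x \<noteq> 0}"

lemma sub: "csubring V" and total: "y \<in> V \<or> inverse y \<in> V"
  using V by (auto simp: valring_def)

lemma V_mult: "x \<in> V \<Longrightarrow> y \<in> V \<Longrightarrow> x * y \<in> V" and V_add: "x \<in> V \<Longrightarrow> y \<in> V \<Longrightarrow> x + y \<in> V"
  and V_1: "1 \<in> V" and V_minus: "x \<in> V \<Longrightarrow> - x \<in> V"
  using sub by (auto simp: csubring_def)

lemma P_nz: "P \<noteq> 0" using p by (auto dest: prime_gt_0_nat)

lemma U_1: "1 \<in> U" by (simp add: U_def V_1)

lemma U_mult: "x \<in> U \<Longrightarrow> y \<in> U \<Longrightarrow> x * y \<in> U"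
  by (auto simp: U_def V_mult)

lemma U_inverse: "x \<in> U \<Longrightarrow> inverse x \<in> U"
  by (auto simp: U_def)

lemma U_divide: "x \<in> U \<Longrightarrow> y \<in> U \<Longrightarrow> x / y \<in> U"
  by (simp add: divide_inverse U_mult U_inverse)

lemma U_power: "x \<in> U \<Longrightarrow> x ^ n \<in> U"
  by (induction n) (auto simp: U_1 U_mult)

lemma U_nz: "x \<in> U \<Longrightarrow> x \<noteq> 0"
  by (simp add: U_def)

lemma U_minus: "x \<in> U \<Longrightarrow> - x \<in> U"
  by (auto simp: U_def V_minus)

lemma P_power_inverse_notin: "n > 0 \<Longrightarrow> inverse (P ^ n) \<notin> V"
proof
  assume n: "n > 0" and *: "inverse (P ^ n) \<in> V"
  have "P ^ (n - 1) \<in> V" using sub csubring_power csubring_of_nat by blast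
  hence "P ^ (n - 1) * inverse (P ^ n) \<in> V" using * by (rule V_mult)
  moreover have "P ^ (n - 1) * inverse (P ^ n) = inverse P"
    using n P_nz by (cases n) (auto simp: field_simps)
  ultimately show False using pV by simp
qed

lemma P_powi_U: "P powi k \<in> U \<Longrightarrow> k = 0"
proof (rule ccontr)
  assume *: "P powi k \<in> U" and k: "k \<noteq> 0"
  have "inverse (P ^ nat \<bar>k\<bar>) \<in> V"
  proof (cases "k > 0")
    case True
    thus ?thesis using * by (simp add: U_def power_int_def)
  next
    case False
    thus ?thesis using * k by (simp add: U_def power_int_def power_inverse)
  qed
  thus False using P_power_inverse_notin[of "nat \<bar>k\<bar>"] k by simp
qed

text \<open>Bezout gives u p + w a = 1. If p / a is in \<open>V\<close>, this writes 1 / a as u (p /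
  a) + w; otherwise a / p is in \<open>V\<close>, and 1 / p = u + w (a / p) would be too.\<close>

lemma int_unit:
  assumes "\<not> int p dvd a"
  shows "of_int a \<in> U"
proof -
  have a0: "a \<noteq> 0" using assms by auto
  have "Rings.coprime (int p) a" using p assms by (intro prime_imp_coprime) auto
  then obtain u w where uw: "u * int p + w * a = 1" by (metis bezout_int coprime_iff_gcd_eq_1)
  have uw': "of_int u * P + of_int w * of_int a = 1"
    using arg_cong[OF uw, of "of_int :: int \<Rightarrow> complex"] by simp
  have i: "of_int m \<in> V" for m using sub csubring_of_int by blast
  have "inverse (of_int a) \<in> V"
  proof (cases "P / of_int a \<in> V")
    case True
    have "inverse (of_int a) = (of_int u * P + of_int w * of_int a) * inverse (of_int a)"
      using uw' by simp
    also have "\<dots> = of_int u * (P / of_int a) + of_int w" using a0 by (simp add: distrib_right divide_inverse mult.assoc)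
    also have "\<dots> \<in> V" by (rule V_add[OF V_mult[OF i True] i])
    finally show ?thesis .
  next
    case False
    hence *: "of_int a / P \<in> V" using total[of "P / of_int a"] by simp
    have "inverse P = (of_int u * P + of_int w * of_int a) * inverse P" using uw' by simp
    also have "\<dots> = of_int u + of_int w * (of_int a / P)" using P_nz by (simp add: distrib_right divide_inverse mult.assoc)
    also have "\<dots> \<in> V" by (rule V_add[OF i V_mult[OF i *]])
    finally show ?thesis using pV by simp
  qed
  thus ?thesis using a0 i by (simp add: U_def)
qed

text \<open>\<open>rel x n k\<close> says that the valuation of \<open>x\<close>, normalized to be 1 at \<open>p\<close>, is \<open>k / n\<close>.\<close>
definition rel :: "complex \<Rightarrow> nat \<Rightarrow> int \<Rightarrow> bool" where
  "rel x n k \<longleftrightarrow> n > 0 \<and> x ^ n / P powi k \<in> U"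

lemma rel_nz: "rel x n k \<Longrightarrow> x \<noteq> 0"
  by (auto simp: rel_def U_def power_0_left)

lemma rel_of_rat:
  assumes "q \<noteq> 0"
  obtains k where "rel (of_rat q) 1 k" "padic_abs p q = real p powi (- k)"
proof -
  obtain k a b where *: "a \<noteq> 0" "b \<noteq> 0" "\<not> int p dvd a" "\<not> int p dvd b"
    "q * of_int b = of_nat p powi k * of_int a" "padic_abs p q = real p powi (- k)"
    using padic_abs_quotient[OF p assms] .
  have powi: "of_rat (of_nat p powi k) = P powi k"
    by (simp add: power_int_def of_rat_power of_rat_inverse)
  have "of_rat q * of_int b = P powi k * of_int a"
    using arg_cong[OF *(5), of "of_rat :: rat \<Rightarrow> complex"] by (simp add: of_rat_mult powi)
  hence "of_rat q / P powi k = of_int a / of_int b" using *(2) P_nz by (simp add: field_simps)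
  moreover have "of_int a / of_int b \<in> U" using * int_unit by (intro U_divide) auto
  ultimately have "rel (of_rat q) 1 k" by (simp add: rel_def)
  thus thesis using that * by blast
qed

lemma rel_power: "rel x n k \<Longrightarrow> x ^ (n * m) / P powi (k * int m) \<in> U"
  using U_power[of "x ^ n / P powi k" m]
  by (simp add: rel_def power_mult power_divide power_int_mult)

lemma rel_unique:
  assumes "rel x n k" "rel x n' k'"
  shows "real_of_int k / real n = real_of_int k' / real n'"
proof -
  have "x ^ (n * n') / P powi (k * int n') \<in> U" "x ^ (n' * n) / P powi (k' * int n) \<in> U"
    using assms rel_power by blast+
  hence "(x ^ (n * n') / P powi (k * int n')) / (x ^ (n' * n) / P powi (k' * int n)) \<in> U"
    (is "?q \<in> U") by (rule U_divide)
  moreover have "x \<noteq> 0" using assms(1) by (rule rel_nz)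
  hence "?q = P powi (k' * int n - k * int n')"
    using P_nz by (simp add: power_int_diff mult.commute)
  ultimately have "k' * int n = k * int n'" using P_powi_U by (metis eq_iff_diff_eq_0)
  hence "real_of_int k' * real n = real_of_int k * real n'" by (metis of_int_mult of_int_of_nat_eq)
  thus ?thesis using assms by (simp add: rel_def field_simps)
qed

lemma rel_mult:
  assumes "rel x n k" "rel y n' k'"
  shows "rel (x * y) (n * n') (k * int n' + k' * int n)"
proof -
  have "x ^ (n * n') / P powi (k * int n') * (y ^ (n' * n) / P powi (k' * int n)) \<in> U"
    using assms rel_power by (intro U_mult)
  moreover have "x ^ (n * n') / P powi (k * int n') * (y ^ (n' * n) / P powi (k' * int n)) =
    (x * y) ^ (n * n') / P powi (k * int n' + k' * int n)"
    using P_nz by (simp add: power_int_add power_mult_distrib mult.commute)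
  ultimately show ?thesis using assms by (simp add: rel_def)
qed

text \<open>\<open>V\<close> is a local ring. One of x / y and y / x is in \<open>V\<close>; if it
  is x / y, then x + y is a multiple of y in \<open>V\<close>, and a unit only if y is one.\<close>

lemma nonunit_add:
  assumes "x \<in> V" "y \<in> V" "x \<notin> U" "y \<notin> U"
  shows "x + y \<notin> U"
proof
  assume s: "x + y \<in> U"
  have *: False if "x \<in> V" "y \<in> V" "y \<notin> U" "y \<noteq> 0" "x / y \<in> V" "x + y \<in> U" for x y
  proof -
    have "(x / y + 1) * inverse (x + y) \<in> V"
      using that U_inverse[of "x + y"] V_1 by (intro V_mult V_add) (auto simp: U_def)
    moreover have "(x / y + 1) * inverse (x + y) = inverse y"
    proof -
      have "x / y + 1 = (x + y) * inverse y" using that by (simp add: field_simps)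
      thus ?thesis using U_nz[OF that(6)] by simp
    qed
    ultimately show False using that by (simp add: U_def)
  qed
  show False
  proof (cases "x = 0 \<or> y = 0")
    case True thus False using s assms by auto
  next
    case False
    show False
    proof (cases "x / y \<in> V")
      case True thus False using *[of x y] assms False s by auto
    next
      case f: False
      hence "y / x \<in> V" using total[of "x / y"] by simp
      thus False using *[of y x] assms False s by (auto simp: add.commute)
    qed
  qed
qed

lemma nonunit_sum:
  assumes "finite I" "\<And>i. i \<in> I \<Longrightarrow> f i \<in> V - U"
  shows "sum f I \<in> V - U"
  using assms
proof (induction I rule: finite_induct)
  case empty
  show ?case using csubring_0[OF sub] by (simp add: U_def)
next
  case (insert i I)
  thus ?case using nonunit_add V_add by simp
qed

text \<open>Divisibility is a total preorder in a valuation ring; this picks a term of least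
  valuation.\<close>

lemma max_divisor:
  assumes "finite J" "J \<noteq> {}" "\<And>j. j \<in> J \<Longrightarrow> t j \<noteq> 0"
  shows "\<exists>i\<in>J. \<forall>j\<in>J. t j / t i \<in> V"
  using assms
proof (induction J rule: finite_ne_induct)
  case (singleton i)
  thus ?case using V_1 by simp
next
  case (insert k J)
  then obtain i where i: "i \<in> J" "\<And>j. j \<in> J \<Longrightarrow> t j / t i \<in> V" by auto
  have ti: "t i \<noteq> 0" "t k \<noteq> 0" using i insert.prems by auto
  show ?case
  proof (cases "t k / t i \<in> V")
    case True
    thus ?thesis using i by auto
  next
    case False
    hence ik: "t i / t k \<in> V" using total[of "t k / t i"] by simp
    have "t j / t k \<in> V" if "j \<in> J" for j
      using V_mult[OF i(2)[OF that] ik] ti by (simp add: field_simps)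
    thus ?thesis using ti V_1 by auto
  qed
qed

text \<open>After division by a term of least valuation, the remaining terms lie in \<open>V\<close>
  and sum to -1. Sums of non-units are non-units, so one of them is a unit.\<close>

lemma associate_terms:
  assumes "finite I" "sum t I = 0" "\<exists>i\<in>I. t i \<noteq> 0"
  shows "\<exists>i\<in>I. \<exists>j\<in>I. i \<noteq> j \<and> t i \<noteq> 0 \<and> t j \<noteq> 0 \<and> t j / t i \<in> U"
proof -
  define J where "J = {i\<in>I. t i \<noteq> 0}"
  have J: "finite J" "J \<noteq> {}" using assms by (auto simp: J_def)
  obtain i where i: "i \<in> J" "\<And>j. j \<in> J \<Longrightarrow> t j / t i \<in> V"
    using max_divisor[OF J, of t] by (auto simp: J_def)
  have "sum t J = sum t I" using assms(1) by (intro sum.mono_neutral_left) (auto simp: J_def)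
  hence "sum t J = 0" using assms(2) by simp
  hence "(\<Sum>j\<in>J. t j / t i) = 0" by (simp add: sum_divide_distrib[symmetric])
  hence eq: "(\<Sum>j\<in>J - {i}. t j / t i) = - 1"
  proof -
    have "t i / t i = 1" using i(1) by (simp add: J_def)
    thus ?thesis using sum.remove[OF J(1) i(1), of "\<lambda>j. t j / t i"] \<open>(\<Sum>j\<in>J. t j / t i) = 0\<close>
      by (simp add: eq_neg_iff_add_eq_0 add.commute)
  qed
  have "\<exists>j\<in>J - {i}. t j / t i \<in> U"
  proof (rule ccontr)
    assume "\<not> ?thesis"
    hence "(\<Sum>j\<in>J - {i}. t j / t i) \<in> V - U" using J i by (intro nonunit_sum) auto
    thus False using eq U_minus[OF U_1] by simp
  qed
  then obtain j where "j \<in> J" "j \<noteq> i" "t j / t i \<in> U" by blast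
  thus ?thesis using i(1) by (intro bexI[of _ i] bexI[of _ j]) (simp_all add: J_def)
qed

text \<open>The value group of \<open>V\<close> on all complex numbers may be large, but the
  valuation of an algebraic number is commensurable with that of p. In f(x) = 0 two nonzero terms
  differ by a unit, so a power of \<open>x\<close> is a rational number up to a unit, and rational
  numbers are powers of p up to units.\<close>

lemma rel_exists:
  assumes "algebraic x" "x \<noteq> 0"
  obtains n k where "rel x n k"
proof -
  note result = that
  obtain f where f: "f \<noteq> 0" "ev f x = 0" using assms(1) by (auto simp: algebraic_iff_ev)
  define t where "t = (\<lambda>i. of_rat (coeff f i) * x ^ i)"
  have sum0: "sum t {..degree f} = 0" using f(2) by (simp add: ev_altdef t_def)
  have ex: "\<exists>i\<in>{..degree f}. t i \<noteq> 0"
    using f(1) assms(2) by (intro bexI[of _ "degree f"]) (auto simp: t_def)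
  obtain i j where ij: "i \<noteq> j" "t i \<noteq> 0" "t j \<noteq> 0" "t j / t i \<in> U"
    using associate_terms[OF finite_atMost sum0 ex] by blast
  have *: thesis if ij: "i < j" "t i \<noteq> 0" "t j \<noteq> 0" "t j / t i \<in> U" for i j
  proof -
    define q where "q = coeff f i / coeff f j"
    have c: "coeff f i \<noteq> 0" "coeff f j \<noteq> 0" using ij by (auto simp: t_def)
    obtain k where k: "rel (of_rat q) 1 k" using rel_of_rat[of q] c by (auto simp: q_def)
    have "x ^ j = x ^ i * x ^ (j - i)" using ij(1) by (simp flip: power_add)
    hence "t j / t i * of_rat q = x ^ (j - i)"
      using c assms(2) by (simp add: t_def q_def of_rat_divide field_simps)
    hence "x ^ (j - i) / P powi k = t j / t i * (of_rat q / P powi k)" by simp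
    also have "\<dots> \<in> U" using ij k by (intro U_mult) (auto simp: rel_def)
    finally show thesis using result[of "j - i" k] ij by (simp add: rel_def)
  qed
  show thesis
  proof (cases "i < j")
    case True thus thesis using * ij by blast
  next
    case False
    thus thesis using *[of j i] ij U_inverse[OF ij(4)] by simp
  qed
qed

text \<open>The pairs with \<open>rel x n k\<close> are not unique, but by \<open>rel_unique\<close>
  their quotient k / n is, and for algebraic \<open>x\<close> a pair exists.\<close>

definition val :: "complex \<Rightarrow> real" where
  "val x = (if x = 0 then 0 else real p powr - (THE r. \<exists>n k. rel x n k \<and> r = real_of_int k / real n))"

lemma val_eq:
  assumes "rel x n k"
  shows "val x = real p powr - (real_of_int k / real n)"
proof -
  have "(THE r. \<exists>n k. rel x n k \<and> r = real_of_int k / real n) = real_of_int k / real n"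
    using assms rel_unique by blast
  moreover have "x \<noteq> 0" using assms by (rule rel_nz)
  ultimately show ?thesis by (simp add: val_def)
qed

lemma val_pos: "algebraic x \<Longrightarrow> x \<noteq> 0 \<Longrightarrow> val x > 0"
proof -
  assume "algebraic x" "x \<noteq> 0"
  then obtain n k where "rel x n k" using rel_exists by blast
  thus ?thesis using val_eq prime_gt_0_nat[OF p] by simp
qed

lemma val_mult:
  assumes "algebraic x" "algebraic y"
  shows "val (x * y) = val x * val y"
proof (cases "x = 0 \<or> y = 0")
  case False
  obtain n k where 1: "rel x n k" using rel_exists assms False by blast
  obtain n' k' where 2: "rel y n' k'" using rel_exists assms False by blast
  have "n > 0" "n' > 0" using 1 2 by (auto simp: rel_def)
  hence "real_of_int (k * int n' + k' * int n) / real (n * n') = real_of_int k / real n + real_of_int k' / real n'"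
    by (simp add: add_divide_distrib)
  thus ?thesis unfolding val_eq[OF 1] val_eq[OF 2] val_eq[OF rel_mult[OF 1 2]]
    by (simp only: minus_add_distrib powr_add)
qed (auto simp: val_def)

text \<open>A case of integral closedness: if x is outside \<open>V\<close>, then x = x ^ n * (1 /
  x) ^ (n - 1) puts it inside.\<close>

lemma V_root:
  assumes "x ^ n \<in> V" "n > 0"
  shows "x \<in> V"
proof (rule ccontr)
  assume x: "x \<notin> V"
  hence "inverse x \<in> V" using total by blast
  hence "x ^ n * inverse x ^ (n - 1) \<in> V" using assms csubring_power[OF sub] by (intro V_mult)
  moreover have "x \<noteq> 0" using x csubring_0[OF sub] by auto
  hence "x ^ (n - 1) * inverse x ^ (n - 1) = 1" by (intro left_right_inverse_power) simp
  hence "x ^ n * inverse x ^ (n - 1) = x"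
    using power_minus_mult[OF assms(2), of x] by (metis mult.assoc mult.commute mult.right_neutral)
  ultimately show False using x by simp
qed

text \<open>On algebraic numbers \<open>V\<close> is the unit ball of \<open>val\<close>. Closure of
  \<open>V\<close> under addition thus becomes the ultrametric inequality, after division by the
  larger summand.\<close>

lemma val_le_1_iff:
  assumes "algebraic x"
  shows "val x \<le> 1 \<longleftrightarrow> x \<in> V"
proof (cases "x = 0")
  case True
  thus ?thesis using csubring_0[OF sub] by (simp add: val_def)
next
  case False
  obtain n k where r: "rel x n k" using rel_exists assms False by blast
  have n: "n > 0" using r by (simp add: rel_def)
  have u: "x ^ n / P powi k \<in> U" using r by (simp add: rel_def)
  have p1: "real p > 1" using prime_gt_1_nat[OF p] by simp
  have "val x \<le> 1 \<longleftrightarrow> - (real_of_int k / real n) \<le> 0"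
    unfolding val_eq[OF r] using p1 powr_le_cancel_iff[of "real p" _ 0] by simp
  also have "\<dots> \<longleftrightarrow> k \<ge> 0" using n by (simp add: zero_le_divide_iff)
  also have "\<dots> \<longleftrightarrow> x \<in> V"
  proof
    assume "k \<ge> 0"
    have "P ^ nat k * (x ^ n / P powi k) \<in> V"
      using u by (intro V_mult csubring_power[OF sub] csubring_of_nat[OF sub]) (auto simp: U_def)
    hence "x ^ n \<in> V" using \<open>k \<ge> 0\<close> P_nz by (simp add: power_int_def)
    thus "x \<in> V" using n by (rule V_root)
  next
    assume x: "x \<in> V"
    show "k \<ge> 0"
    proof (rule ccontr)
      assume k: "\<not> k \<ge> 0"
      have "x ^ n * inverse (x ^ n / P powi k) \<in> V"
        using x u csubring_power[OF sub] by (intro V_mult) (auto simp: U_def)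
      moreover have "x ^ n * inverse (x ^ n / P powi k) = inverse (P ^ nat (- k))"
        using False k by (simp add: power_int_def power_inverse)
      ultimately show False using P_power_inverse_notin[of "nat (- k)"] k by simp
    qed
  qed
  finally show ?thesis .
qed

lemma val_add_max:
  assumes "algebraic x" "algebraic y" "val x \<le> val y"
  shows "val (x + y) \<le> val y"
proof (cases "y = 0")
  case True
  have "x = 0"
  proof (rule ccontr)
    assume "x \<noteq> 0"
    thus False using val_pos[OF assms(1)] assms(3) True by (simp add: val_def)
  qed
  thus ?thesis using True by simp
next
  case False
  have y: "val y > 0" using val_pos assms False by blast
  have alg: "algebraic (x / y)" "algebraic (x / y + 1)"
    using assms by (auto simp: divide_inverse intro!: algebraic_mult algebraic_add)
  have "val (x / y) * val y = val x" using val_mult[OF alg(1) assms(2)] False by simp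
  hence "val (x / y) * val y \<le> 1 * val y" using assms(3) by simp
  hence "val (x / y) \<le> 1" using y by (rule mult_right_le_imp_le)
  hence "x / y + 1 \<in> V" using val_le_1_iff alg V_add V_1 by blast
  hence "val (x / y + 1) \<le> 1" using val_le_1_iff alg by blast
  moreover have "val (x + y) = val (x / y + 1) * val y"
    using val_mult[OF alg(2) assms(2)] False by (simp add: field_simps)
  ultimately show ?thesis using y by simp
qed

lemma val_of_rat: "val (of_rat q) = padic_abs p q"
proof (cases "q = 0")
  case False
  obtain k where k: "rel (of_rat q) 1 k" "padic_abs p q = real p powi (- k)"
    using rel_of_rat[OF False] .
  have "real p > 0" using prime_gt_0_nat[OF p] by simp
  hence "real p powr real_of_int (- k) = real p powi (- k)" by (intro powr_real_of_int') auto
  thus ?thesis using k(2) val_eq[OF k(1)] by simp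
qed (simp add: val_def padic_abs_def)

lemma abs_value_on_val:
  assumes "algebraic \<alpha>"
  shows "abs_value_on (Qadj \<alpha>) val"
  unfolding abs_value_on_def
proof (intro conjI ballI)
  fix x y assume "x \<in> Qadj \<alpha>" "y \<in> Qadj \<alpha>"
  hence alg: "algebraic x" "algebraic y" using assms algebraic_Qadj by blast+
  have v0: "val 0 = 0" by (simp add: val_def)
  have nn: "val z \<ge> 0" if "algebraic z" for z using val_pos[OF that] v0 by (cases "z = 0") auto
  show "val x \<ge> 0" by (rule nn[OF alg(1)])
  show "val x = 0 \<longleftrightarrow> x = 0" using val_pos[OF alg(1)] v0 by (cases "x = 0") auto
  show "val (x * y) = val x * val y" using val_mult[OF alg] .
  show "val (x + y) \<le> val x + val y"
  proof (cases "val x \<le> val y")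
    case True
    thus ?thesis using val_add_max[OF alg True] nn[OF alg(1)] by linarith
  next
    case False
    hence "val (y + x) \<le> val x" by (intro val_add_max alg) simp
    thus ?thesis using nn[OF alg(2)] by (simp add: add.commute)
  qed
qed

end

text \<open>Take a valuation ring that contains 1 / \<alpha> but not \<alpha>. If all primes were
  invertible in it, it would contain Q and hence Q[1 / \<alpha>], a field to which \<alpha> belongs.
  So some prime p has no inverse there, and this p carries the place.\<close>

lemma padic_place_exists:
  assumes \<alpha>: "algebraic \<alpha>" "\<not> algebraic_int \<alpha>"
  obtains p v where "prime p" "abs_value_on (Qadj \<alpha>) v" "\<And>q. v (of_rat q) = padic_abs p q" "v \<alpha> > 1"
proof -
  obtain V where V: "valring V" and \<alpha>V: "\<alpha> \<notin> V" "inverse \<alpha> \<in> V" using valring_excluding[OF \<alpha>(2)] .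
  have sub: "csubring V" using V by (simp add: valring_def)
  have "\<exists>p. prime p \<and> inverse (of_nat p) \<notin> V"
  proof (rule ccontr)
    assume no: "\<not> ?thesis"
    have nat: "inverse (of_nat n) \<in> V" if "n > 0" for n :: nat using that
    proof (induction n rule: prime_divisors_induct)
      case (factor p n)
      hence "inverse (of_nat p) * inverse (of_nat n) \<in> V" using no sub by (auto simp: csubring_def)
      thus ?case by simp
    qed (use sub in \<open>auto simp: csubring_def\<close>)
    have rat: "of_rat q \<in> V" for q
    proof -
      obtain a b where "b > 0" "q = of_int a / of_int b"
        by (metis quotient_of_denom_pos quotient_of_div surj_pair)
      hence "(of_rat q :: complex) = of_int a * inverse (of_nat (nat b))"
        by (simp add: of_rat_divide) (simp add: divide_inverse)
      moreover have "of_int a \<in> V" using sub csubring_of_int by blast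
      ultimately show ?thesis using nat[of "nat b"] \<open>b > 0\<close> sub by (simp add: csubring_def)
    qed
    have "ev f (inverse \<alpha>) \<in> V" for f
      by (induction f) (use sub rat \<alpha>V in \<open>auto simp: csubring_0 csubring_def\<close>)
    moreover have "inverse (inverse \<alpha>) \<in> Qadj (inverse \<alpha>)"
      using \<alpha>(1) by (intro Qadj_inverse algebraic_inverse Qadj_self)
    then obtain f where "\<alpha> = ev f (inverse \<alpha>)" unfolding inverse_inverse_eq by (rule QadjE)
    ultimately have "\<alpha> \<in> V" by metis
    thus False using \<alpha>V by simp
  qed
  then obtain p where p: "prime p" "inverse (of_nat p) \<notin> V" by blast
  interpret padic_valring V p using V p by unfold_locales
  show thesis
  proof (rule that[OF p(1) abs_value_on_val[OF \<alpha>(1)] val_of_rat])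
    show "val \<alpha> > 1" using val_le_1_iff[OF \<alpha>(1)] \<alpha>V(1) by simp
  qed
qed

section \<open>Completions and local degrees\<close>

locale valued_adjoin =
  fixes \<alpha> :: complex and v :: "complex \<Rightarrow> real"
  assumes alg: "algebraic \<alpha>" and av: "abs_value_on (Qadj \<alpha>) v"
begin

abbreviation K where "K \<equiv> Qadj \<alpha>"

lemma K_inverse: "x \<in> K \<Longrightarrow> inverse x \<in> K"
  by (rule Qadj_inverse[OF alg])

lemma K_divide: "x \<in> K \<Longrightarrow> y \<in> K \<Longrightarrow> x / y \<in> K"
  by (rule Qadj_divide[OF alg])

lemma K_Rats: "x \<in> \<rat> \<Longrightarrow> x \<in> K"
  by (auto elim!: Rats_cases)

lemma v_nonneg: "x \<in> K \<Longrightarrow> v x \<ge> 0"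
  using av by (simp add: abs_value_on_def)

lemma v_eq_0_iff: "x \<in> K \<Longrightarrow> v x = 0 \<longleftrightarrow> x = 0"
  using av by (simp add: abs_value_on_def)

lemma v_mult: "x \<in> K \<Longrightarrow> y \<in> K \<Longrightarrow> v (x * y) = v x * v y"
  using av by (simp add: abs_value_on_def)

lemma v_add: "x \<in> K \<Longrightarrow> y \<in> K \<Longrightarrow> v (x + y) \<le> v x + v y"
  using av by (simp add: abs_value_on_def)

lemma v_0 [simp]: "v 0 = 0"
  by (simp add: v_eq_0_iff)

lemma v_pos: "x \<in> K \<Longrightarrow> x \<noteq> 0 \<Longrightarrow> v x > 0"
  using v_nonneg v_eq_0_iff by (metis less_eq_real_def)

lemma v_1 [simp]: "v 1 = 1"
proof -
  have "v 1 = v 1 * v 1" using v_mult[of 1 1] by simp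
  moreover have "v 1 > 0" by (intro v_pos) auto
  ultimately show ?thesis by simp
qed

lemma v_m1: "v (- 1) = 1"
proof -
  have "v (- 1) * v (- 1) = 1" using v_mult[of "- 1" "- 1"] by (simp add: Qadj_minus)
  moreover have "v (- 1) \<ge> 0" by (intro v_nonneg Qadj_minus) auto
  ultimately show ?thesis by (metis abs_of_nonneg abs_mult_self_eq mult_cancel_right1 power2_eq_1_iff power2_eq_square abs_1 abs_minus_cancel)
qed

lemma v_minus: "x \<in> K \<Longrightarrow> v (- x) = v x"
  using v_mult[of "- 1" x] v_m1 by (simp add: Qadj_minus)

lemma v_diff: "x \<in> K \<Longrightarrow> y \<in> K \<Longrightarrow> v (x - y) \<le> v x + v y"
  using v_add[of x "- y"] v_minus[of y] by (simp add: Qadj_minus)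

lemma v_diff_commute: "x \<in> K \<Longrightarrow> y \<in> K \<Longrightarrow> v (x - y) = v (y - x)"
  using v_minus[of "x - y"] by (simp add: Qadj_diff)

lemma v_power: "x \<in> K \<Longrightarrow> v (x ^ n) = v x ^ n"
  by (induction n) (auto simp: v_mult Qadj_power)

lemma v_inverse: "x \<in> K \<Longrightarrow> v (inverse x) = inverse (v x)"
proof (cases "x = 0")
  case False
  assume "x \<in> K"
  hence "v x * v (inverse x) = 1" using v_mult[of x "inverse x"] False by (simp add: K_inverse)
  thus ?thesis by (metis inverse_unique)
qed simp

lemma v_divide: "x \<in> K \<Longrightarrow> y \<in> K \<Longrightarrow> v (x / y) = v x / v y"
  by (simp add: divide_inverse v_mult v_inverse K_inverse)

lemma v_sum_le: "(\<And>i. i \<in> I \<Longrightarrow> f i \<in> K) \<Longrightarrow> v (sum f I) \<le> (\<Sum>i\<in>I. v (f i))"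
proof (induction I rule: infinite_finite_induct)
  case (insert i I)
  thus ?case using v_add[of "f i" "sum f I"] by (simp add: Qadj_sum)
qed auto

text \<open>A common notion for \<open>K\<close> and the rationals, so that each closure property of
  Cauchy sequences serves the completion and its subfield \<open>completion_rat\<close> at
  once.\<close>

definition subfld :: "complex set \<Rightarrow> bool" where
  "subfld F \<longleftrightarrow> csubring F \<and> (\<forall>x\<in>F. inverse x \<in> F) \<and> F \<subseteq> K"

lemma subfld_K: "subfld K"
  by (simp add: subfld_def csubring_Qadj K_inverse)

lemma subfld_Rats: "subfld \<rat>"
  using K_Rats by (auto simp: subfld_def csubring_def)

lemma cauchy_mem: "s \<in> cauchy_seqs F v \<Longrightarrow> s n \<in> F"
  by (auto simp: cauchy_seqs_def)

lemma cauchyD: "s \<in> cauchy_seqs F v \<Longrightarrow> e > 0 \<Longrightarrow> \<exists>N. \<forall>m\<ge>N. \<forall>n\<ge>N. v (s m - s n) < e"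
  by (auto simp: cauchy_seqs_def)

lemma cauchyI: "(\<And>n. s n \<in> F) \<Longrightarrow> (\<And>e. e > 0 \<Longrightarrow> \<exists>N. \<forall>m\<ge>N. \<forall>n\<ge>N. v (s m - s n) < e) \<Longrightarrow> s \<in> cauchy_seqs F v"
  by (auto simp: cauchy_seqs_def)

lemma cauchy_mono: "F \<subseteq> F' \<Longrightarrow> cauchy_seqs F v \<subseteq> cauchy_seqs F' v"
  by (auto simp: cauchy_seqs_def)

lemma cauchy_Rats: "s \<in> cauchy_seqs \<rat> v \<Longrightarrow> s \<in> cauchy_seqs K v"
  using cauchy_mono[of \<rat> K] K_Rats by auto

lemma cauchy_const: "x \<in> F \<Longrightarrow> (\<lambda>_. x) \<in> cauchy_seqs F v"
  by (auto simp: cauchy_seqs_def)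

lemma cauchy_add:
  assumes F: "subfld F" and s: "s \<in> cauchy_seqs F v" and t: "t \<in> cauchy_seqs F v"
  shows "(\<lambda>n. s n + t n) \<in> cauchy_seqs F v"
proof (rule cauchyI)
  show "s n + t n \<in> F" for n
    using F cauchy_mem[OF s] cauchy_mem[OF t] by (auto simp: subfld_def csubring_def)
next
  fix e :: real assume "e > 0"
  then obtain M N where M: "\<And>m n. m \<ge> M \<Longrightarrow> n \<ge> M \<Longrightarrow> v (s m - s n) < e / 2"
    and N: "\<And>m n. m \<ge> N \<Longrightarrow> n \<ge> N \<Longrightarrow> v (t m - t n) < e / 2"
    using cauchyD[OF s, of "e / 2"] cauchyD[OF t, of "e / 2"] by (metis half_gt_zero)
  have "v ((s m + t m) - (s n + t n)) < e" if "m \<ge> max M N" "n \<ge> max M N" for m n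
  proof -
    have k: "s m - s n \<in> K" "t m - t n \<in> K"
      using F cauchy_mem[OF s] cauchy_mem[OF t] by (auto simp: subfld_def intro!: Qadj_diff)
    have eq: "(s m + t m) - (s n + t n) = (s m - s n) + (t m - t n)" by simp
    have "v ((s m + t m) - (s n + t n)) \<le> v (s m - s n) + v (t m - t n)"
      unfolding eq by (rule v_add[OF k])
    thus ?thesis using M[of m n] N[of m n] that by simp
  qed
  thus "\<exists>N. \<forall>m\<ge>N. \<forall>n\<ge>N. v ((s m + t m) - (s n + t n)) < e" by blast
qed

lemma cauchy_minus:
  assumes F: "subfld F" and s: "s \<in> cauchy_seqs F v"
  shows "(\<lambda>n. - s n) \<in> cauchy_seqs F v"
proof (rule cauchyI)
  have sK: "s n \<in> K" for n using F cauchy_mem[OF s] by (auto simp: subfld_def)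
  show "- s n \<in> F" for n using F cauchy_mem[OF s] by (auto simp: subfld_def csubring_def)
  fix e :: real assume "e > 0"
  have "v (- s m - - s n) = v (s m - s n)" for m n using v_diff_commute[OF sK sK] by simp
  thus "\<exists>N. \<forall>m\<ge>N. \<forall>n\<ge>N. v (- s m - - s n) < e" using cauchyD[OF s \<open>e > 0\<close>] by simp
qed

lemma cauchy_bounded:
  assumes s: "s \<in> cauchy_seqs K v"
  obtains B where "B > 0" "\<And>n. v (s n) \<le> B"
proof -
  obtain N where N: "\<And>m n. m \<ge> N \<Longrightarrow> n \<ge> N \<Longrightarrow> v (s m - s n) < 1" using cauchyD[OF s, of 1] by auto
  have sK: "s n \<in> K" for n using cauchy_mem[OF s] .
  define B where "B = 1 + v (s N) + (\<Sum>n<N. v (s n))"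
  have nn: "v (s n) \<ge> 0" for n using v_nonneg[OF sK] .
  hence snn: "(\<Sum>n<N. v (s n)) \<ge> 0" by (intro sum_nonneg)
  have "v (s n) \<le> B" for n
  proof (cases "n < N")
    case True
    hence "v (s n) \<le> (\<Sum>n<N. v (s n))" using nn by (intro member_le_sum) auto
    thus ?thesis using nn[of N] by (simp add: B_def)
  next
    case False
    have "v (s n) \<le> v (s n - s N) + v (s N)" using v_add[of "s n - s N" "s N"] sK by (simp add: Qadj_diff)
    thus ?thesis using N[of n N] False snn by (simp add: B_def)
  qed
  moreover have "B > 0" using nn[of N] snn by (simp add: B_def)
  ultimately show thesis using that by blast
qed

lemma cauchy_mult:
  assumes F: "subfld F" and s: "s \<in> cauchy_seqs F v" and t: "t \<in> cauchy_seqs F v"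
  shows "(\<lambda>n. s n * t n) \<in> cauchy_seqs F v"
proof (rule cauchyI)
  show "s n * t n \<in> F" for n
    using F cauchy_mem[OF s] cauchy_mem[OF t] by (auto simp: subfld_def csubring_def)
next
  have FK: "F \<subseteq> K" using F by (simp add: subfld_def)
  have sK: "s n \<in> K" and tK: "t n \<in> K" for n using cauchy_mem[OF s] cauchy_mem[OF t] FK by auto
  obtain A where A: "A > 0" "\<And>n. v (s n) \<le> A" using cauchy_bounded cauchy_mono[OF FK] s by blast
  obtain B where B: "B > 0" "\<And>n. v (t n) \<le> B" using cauchy_bounded cauchy_mono[OF FK] t by blast
  fix e :: real assume "e > 0"
  hence e: "e / (2 * B) > 0" "e / (2 * A) > 0" using A B by auto
  obtain M where M: "\<And>m n. m \<ge> M \<Longrightarrow> n \<ge> M \<Longrightarrow> v (s m - s n) < e / (2 * B)"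
    using cauchyD[OF s e(1)] by auto
  obtain N where N: "\<And>m n. m \<ge> N \<Longrightarrow> n \<ge> N \<Longrightarrow> v (t m - t n) < e / (2 * A)"
    using cauchyD[OF t e(2)] by auto
  have "v (s m * t m - s n * t n) < e" if "m \<ge> max M N" "n \<ge> max M N" for m n
  proof -
    have "s m * t m - s n * t n = (s m - s n) * t m + s n * (t m - t n)" by (simp add: algebra_simps)
    also have "v \<dots> \<le> v ((s m - s n) * t m) + v (s n * (t m - t n))"
      using sK tK by (intro v_add Qadj_mult Qadj_diff)
    also have "\<dots> = v (s m - s n) * v (t m) + v (s n) * v (t m - t n)"
      using sK tK by (simp add: v_mult Qadj_diff)
    also have "\<dots> < e / (2 * B) * B + A * (e / (2 * A))"
    proof (rule add_less_le_mono)
      have "v (s m - s n) * v (t m) \<le> v (s m - s n) * B"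
        using B(2) sK by (intro mult_left_mono v_nonneg Qadj_diff) auto
      also have "\<dots> < e / (2 * B) * B" using M[of m n] that B(1) by (intro mult_strict_right_mono) auto
      finally show "v (s m - s n) * v (t m) < e / (2 * B) * B" .
      show "v (s n) * v (t m - t n) \<le> A * (e / (2 * A))"
        using A N[of m n] that sK tK by (intro mult_mono v_nonneg Qadj_diff) auto
    qed
    also have "\<dots> = e" using A(1) B(1) by simp
    finally show ?thesis .
  qed
  thus "\<exists>N. \<forall>m\<ge>N. \<forall>n\<ge>N. v (s m * t m - s n * t n) < e" by blast
qed

text \<open>Values that reach some e > 0 at arbitrarily large indices stay above e / 2 as soon as
  the terms are e / 2 close to each other.\<close>

lemma cauchy_nonnull_bound:
  assumes s: "s \<in> cauchy_seqs K v" and nn: "\<not> (\<lambda>n. v (s n)) \<longlonglongrightarrow> 0"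
  obtains \<delta> N where "\<delta> > 0" "\<And>n. n \<ge> N \<Longrightarrow> v (s n) \<ge> \<delta>"
proof -
  have sK: "s n \<in> K" for n using cauchy_mem[OF s] .
  obtain e where e: "e > 0" "\<And>N. \<exists>n\<ge>N. v (s n) \<ge> e"
    using nn v_nonneg[OF sK] unfolding LIMSEQ_iff by (auto simp: not_less)
  obtain N where N: "\<And>m n. m \<ge> N \<Longrightarrow> n \<ge> N \<Longrightarrow> v (s m - s n) < e / 2"
    using cauchyD[OF s, of "e / 2"] e(1) by auto
  obtain n0 where n0: "n0 \<ge> N" "v (s n0) \<ge> e" using e(2) by blast
  have "v (s n) \<ge> e / 2" if "n \<ge> N" for n
  proof -
    have "v (s n0) \<le> v (s n0 - s n) + v (s n)"
      using v_add[of "s n0 - s n" "s n"] sK by (simp add: Qadj_diff)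
    thus ?thesis using N[of n0 n] n0 that by simp
  qed
  thus thesis using that[of "e / 2" N] e(1) by simp
qed

text \<open>Finitely many terms may vanish and then have inverse 0; the later ones are bounded away
  from 0. This is why the product is only claimed to tend to 1.\<close>

lemma cauchy_inverse:
  assumes F: "subfld F" and s: "s \<in> cauchy_seqs F v" and nn: "\<not> (\<lambda>n. v (s n)) \<longlonglongrightarrow> 0"
  shows "(\<lambda>n. inverse (s n)) \<in> cauchy_seqs F v"
    and "(\<lambda>n. v (s n * inverse (s n) - 1)) \<longlonglongrightarrow> 0"
proof -
  have FK: "F \<subseteq> K" using F by (simp add: subfld_def)
  have sK: "s n \<in> K" for n using cauchy_mem[OF s] FK by auto
  obtain \<delta> N where \<delta>: "\<delta> > 0" "\<And>n. n \<ge> N \<Longrightarrow> v (s n) \<ge> \<delta>"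
    using cauchy_nonnull_bound cauchy_mono[OF FK] s nn by blast
  have nz: "s n \<noteq> 0" if "n \<ge> N" for n using \<delta>(2)[OF that] \<delta>(1) by auto
  show "(\<lambda>n. inverse (s n)) \<in> cauchy_seqs F v"
  proof (rule cauchyI)
    show "inverse (s n) \<in> F" for n using F cauchy_mem[OF s] by (simp add: subfld_def)
    fix e :: real assume "e > 0"
    hence "e * \<delta>\<^sup>2 > 0" using \<delta>(1) by simp
    then obtain M where M: "\<And>m n. m \<ge> M \<Longrightarrow> n \<ge> M \<Longrightarrow> v (s m - s n) < e * \<delta>\<^sup>2"
      using cauchyD[OF s] by blast
    have "v (inverse (s m) - inverse (s n)) < e" if "m \<ge> max M N" "n \<ge> max M N" for m n
    proof -
      have nz': "s m \<noteq> 0" "s n \<noteq> 0" using nz that by auto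
      have "inverse (s m) - inverse (s n) = (s n - s m) / (s m * s n)"
        using nz' by (simp add: divide_simps)
      hence "v (inverse (s m) - inverse (s n)) = v (s n - s m) / (v (s m) * v (s n))"
        using sK by (simp add: v_divide v_mult Qadj_mult Qadj_diff)
      also have "\<dots> < e * \<delta>\<^sup>2 / (v (s m) * v (s n))"
        using M[of n m] that nz' sK by (intro divide_strict_right_mono mult_pos_pos v_pos) auto
      also have "\<dots> \<le> e * \<delta>\<^sup>2 / (\<delta> * \<delta>)"
        using \<delta> that \<open>e > 0\<close> by (intro divide_left_mono mult_mono v_nonneg sK) (auto intro!: mult_pos_pos v_pos sK nz')
      also have "\<dots> = e" using \<delta>(1) by (simp add: power2_eq_square)
      finally show ?thesis .
    qed
    thus "\<exists>N. \<forall>m\<ge>N. \<forall>n\<ge>N. v (inverse (s m) - inverse (s n)) < e" by blast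
  qed
  have "eventually (\<lambda>n. v (s n * inverse (s n) - 1) = 0) sequentially"
    using eventually_ge_at_top[of N] by eventually_elim (simp add: nz)
  thus "(\<lambda>n. v (s n * inverse (s n) - 1)) \<longlonglongrightarrow> 0" by (rule tendsto_eventually)
qed

lemma null_add:
  assumes "\<And>n. s n \<in> K" "\<And>n. t n \<in> K" "(\<lambda>n. v (s n)) \<longlonglongrightarrow> 0" "(\<lambda>n. v (t n)) \<longlonglongrightarrow> 0"
  shows "(\<lambda>n. v (s n + t n)) \<longlonglongrightarrow> 0"
proof (rule real_tendsto_sandwich[where f = "\<lambda>_. 0" and h = "\<lambda>n. v (s n) + v (t n)"])
  show "(\<lambda>n. v (s n) + v (t n)) \<longlonglongrightarrow> 0" using tendsto_add[OF assms(3,4)] by simp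
  show "eventually (\<lambda>n. 0 \<le> v (s n + t n)) sequentially"
    using assms(1,2) by (intro always_eventually allI v_nonneg Qadj_add)
  show "eventually (\<lambda>n. v (s n + t n) \<le> v (s n) + v (t n)) sequentially"
    using assms(1,2) v_add by (intro always_eventually allI) auto
qed auto

lemma null_mult:
  assumes s: "s \<in> cauchy_seqs K v" and t: "\<And>n. t n \<in> K" "(\<lambda>n. v (t n)) \<longlonglongrightarrow> 0"
  shows "(\<lambda>n. v (s n * t n)) \<longlonglongrightarrow> 0"
proof -
  obtain B where B: "B > 0" "\<And>n. v (s n) \<le> B" using cauchy_bounded[OF s] by blast
  show ?thesis
  proof (rule real_tendsto_sandwich[where f = "\<lambda>_. 0" and h = "\<lambda>n. B * v (t n)"])
    show "(\<lambda>n. B * v (t n)) \<longlonglongrightarrow> 0" using tendsto_mult[OF tendsto_const t(2), of B] by simp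
    show "eventually (\<lambda>n. v (s n * t n) \<le> B * v (t n)) sequentially"
      using B(2) t(1) cauchy_mem[OF s] v_nonneg by (intro always_eventually allI) (auto simp: v_mult intro: mult_right_mono)
    show "eventually (\<lambda>n. 0 \<le> v (s n * t n)) sequentially"
      using t(1) cauchy_mem[OF s] by (intro always_eventually allI v_nonneg Qadj_mult)
  qed auto
qed

section \<open>The completion as a field over the completion of Q\<close>

abbreviation R where "R \<equiv> cauchy_ring K v"
abbreviation N where "N \<equiv> null_seqs K v"
abbreviation C where "C \<equiv> completion K v"
abbreviation F where "F \<equiv> completion_rat K v"

lemma R_simps [simp]:
  "carrier R = cauchy_seqs K v" "monoid.mult R s t = (\<lambda>n. s n * t n)" "monoid.one R = (\<lambda>_. 1)"
  "ring.zero R = (\<lambda>_. 0)" "ring.add R s t = (\<lambda>n. s n + t n)" by (simp_all add: cauchy_ring_def)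

lemma cring_R: "cring R"
proof (rule cringI)
  show "abelian_group R"
  proof (rule abelian_groupI)
    fix s assume "s \<in> carrier R"
    thus "\<exists>t\<in>carrier R. ring.add R t s = ring.zero R"
      using cauchy_minus[OF subfld_K] by (intro bexI[of _ "\<lambda>n. - s n"]) auto
  qed (auto simp: add_ac cauchy_add[OF subfld_K] cauchy_const)
  show "comm_monoid R"
    by (rule comm_monoidI) (auto simp: mult_ac cauchy_mult[OF subfld_K] cauchy_const)
qed (auto simp: algebra_simps)

lemma R_minus: "s \<in> cauchy_seqs K v \<Longrightarrow> a_inv R s = (\<lambda>n. - s n)"
proof -
  interpret cring R by (rule cring_R)
  assume s: "s \<in> cauchy_seqs K v"
  show ?thesis by (rule minus_equality) (use s cauchy_minus[OF subfld_K s] in auto)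
qed

lemma ideal_N: "ideal N R"
proof (rule idealI)
  interpret cring R by (rule cring_R)
  show "ring R" by (rule ring_axioms)
  show "subgroup N (add_monoid R)"
  proof (rule add.subgroupI)
    show "N \<subseteq> carrier R" by (auto simp: null_seqs_def)
    show "N \<noteq> {}" using cauchy_const[of 0 K] by (auto simp: null_seqs_def)
  next
    fix s assume s: "s \<in> N"
    hence "v (- s n) = v (s n)" for n using v_minus cauchy_mem by (auto simp: null_seqs_def)
    thus "a_inv R s \<in> N" using s R_minus cauchy_minus[OF subfld_K] by (auto simp: null_seqs_def)
  next
    fix s t assume st: "s \<in> N" "t \<in> N"
    thus "s \<oplus>\<^bsub>R\<^esub> t \<in> N"
      using null_add[of s t] cauchy_add[OF subfld_K] cauchy_mem by (auto simp: null_seqs_def)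
  qed
next
  fix t s assume "t \<in> N" "s \<in> carrier R"
  thus "s \<otimes>\<^bsub>R\<^esub> t \<in> N"
    using null_mult[of s t] cauchy_mult[OF subfld_K, of s t] cauchy_mem by (auto simp: null_seqs_def)
  thus "t \<otimes>\<^bsub>R\<^esub> s \<in> N" by (simp add: mult.commute)
qed

definition cls :: "(nat \<Rightarrow> complex) \<Rightarrow> (nat \<Rightarrow> complex) set" where
  "cls s = N +>\<^bsub>R\<^esub> s"

lemma cls_eq_iff:
  assumes s: "s \<in> cauchy_seqs K v" and t: "t \<in> cauchy_seqs K v"
  shows "cls s = cls t \<longleftrightarrow> (\<lambda>n. v (s n - t n)) \<longlonglongrightarrow> 0"
proof -
  interpret cring R by (rule cring_R)
  have "s \<ominus>\<^bsub>R\<^esub> t = (\<lambda>n. s n - t n)" using R_minus[OF t] by (simp add: a_minus_def)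
  moreover have "(\<lambda>n. s n + - t n) \<in> cauchy_seqs K v"
    by (intro cauchy_add[OF subfld_K] cauchy_minus[OF subfld_K] s t)
  ultimately have "s \<ominus>\<^bsub>R\<^esub> t \<in> N \<longleftrightarrow> (\<lambda>n. v (s n - t n)) \<longlonglongrightarrow> 0" by (simp add: null_seqs_def)
  moreover have "s \<ominus>\<^bsub>R\<^esub> t \<in> N \<longleftrightarrow> cls s = cls t"
    unfolding cls_def using s t by (intro quotient_eq_iff_same_a_r_cos[OF ideal_N]) auto
  ultimately show ?thesis by simp
qed

lemma cls_hom: "cls \<in> ring_hom R C"
  using ideal.rcos_ring_hom[OF ideal_N] by (simp add: completion_def cls_def[abs_def])

lemma carrier_C: "carrier C = cls ` cauchy_seqs K v"
  by (auto simp: completion_def FactRing_def A_RCOSETS_def' cls_def)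

lemma cls_add: "s \<in> cauchy_seqs K v \<Longrightarrow> t \<in> cauchy_seqs K v \<Longrightarrow> cls s \<oplus>\<^bsub>C\<^esub> cls t = cls (\<lambda>n. s n + t n)"
  using ring_hom_add[OF cls_hom, of s t] by simp

lemma cls_mult: "s \<in> cauchy_seqs K v \<Longrightarrow> t \<in> cauchy_seqs K v \<Longrightarrow> cls s \<otimes>\<^bsub>C\<^esub> cls t = cls (\<lambda>n. s n * t n)"
  using ring_hom_mult[OF cls_hom, of s t] by simp

lemma cls_one: "\<one>\<^bsub>C\<^esub> = cls (\<lambda>_. 1)"
  using ring_hom_one[OF cls_hom] by simp

lemma cring_C: "cring C"
  unfolding completion_def by (rule ideal.quotient_is_cring[OF ideal_N cring_R])

lemma cls_zero: "\<zero>\<^bsub>C\<^esub> = cls (\<lambda>_. 0)"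
  using ring_hom_zero[OF cls_hom] cring_R cring_C by (simp add: cring_def)

lemma cls_eq_zero_iff: "s \<in> cauchy_seqs K v \<Longrightarrow> cls s = \<zero>\<^bsub>C\<^esub> \<longleftrightarrow> (\<lambda>n. v (s n)) \<longlonglongrightarrow> 0"
  using cls_eq_iff[of s "\<lambda>_. 0"] by (simp add: cls_zero cauchy_const)

lemma cls_inverse:
  assumes "subfld E" "s \<in> cauchy_seqs E v" "cls s \<noteq> \<zero>\<^bsub>C\<^esub>"
  shows "(\<lambda>n. inverse (s n)) \<in> cauchy_seqs E v" "cls s \<otimes>\<^bsub>C\<^esub> cls (\<lambda>n. inverse (s n)) = \<one>\<^bsub>C\<^esub>"
proof -
  have E: "cauchy_seqs E v \<subseteq> cauchy_seqs K v"
    using assms(1) by (intro cauchy_mono) (simp add: subfld_def)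
  have s: "s \<in> cauchy_seqs K v" using assms E by auto
  hence nn: "\<not> (\<lambda>n. v (s n)) \<longlonglongrightarrow> 0" using assms(3) cls_eq_zero_iff by simp
  show inv: "(\<lambda>n. inverse (s n)) \<in> cauchy_seqs E v" by (rule cauchy_inverse[OF assms(1,2) nn])
  hence inv': "(\<lambda>n. inverse (s n)) \<in> cauchy_seqs K v" using E by auto
  show "cls s \<otimes>\<^bsub>C\<^esub> cls (\<lambda>n. inverse (s n)) = \<one>\<^bsub>C\<^esub>" unfolding cls_mult[OF s inv'] cls_one
    using cauchy_inverse(2)[OF assms(1,2) nn] cauchy_mult[OF subfld_K s inv']
    by (subst cls_eq_iff) (auto simp: cauchy_const)
qed

lemma field_C: "field C"
proof (rule cring.cring_fieldI2[OF cring_C])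
  show "\<zero>\<^bsub>C\<^esub> \<noteq> \<one>\<^bsub>C\<^esub>"
    unfolding cls_one using cls_eq_zero_iff[of "\<lambda>_. 1"] by (auto simp: cauchy_const LIMSEQ_const_iff)
  fix a assume "a \<in> carrier C" "a \<noteq> \<zero>\<^bsub>C\<^esub>"
  thus "\<exists>b\<in>carrier C. a \<otimes>\<^bsub>C\<^esub> b = \<one>\<^bsub>C\<^esub>" unfolding carrier_C using cls_inverse[OF subfld_K] by blast
qed

lemma F_eq: "F = cls ` cauchy_seqs \<rat> v"
  by (auto simp: completion_rat_def cls_def)

lemma subfield_F: "subfield F C"
proof -
  interpret field C by (rule field_C)
  have sub: "F \<subseteq> carrier C" unfolding F_eq carrier_C using cauchy_Rats by auto
  show ?thesis
  proof (rule subfieldI')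
    show "subring F C"
    proof (rule subringI)
      show "\<one>\<^bsub>C\<^esub> \<in> F" unfolding F_eq cls_one by (intro imageI cauchy_const) auto
    next
      fix h assume "h \<in> F"
      then obtain s where s: "s \<in> cauchy_seqs \<rat> v" "h = cls s" by (auto simp: F_eq)
      have m: "(\<lambda>n. - s n) \<in> cauchy_seqs \<rat> v" by (rule cauchy_minus[OF subfld_Rats s(1)])
      have "cls (\<lambda>n. - s n) \<oplus>\<^bsub>C\<^esub> h = \<zero>\<^bsub>C\<^esub>"
        using cls_add[OF cauchy_Rats[OF m] cauchy_Rats[OF s(1)]] by (simp add: s cls_zero)
      hence "\<ominus>\<^bsub>C\<^esub> h = cls (\<lambda>n. - s n)"
        using s m cauchy_Rats by (intro minus_equality) (auto simp: carrier_C)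
      thus "\<ominus>\<^bsub>C\<^esub> h \<in> F" using m by (simp add: F_eq)
    next
      fix h k assume "h \<in> F" "k \<in> F"
      then obtain s t where st: "s \<in> cauchy_seqs \<rat> v" "h = cls s" "t \<in> cauchy_seqs \<rat> v" "k = cls t"
        by (auto simp: F_eq)
      show "h \<otimes>\<^bsub>C\<^esub> k \<in> F" "h \<oplus>\<^bsub>C\<^esub> k \<in> F"
        using st cauchy_Rats cauchy_mult[OF subfld_Rats st(1,3)] cauchy_add[OF subfld_Rats st(1,3)]
        by (simp_all add: F_eq cls_mult cls_add)
    qed (rule sub)
  next
    fix k assume k: "k \<in> F - {\<zero>\<^bsub>C\<^esub>}"
    then obtain s where s: "s \<in> cauchy_seqs \<rat> v" "k = cls s" by (auto simp: F_eq)
    have i: "(\<lambda>n. inverse (s n)) \<in> cauchy_seqs \<rat> v" "k \<otimes>\<^bsub>C\<^esub> cls (\<lambda>n. inverse (s n)) = \<one>\<^bsub>C\<^esub>"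
      using cls_inverse[OF subfld_Rats s(1)] k s by auto
    have "inv\<^bsub>C\<^esub> k = cls (\<lambda>n. inverse (s n))"
      using i s cauchy_Rats by (intro comm_inv_char) (auto simp: carrier_C)
    thus "inv\<^bsub>C\<^esub> k \<in> F" using i by (simp add: F_eq)
  qed
qed

text \<open>Linear combinations of classes are classes of termwise combinations; spanning and
  independence over the completion of Q thereby become statements about null sequences.\<close>

lemma combine_cls:
  assumes "\<And>j. j \<in> set js \<Longrightarrow> c j \<in> cauchy_seqs \<rat> v" "\<And>j. j \<in> set js \<Longrightarrow> e j \<in> K"
  shows "ring.combine C (map (\<lambda>j. cls (c j)) js) (map (\<lambda>j. cls (\<lambda>_. e j)) js) = cls (\<lambda>n. \<Sum>j\<leftarrow>js. c j n * e j)
     \<and> (\<lambda>n. \<Sum>j\<leftarrow>js. c j n * e j) \<in> cauchy_seqs K v" using assms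
proof (induction js)
  interpret field C by (rule field_C)
  case Nil
  show ?case by (simp add: cls_zero cauchy_const)
next
  interpret field C by (rule field_C)
  case (Cons j js)
  have IH: "combine (map (\<lambda>j. cls (c j)) js) (map (\<lambda>j. cls (\<lambda>_. e j)) js) = cls (\<lambda>n. \<Sum>j\<leftarrow>js. c j n * e j)"
    "(\<lambda>n. \<Sum>j\<leftarrow>js. c j n * e j) \<in> cauchy_seqs K v" using Cons by auto
  have j: "c j \<in> cauchy_seqs K v" "(\<lambda>_. e j) \<in> cauchy_seqs K v"
    using Cons.prems cauchy_Rats cauchy_const by auto
  have m: "(\<lambda>n. c j n * e j) \<in> cauchy_seqs K v" by (rule cauchy_mult[OF subfld_K j])
  show ?case using IH j m cls_mult[OF j] cls_add[OF m IH(2)] cauchy_add[OF subfld_K m IH(2)] by simp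
qed

end

lemma Qadj_span:
  assumes "is_minpoly m x" "y \<in> Qadj x"
  obtains c where "y = (\<Sum>j<degree m. of_rat (c j) * x ^ j)"
proof -
  obtain p where p: "y = ev p x" using assms(2) by (rule QadjE)
  define r where "r = p mod m"
  have "y = ev r x"
    using p minpoly_root[OF assms(1)] ev_add[of "m * (p div m)" "p mod m" x] by (simp add: r_def)
  moreover have "degree r < degree m"
    using minpoly_degree_pos[OF assms(1)] minpoly_nonzero[OF assms(1)] degree_mod_less[of m p] by (auto simp: r_def)
  hence "ev r x = (\<Sum>j<degree m. of_rat (coeff r j) * x ^ j)"
    unfolding ev_altdef by (intro sum.mono_neutral_left) (auto simp: coeff_eq_0)
  ultimately show thesis using that by blast
qed

section \<open>A basis of the completion made of powers of \<alpha>\<close>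

context valued_adjoin begin

definition lincomb :: "nat set \<Rightarrow> (nat \<Rightarrow> rat) \<Rightarrow> complex" where
  "lincomb J c = (\<Sum>j\<in>J. of_rat (c j) * \<alpha> ^ j)"

lemma lincomb_K [simp, intro]: "lincomb J c \<in> K"
  unfolding lincomb_def by (intro Qadj_sum Qadj_mult Qadj_power) auto

lemma lincomb_diff: "lincomb J c - lincomb J d = lincomb J (\<lambda>j. c j - d j)"
  by (simp add: lincomb_def of_rat_diff algebra_simps sum_subtractf)

text \<open>Approximation instead of equality, because powers of \<alpha> that are independent over
  Q may become dependent over the completion of Q. A set of exponents of least cardinality with this
  property has no such redundancy.\<close>

definition dense_span :: "nat set \<Rightarrow> bool" where
  "dense_span J \<longleftrightarrow> finite J \<and> (\<forall>x\<in>K. \<forall>e>0. \<exists>c. v (x - lincomb J c) < e)"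

lemma dense_span_exists: "\<exists>J. dense_span J"
proof -
  obtain m where m: "is_minpoly m \<alpha>" using minpoly_exists[OF alg] .
  have "\<exists>c. v (x - lincomb {..<degree m} c) < e" if x: "x \<in> K" and e: "e > 0" for x e
  proof -
    obtain c where "x = lincomb {..<degree m} c"
      using Qadj_span[OF m x] unfolding lincomb_def by blast
    thus ?thesis using e by (intro exI[of _ c]) simp
  qed
  thus ?thesis unfolding dense_span_def by blast
qed

text \<open>If \<alpha> ^ j were a limit of combinations of the other powers, these could replace
  it, and J - {j} would have a dense span as well.\<close>

lemma minimal_dense_span_gap:
  assumes J: "dense_span J" and min: "\<And>J'. dense_span J' \<Longrightarrow> card J \<le> card J'" and j: "j \<in> J"
  shows "\<exists>\<delta>>0. \<forall>c. v (\<alpha> ^ j - lincomb (J - {j}) c) \<ge> \<delta>"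
proof (rule ccontr)
  assume "\<not> ?thesis"
  hence close: "\<exists>c. v (\<alpha> ^ j - lincomb (J - {j}) c) < \<delta>" if "\<delta> > 0" for \<delta>
    using that by (meson not_le)
  have fin: "finite J" using J by (simp add: dense_span_def)
  have split: "lincomb J c = of_rat (c j) * \<alpha> ^ j + lincomb (J - {j}) c" for c
    unfolding lincomb_def by (rule sum.remove[OF fin j])
  have "\<exists>c. v (x - lincomb (J - {j}) c) < e" if x: "x \<in> K" and e: "e > 0" for x e
  proof -
    have "e / 2 > 0" using e by simp
    then obtain c where c: "v (x - lincomb J c) < e / 2" using J x unfolding dense_span_def by blast
    show ?thesis
    proof (cases "c j = 0")
      case True
      hence "lincomb J c = lincomb (J - {j}) c" by (simp add: split)
      thus ?thesis using c e by (intro exI[of _ c]) simp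
    next
      case False
      have vc: "v (of_rat (c j)) > 0" using False by (intro v_pos) auto
      \<comment> \<open>This accuracy compensates the factor c_j and leaves an error below e /
        2.\<close>
      hence "e / (2 * v (of_rat (c j))) > 0" using e by simp
      then obtain d where d: "v (\<alpha> ^ j - lincomb (J - {j}) d) < e / (2 * v (of_rat (c j)))"
        using close by blast
      define b where "b = (\<lambda>i. c i + c j * d i)"
      have lb: "lincomb (J - {j}) b = lincomb (J - {j}) c + of_rat (c j) * lincomb (J - {j}) d"
        by (simp add: lincomb_def b_def of_rat_add of_rat_mult algebra_simps sum.distrib sum_distrib_left)
      have eq: "x - lincomb (J - {j}) b = (x - lincomb J c) + of_rat (c j) * (\<alpha> ^ j - lincomb (J - {j}) d)"
        unfolding lb split by (simp add: algebra_simps)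
      have "v (x - lincomb (J - {j}) b) \<le> v (x - lincomb J c) + v (of_rat (c j) * (\<alpha> ^ j - lincomb (J - {j}) d))"
        unfolding eq using x by (intro v_add Qadj_diff Qadj_mult Qadj_power) auto
      also have "v (of_rat (c j) * (\<alpha> ^ j - lincomb (J - {j}) d)) = v (of_rat (c j)) * v (\<alpha> ^ j - lincomb (J - {j}) d)"
        by (intro v_mult Qadj_diff Qadj_power) auto
      also have "\<dots> < v (of_rat (c j)) * (e / (2 * v (of_rat (c j))))"
        using d vc by (intro mult_strict_left_mono)
      also have "\<dots> = e / 2" using vc by simp
      finally have "v (x - lincomb (J - {j}) b) < e" using c by simp
      thus ?thesis by blast
    qed
  qed
  hence "dense_span (J - {j})" using fin by (simp add: dense_span_def)
  hence "card J \<le> card (J - {j})" by (rule min)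
  thus False using fin j card_Diff1_less[OF fin j] by simp
qed

text \<open>The nontrivial half of an equivalence of norms. For a nonzero coefficient c_j, division
  by it turns the combination into the difference of \<alpha> ^ j and a combination of the other
  powers, to which the gap of a minimal \<open>J\<close> applies.\<close>

lemma coefficient_bound:
  obtains J \<delta> where "dense_span J" "\<delta> > 0" "\<And>c j. j \<in> J \<Longrightarrow> v (of_rat (c j)) * \<delta> \<le> v (lincomb J c)"
proof -
  obtain J where J: "dense_span J" and min: "\<And>J'. dense_span J' \<Longrightarrow> card J \<le> card J'"
    using dense_span_exists ex_has_least_nat[of dense_span _ card] by blast
  have fin: "finite J" using J by (simp add: dense_span_def)
  have "\<forall>j\<in>J. \<exists>\<delta>>0. \<forall>c. v (\<alpha> ^ j - lincomb (J - {j}) c) \<ge> \<delta>"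
    using minimal_dense_span_gap[OF J min] by blast
  then obtain d where d: "\<And>j. j \<in> J \<Longrightarrow> d j > 0" "\<And>j c. j \<in> J \<Longrightarrow> v (\<alpha> ^ j - lincomb (J - {j}) c) \<ge> d j"
    using bchoice[of J "\<lambda>j \<delta>. \<delta> > 0 \<and> (\<forall>c. v (\<alpha> ^ j - lincomb (J - {j}) c) \<ge> \<delta>)"] by blast
  define \<delta> :: real where "\<delta> = Min (insert 1 (d ` J))"
  have \<delta>: "\<delta> > 0" "\<And>j. j \<in> J \<Longrightarrow> \<delta> \<le> d j" using fin d(1) by (auto simp: \<delta>_def)
  have "v (of_rat (c j)) * \<delta> \<le> v (lincomb J c)" if j: "j \<in> J" for c j
  proof (cases "c j = 0")
    case True
    thus ?thesis by (simp add: v_nonneg)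
  next
    case False
    define b where "b = (\<lambda>i. - c i / c j)"
    have "of_rat (c j) * lincomb (J - {j}) b = - lincomb (J - {j}) c"
      using False by (simp add: lincomb_def b_def sum_distrib_left of_rat_divide of_rat_minus sum_negf)
    moreover have "lincomb J c = of_rat (c j) * \<alpha> ^ j + lincomb (J - {j}) c"
      unfolding lincomb_def by (rule sum.remove[OF fin j])
    ultimately have "lincomb J c = of_rat (c j) * (\<alpha> ^ j - lincomb (J - {j}) b)"
      by (simp add: right_diff_distrib)
    hence "v (lincomb J c) = v (of_rat (c j)) * v (\<alpha> ^ j - lincomb (J - {j}) b)"
      by (simp add: v_mult Qadj_diff Qadj_power)
    also have "\<dots> \<ge> v (of_rat (c j)) * \<delta>"
      using \<delta>(2)[OF j] d(2)[OF j, of b] by (intro mult_left_mono v_nonneg) auto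
    finally show ?thesis .
  qed
  thus thesis using that J \<delta>(1) by blast
qed

text \<open>Approximate the n-th term to within 1 / (n + 1) by a rational combination; the
  coefficient bound carries the Cauchy property over to each coefficient.\<close>

lemma cauchy_decompose:
  assumes J: "dense_span J" and \<delta>: "\<delta> > 0" and bd: "\<And>c j. j \<in> J \<Longrightarrow> v (of_rat (c j)) * \<delta> \<le> v (lincomb J c)"
    and s: "s \<in> cauchy_seqs K v"
  obtains c :: "nat \<Rightarrow> nat \<Rightarrow> rat" where "\<And>j. j \<in> J \<Longrightarrow> (\<lambda>n. of_rat (c n j)) \<in> cauchy_seqs \<rat> v"
    "(\<lambda>n. v (s n - lincomb J (c n))) \<longlonglongrightarrow> 0"
proof -
  have sK: "s n \<in> K" for n using cauchy_mem[OF s] .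
  have "\<forall>n. \<exists>c. v (s n - lincomb J c) < inverse (real (Suc n))"
    using J sK by (auto simp: dense_span_def)
  then obtain c where c: "\<And>n. v (s n - lincomb J (c n)) < inverse (real (Suc n))" by metis
  have null: "(\<lambda>n. v (s n - lincomb J (c n))) \<longlonglongrightarrow> 0"
  proof (rule real_tendsto_sandwich[where f = "\<lambda>_. 0" and h = "\<lambda>n. inverse (real (Suc n))"])
    show "eventually (\<lambda>n. 0 \<le> v (s n - lincomb J (c n))) sequentially"
      using sK by (intro always_eventually allI v_nonneg Qadj_diff) auto
    show "eventually (\<lambda>n. v (s n - lincomb J (c n)) \<le> inverse (real (Suc n))) sequentially"
      using c by (intro always_eventually allI less_imp_le)
    show "(\<lambda>n. inverse (real (Suc n))) \<longlonglongrightarrow> 0" by (rule LIMSEQ_inverse_real_of_nat)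
  qed auto
  have "(\<lambda>n. of_rat (c n j)) \<in> cauchy_seqs \<rat> v" if j: "j \<in> J" for j
  proof (rule cauchyI)
    fix e :: real assume "e > 0"
    hence e: "e * \<delta> / 3 > 0" using \<delta> by simp
    obtain M where M: "\<And>m n. m \<ge> M \<Longrightarrow> n \<ge> M \<Longrightarrow> v (s m - s n) < e * \<delta> / 3"
      using cauchyD[OF s e] by blast
    obtain N where N: "\<And>n. n \<ge> N \<Longrightarrow> v (s n - lincomb J (c n)) < e * \<delta> / 3"
      using order_tendstoD(2)[OF null e] by (auto simp: eventually_sequentially)
    have "v (of_rat (c m j) - of_rat (c n j)) < e" if mn: "m \<ge> max M N" "n \<ge> max M N" for m n
    proof -
      define a where "a = s m - s n"
      define b where "b = s m - lincomb J (c m)"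
      define d where "d = s n - lincomb J (c n)"
      have K: "a \<in> K" "b \<in> K" "d \<in> K"
        unfolding a_def b_def d_def using sK by (intro Qadj_diff; simp)+
      have "v (of_rat (c m j) - of_rat (c n j)) * \<delta> \<le> v (lincomb J (\<lambda>j. c m j - c n j))"
        using bd[OF j, of "\<lambda>j. c m j - c n j"] by (simp add: of_rat_diff)
      also have "lincomb J (\<lambda>j. c m j - c n j) = (a - b) + d"
        unfolding lincomb_diff[symmetric] a_def b_def d_def by simp
      also have "v \<dots> \<le> v (a - b) + v d" using K by (intro v_add Qadj_diff)
      also have "\<dots> \<le> v a + v b + v d" using v_diff[OF K(1,2)] by simp
      also have "\<dots> < e * \<delta> / 3 + e * \<delta> / 3 + e * \<delta> / 3"
        using M[of m n] N[of m] N[of n] mn unfolding a_def b_def d_def by (intro add_strict_mono) auto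
      also have "\<dots> = e * \<delta>" by simp
      finally show ?thesis using \<delta> by simp
    qed
    thus "\<exists>N. \<forall>m\<ge>N. \<forall>n\<ge>N. v (of_rat (c m j) - of_rat (c n j)) < e" by blast
  qed simp
  thus thesis using that null by blast
qed

text \<open>A minimal set of powers of \<open>\<alpha>\<close> with dense rational span is a basis of the completion.\<close>
lemma finite_dimension_completion: "ring.dimension C (local_degree K v) F (carrier C)"
proof -
  interpret field C by (rule field_C)
  obtain J \<delta> where J: "dense_span J" "\<delta> > 0" "\<And>c j. j \<in> J \<Longrightarrow> v (of_rat (c j)) * \<delta> \<le> v (lincomb J c)"
    using coefficient_bound by blast
  have fin: "finite J" using J by (simp add: dense_span_def)
  define js where "js = sorted_list_of_set J"
  have js: "set js = J" "distinct js" using fin by (auto simp: js_def)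
  define Us where "Us = map (\<lambda>j. cls (\<lambda>_. \<alpha> ^ j)) js"
  have Us: "set Us \<subseteq> carrier C"
    by (auto simp: Us_def carrier_C intro!: imageI cauchy_const Qadj_power)
  have "Span F Us = carrier C"
  proof
    show "Span F Us \<subseteq> carrier C" using Us subfieldE(3)[OF subfield_F] by (intro Span_in_carrier)
    show "carrier C \<subseteq> Span F Us"
    proof
      fix a assume "a \<in> carrier C"
      then obtain s where s: "s \<in> cauchy_seqs K v" "a = cls s" by (auto simp: carrier_C)
      obtain c where c: "\<And>j. j \<in> J \<Longrightarrow> (\<lambda>n. of_rat (c n j)) \<in> cauchy_seqs \<rat> v"
        "(\<lambda>n. v (s n - lincomb J (c n))) \<longlonglongrightarrow> 0" using cauchy_decompose[OF J s(1)] by blast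
      define Ks where "Ks = map (\<lambda>j. cls (\<lambda>n. of_rat (c n j))) js"
      have lin: "(\<Sum>j\<leftarrow>js. of_rat (c n j) * \<alpha> ^ j) = lincomb J (c n)" for n
        using js by (simp add: lincomb_def sum_list_distinct_conv_sum_set)
      have comb: "combine Ks Us = cls (\<lambda>n. lincomb J (c n))" "(\<lambda>n. lincomb J (c n)) \<in> cauchy_seqs K v"
        using combine_cls[of js "\<lambda>j n. of_rat (c n j)" "\<lambda>j. \<alpha> ^ j", OF _ Qadj_power[OF Qadj_self]] c(1) js(1)
        unfolding lin Ks_def Us_def by simp_all
      have "a = combine Ks Us" unfolding comb(1) s(2) using cls_eq_iff[OF s(1) comb(2)] c(2) by simp
      moreover have "set Ks \<subseteq> F" using c(1) js(1) by (auto simp: Ks_def F_eq)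
      moreover have "length Ks = length Us" by (simp add: Ks_def Us_def)
      ultimately show "a \<in> Span F Us" using Span_mem_iff_length_version[OF subfield_F Us] by blast
    qed
  qed
  hence "finite_dimension F (carrier C)" using Span_finite_dimension[OF subfield_F Us] by simp
  from finite_dimensionE[OF subfield_F this] show ?thesis by (simp add: local_degree_def over_def)
qed

text \<open>\<open>indep\<close> is linear independence over the completion of Q in terms of
  representing sequences. The comparison with \<open>local_degree\<close> rests on
  \<open>finite_dimension_completion\<close>, which gives that number its meaning as a
  dimension.\<close>

lemma local_degree_ge:
  assumes e: "\<And>j. j < k \<Longrightarrow> e j \<in> K"
    and indep: "\<And>c j. (\<And>j. j < k \<Longrightarrow> c j \<in> cauchy_seqs \<rat> v) \<Longrightarrow>
      (\<lambda>n. v (\<Sum>j<k. c j n * e j)) \<longlonglongrightarrow> 0 \<Longrightarrow> j < k \<Longrightarrow> (\<lambda>n. v (c j n)) \<longlonglongrightarrow> 0"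
  shows "k \<le> local_degree K v"
proof -
  interpret field C by (rule field_C)
  define Us where "Us = map (\<lambda>j. cls (\<lambda>_. e j)) [0..<k]"
  have Us: "set Us \<subseteq> carrier C" using e by (auto simp: Us_def carrier_C intro!: imageI cauchy_const)
  have "independent F Us"
  proof (rule ccontr)
    assume dep: "dependent F Us"
    obtain Ks where Ks: "length Ks = length Us" "combine Ks Us = \<zero>\<^bsub>C\<^esub>" "set Ks \<subseteq> F" "set Ks \<noteq> {\<zero>\<^bsub>C\<^esub>}"
      using dependent_imp_non_trivial_combine[OF subfield_F Us dep] by blast
    have len: "length Ks = k" using Ks(1) by (simp add: Us_def)
    have "\<forall>j. \<exists>s. j < k \<longrightarrow> s \<in> cauchy_seqs \<rat> v \<and> Ks ! j = cls s"
      using Ks(3) len unfolding F_eq by (metis image_iff nth_mem subsetD)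
    then obtain c where c: "\<And>j. j < k \<Longrightarrow> c j \<in> cauchy_seqs \<rat> v" "\<And>j. j < k \<Longrightarrow> Ks ! j = cls (c j)" by metis
    have Ks_eq: "Ks = map (\<lambda>j. cls (c j)) [0..<k]" using len c(2) by (intro nth_equalityI) auto
    have lin: "(\<Sum>j\<leftarrow>[0..<k]. c j n * e j) = (\<Sum>j<k. c j n * e j)" for n
      by (simp add: sum_list_distinct_conv_sum_set atLeast0LessThan)
    have comb: "combine Ks Us = cls (\<lambda>n. \<Sum>j<k. c j n * e j)" "(\<lambda>n. \<Sum>j<k. c j n * e j) \<in> cauchy_seqs K v"
      using combine_cls[of "[0..<k]" c e] c(1) e unfolding lin Ks_eq Us_def by auto
    have null: "(\<lambda>n. v (\<Sum>j<k. c j n * e j)) \<longlonglongrightarrow> 0" using Ks(2) comb cls_eq_zero_iff by simp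
    have "cls (c j) = \<zero>\<^bsub>C\<^esub>" if "j < k" for j
      using indep[OF c(1) null that] cls_eq_zero_iff[OF cauchy_Rats[OF c(1)[OF that]]] by simp
    hence "set Ks \<subseteq> {\<zero>\<^bsub>C\<^esub>}" by (auto simp: Ks_eq)
    hence "Ks = []" using Ks(4) by (cases Ks) auto
    hence "Us = []" using Ks(1) by simp
    thus False using dep by simp
  qed
  hence "length Us \<le> local_degree K v"
    using independent_length_le_dimension[OF subfield_F finite_dimension_completion] Us by blast
  thus ?thesis by (simp add: Us_def)
qed

lemma local_degree_pos: "local_degree K v \<ge> 1"
proof (rule local_degree_ge[where e = "\<lambda>_. 1"])
  fix c :: "nat \<Rightarrow> nat \<Rightarrow> complex" and j :: nat
  assume "(\<lambda>n. v (\<Sum>j<1. c j n * 1)) \<longlonglongrightarrow> 0" "j < 1"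
  thus "(\<lambda>n. v (c j n)) \<longlonglongrightarrow> 0" by simp
qed auto

end

section \<open>The field Q(\<alpha>) and its degree over Q\<close>

lemma complex_ring_simps [simp]:
  "carrier complex_ring = UNIV" "x \<otimes>\<^bsub>complex_ring\<^esub> y = x * y" "\<one>\<^bsub>complex_ring\<^esub> = 1"
  "\<zero>\<^bsub>complex_ring\<^esub> = 0" "x \<oplus>\<^bsub>complex_ring\<^esub> y = x + y" by (simp_all add: ring_of_type_algebra_def)

lemma field_complex_ring: "field complex_ring"
  by (rule field_from_type_algebra)

lemma complex_ring_a_inv [simp]: "\<ominus>\<^bsub>complex_ring\<^esub> x = - x"
proof -
  interpret field complex_ring by (rule field_complex_ring)
  show ?thesis by (rule minus_equality) auto
qed

lemma complex_ring_m_inv: "x \<noteq> 0 \<Longrightarrow> inv\<^bsub>complex_ring\<^esub> x = inverse x"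
proof -
  interpret field complex_ring by (rule field_complex_ring)
  assume "x \<noteq> 0"
  thus ?thesis by (intro comm_inv_char) auto
qed

lemma subfield_complex_ring:
  assumes "csubring S" "\<And>x. x \<in> S \<Longrightarrow> inverse x \<in> S"
  shows "subfield S complex_ring"
proof -
  interpret field complex_ring by (rule field_complex_ring)
  show ?thesis
  proof (rule subfieldI')
    show "subring S complex_ring" using assms(1) by (intro subringI) (auto simp: csubring_def)
  qed (use assms(2) in \<open>auto simp: complex_ring_m_inv\<close>)
qed

lemma adjoin_rat_eq:
  assumes "algebraic \<alpha>"
  shows "adjoin_rat \<alpha> = Qadj \<alpha>"
proof
  interpret field complex_ring by (rule field_complex_ring)
  have "subfield (Qadj \<alpha>) complex_ring"
    using csubring_Qadj Qadj_inverse[OF assms] by (intro subfield_complex_ring) auto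
  thus "adjoin_rat \<alpha> \<subseteq> Qadj \<alpha>" unfolding adjoin_rat_def by (intro generate_field_min_subfield1) auto
  define A where "A = adjoin_rat \<alpha>"
  have A: "\<And>x y. x \<in> A \<Longrightarrow> y \<in> A \<Longrightarrow> x + y \<in> A" "\<And>x y. x \<in> A \<Longrightarrow> y \<in> A \<Longrightarrow> x * y \<in> A"
    "1 \<in> A" "\<alpha> \<in> A" "\<And>x. x \<in> A \<Longrightarrow> - x \<in> A" "\<And>x. x \<in> A \<Longrightarrow> x \<noteq> 0 \<Longrightarrow> inverse x \<in> A"
    unfolding A_def adjoin_rat_def using generate_field.intros[where R = complex_ring and H = "{\<alpha>}"]
    by (simp_all add: complex_ring_m_inv) (metis complex_ring_m_inv)?
  have "csubring A" using A by (simp add: csubring_def)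
  have rat: "of_rat q \<in> A" for q
  proof -
    obtain a b where "b > 0" "q = of_int a / of_int b"
      by (metis quotient_of_denom_pos quotient_of_div surj_pair)
    hence "of_rat q = of_int a * inverse (of_int b :: complex)"
      by (simp add: of_rat_divide) (simp add: divide_inverse)
    thus ?thesis using A csubring_of_int[OF \<open>csubring A\<close>] \<open>b > 0\<close> by simp
  qed
  have "ev p \<alpha> \<in> A" for p
  proof (induction p)
    case 0
    show ?case using csubring_0[OF \<open>csubring A\<close>] by simp
  next
    case (pCons a p)
    thus ?case using A rat by simp
  qed
  thus "Qadj \<alpha> \<subseteq> adjoin_rat \<alpha>" by (auto simp: Qadj_def A_def)
qed

text \<open>Positivity lets the degree, as exponent of the Mahler measure, cancel against the degree
  in the normalized absolute value. The powers of \<alpha> provide the finite dimension that gives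
  \<open>ring.dim\<close> its meaning.\<close>

lemma field_degree_pos:
  assumes "algebraic \<alpha>"
  shows "field_degree (Qadj \<alpha>) > 0"
proof -
  interpret field complex_ring by (rule field_complex_ring)
  obtain m where m: "is_minpoly m \<alpha>" using minpoly_exists[OF assms] .
  have Q: "subfield \<rat> complex_ring" by (rule subfield_complex_ring) (auto simp: csubring_def)
  define Us where "Us = map (\<lambda>j. \<alpha> ^ j) [0..<degree m]"
  have comb: "combine (map c js) (map (\<lambda>j. \<alpha> ^ j) js) = (\<Sum>j\<leftarrow>js. c j * \<alpha> ^ j)" for c js
    by (induction js) auto
  have mem: "a \<in> Span \<rat> Us \<longleftrightarrow> (\<exists>Ks. set Ks \<subseteq> \<rat> \<and> length Ks = length Us \<and> a = combine Ks Us)" for a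
    by (rule Span_mem_iff_length_version[OF Q]) auto
  have "Span \<rat> Us = Qadj \<alpha>"
  proof
    show "Qadj \<alpha> \<subseteq> Span \<rat> Us"
    proof
      fix x assume "x \<in> Qadj \<alpha>"
      then obtain c where c: "x = (\<Sum>j<degree m. of_rat (c j) * \<alpha> ^ j)" using Qadj_span[OF m] by blast
      have "x = combine (map (\<lambda>j. of_rat (c j)) [0..<degree m]) Us"
        unfolding Us_def comb by (simp add: c sum_list_distinct_conv_sum_set atLeast0LessThan)
      thus "x \<in> Span \<rat> Us"
        unfolding mem by (intro exI[of _ "map (\<lambda>j. of_rat (c j)) [0..<degree m]"]) (auto simp: Us_def)
    qed
    show "Span \<rat> Us \<subseteq> Qadj \<alpha>"
    proof
      fix x assume "x \<in> Span \<rat> Us"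
      then obtain Ks where Ks: "set Ks \<subseteq> \<rat>" "length Ks = length Us" "x = combine Ks Us" using mem by blast
      have "Ks = map (\<lambda>j. Ks ! j) [0..<degree m]"
        using Ks(2) by (intro nth_equalityI) (auto simp: Us_def)
      hence "x = (\<Sum>j\<leftarrow>[0..<degree m]. Ks ! j * \<alpha> ^ j)" using Ks(3) comb unfolding Us_def by metis
      also have "\<dots> = (\<Sum>j<degree m. Ks ! j * \<alpha> ^ j)"
        by (simp add: sum_list_distinct_conv_sum_set atLeast0LessThan)
      also have "\<dots> \<in> Qadj \<alpha>"
      proof (intro Qadj_sum Qadj_mult Qadj_power Qadj_self)
        fix j assume "j \<in> {..<degree m}"
        hence "Ks ! j \<in> \<rat>" using Ks(1,2) by (auto simp: Us_def)
        thus "Ks ! j \<in> Qadj \<alpha>" by (auto elim!: Rats_cases)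
      qed
      finally show "x \<in> Qadj \<alpha>" .
    qed
  qed
  hence "finite_dimension \<rat> (Qadj \<alpha>)" using Span_finite_dimension[OF Q, of Us] by simp
  from finite_dimensionE[OF Q this] have dim: "dimension (field_degree (Qadj \<alpha>)) \<rat> (Qadj \<alpha>)"
    by (simp add: field_degree_def over_def)
  show ?thesis
  proof (rule ccontr)
    assume "\<not> ?thesis"
    hence "Qadj \<alpha> = {\<zero>\<^bsub>complex_ring\<^esub>}" using dim dimension_zero[OF Q] by simp
    moreover have "1 \<in> Qadj \<alpha>" by simp
    ultimately show False by (simp del: Qadj_1)
  qed
qed

section \<open>p-adic absolute values on Q(\<alpha>)\<close>

lemma padic_abs_of_int: "n \<noteq> 0 \<Longrightarrow> padic_abs p (of_int n) = real p powi (- int (multiplicity (int p) n))"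
  by (simp add: padic_abs_def quotient_of_int)

lemma padic_abs_of_int_le_1:
  assumes "prime p"
  shows "padic_abs p (of_int n) \<le> 1"
proof (cases "n = 0")
  case False
  have "real p ^ multiplicity (int p) n \<ge> 1"
    using prime_ge_1_nat[OF assms] by (intro one_le_power) simp
  thus ?thesis using False by (simp add: padic_abs_of_int power_int_minus inverse_le_1_iff)
qed (simp add: padic_abs_def)

lemma padic_abs_unit:
  assumes "\<not> int p dvd n"
  shows "padic_abs p (of_int n) = 1"
proof -
  have "n \<noteq> 0" using assms by auto
  thus ?thesis using assms by (simp add: padic_abs_of_int not_dvd_imp_multiplicity_0)
qed

lemma padic_abs_eq_power: "q \<noteq> 0 \<Longrightarrow> \<exists>k. padic_abs p q = real p powi k"
  unfolding padic_abs_def by auto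

locale padic_valued_adjoin = valued_adjoin +
  fixes p :: nat
  assumes p: "prime p" and vp: "\<And>q. v (of_rat q) = padic_abs p q"
begin

lemma v_of_int: "v (of_int n) = padic_abs p (of_int n)"
  using vp[of "of_int n"] by simp

lemma v_of_nat_le_1: "v (of_nat n) \<le> 1"
  using v_of_int[of "int n"] padic_abs_of_int_le_1[OF p, of "int n"] by simp

text \<open>The binomial expansion gives \<open>v (x + y) ^ n \<le> (n + 1) * M ^ n\<close> for all \<open>n\<close>.\<close>
lemma ultrametric:
  assumes x: "x \<in> K" and y: "y \<in> K"
  shows "v (x + y) \<le> max (v x) (v y)"
proof (rule ccontr)
  assume neg: "\<not> ?thesis"
  define M where "M = max (v x) (v y)"
  have M0: "M \<ge> 0" using v_nonneg[OF x] by (simp add: M_def)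
  have "M \<noteq> 0"
  proof
    assume "M = 0"
    hence "v x = 0" "v y = 0" using v_nonneg[OF x] v_nonneg[OF y] by (auto simp: M_def max_def split: if_splits)
    hence "x = 0" "y = 0" using v_eq_0_iff x y by auto
    thus False using neg by simp
  qed
  hence M: "M > 0" using M0 by simp
  define r where "r = v (x + y) / M"
  have "v (x + y) > M" using neg by (simp only: M_def not_le)
  hence r: "r > 1" using M by (simp add: r_def)
  have bound: "r ^ n \<le> real n + 1" for n
  proof -
    have "v (x + y) ^ n = v ((x + y) ^ n)" using x y by (simp add: v_power Qadj_add)
    also have "(x + y) ^ n = (\<Sum>k\<le>n. of_nat (n choose k) * x ^ k * y ^ (n - k))"
      by (rule binomial_ring)
    also have "v \<dots> \<le> (\<Sum>k\<le>n. v (of_nat (n choose k) * x ^ k * y ^ (n - k)))"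
      using x y by (intro v_sum_le Qadj_mult Qadj_power) auto
    also have "\<dots> \<le> (\<Sum>k\<le>n. M ^ n)"
    proof (rule sum_mono)
      fix k assume "k \<in> {..n}"
      hence k: "k \<le> n" by simp
      have "v (of_nat (n choose k) * x ^ k * y ^ (n - k)) = v (of_nat (n choose k)) * (v x ^ k * v y ^ (n - k))"
        using x y by (simp add: v_mult v_power Qadj_mult Qadj_power)
      also have "\<dots> \<le> 1 * (M ^ k * M ^ (n - k))" using v_of_nat_le_1 M0 x y
        by (intro mult_mono power_mono) (auto simp: M_def v_nonneg intro!: mult_nonneg_nonneg zero_le_power)
      also have "\<dots> = M ^ n" using k by (simp flip: power_add)
      finally show "v (of_nat (n choose k) * x ^ k * y ^ (n - k)) \<le> M ^ n" .
    qed
    also have "\<dots> = (real n + 1) * M ^ n" by simp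
    finally show ?thesis using M by (simp add: r_def power_divide divide_simps)
  qed
  have "(\<lambda>n. real n / r ^ n + (1 / r) ^ n) \<longlonglongrightarrow> 0 + 0"
    using r lim_n_over_pown[of r] by (intro tendsto_add LIMSEQ_realpow_zero) auto
  hence "eventually (\<lambda>n. real n / r ^ n + (1 / r) ^ n < 1) sequentially"
    by (rule order_tendstoD) simp
  then obtain n where n: "real n / r ^ n + (1 / r) ^ n < 1" by (auto simp: eventually_sequentially)
  have rn: "r ^ n > 0" using r by simp
  have "real n / r ^ n + (1 / r) ^ n = (real n + 1) / r ^ n"
    by (simp add: add_divide_distrib power_divide)
  hence "real n + 1 < r ^ n" using n rn by (simp add: divide_less_eq)
  thus False using bound[of n] by simp
qed

lemma v_sum_less:
  assumes "finite I" "\<And>i. i \<in> I \<Longrightarrow> f i \<in> K" "\<And>i. i \<in> I \<Longrightarrow> v (f i) < B" "B > 0"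
  shows "v (sum f I) < B"
  using assms
proof (induction I rule: finite_induct)
  case (insert i I)
  have "v (f i + sum f I) \<le> max (v (f i)) (v (sum f I))"
    using insert.prems by (intro ultrametric Qadj_sum) auto
  also have "\<dots> < B" using insert by simp
  finally show ?case using insert.hyps by simp
qed simp

text \<open>Nonzero terms of pairwise different values cannot cancel: the largest strictly dominates
  the sum of the others, so the whole sum is at least as large.\<close>

lemma v_term_le_sum:
  assumes I: "finite I" and fK: "\<And>i. i \<in> I \<Longrightarrow> f i \<in> K"
    and dist: "\<And>i j. i \<in> I \<Longrightarrow> j \<in> I \<Longrightarrow> i \<noteq> j \<Longrightarrow> f i \<noteq> 0 \<Longrightarrow> f j \<noteq> 0 \<Longrightarrow> v (f i) \<noteq> v (f j)"
    and j: "j \<in> I"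
  shows "v (f j) \<le> v (sum f I)"
proof -
  have "\<exists>i\<in>I. \<forall>k\<in>I. v (f k) \<le> v (f i)"
  proof -
    have fin: "finite ((\<lambda>i. v (f i)) ` I)" and ne: "(\<lambda>i. v (f i)) ` I \<noteq> {}" using I j by auto
    obtain i where "i \<in> I" "v (f i) = Max ((\<lambda>i. v (f i)) ` I)" using Max_in[OF fin ne] by auto
    thus ?thesis using Max_ge[OF fin] by (intro bexI[of _ i]) auto
  qed
  then obtain i where i: "i \<in> I" "\<And>k. k \<in> I \<Longrightarrow> v (f k) \<le> v (f i)" by blast
  have "v (f i) \<le> v (sum f I)"
  proof (cases "f i = 0")
    case True
    thus ?thesis using fK by (simp add: v_nonneg Qadj_sum)
  next
    case False
    hence pos: "v (f i) > 0" using fK i by (intro v_pos) auto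
    have rest: "v (sum f (I - {i})) < v (f i)"
    proof (rule v_sum_less)
      fix k assume k: "k \<in> I - {i}"
      show "v (f k) < v (f i)"
      proof (cases "f k = 0")
        case False
        hence "v (f k) \<noteq> v (f i)" using dist k i \<open>f i \<noteq> 0\<close> by blast
        thus ?thesis using i(2)[of k] k by simp
      qed (use pos in simp)
    qed (use I fK pos in auto)
    have K: "sum f I \<in> K" "sum f (I - {i}) \<in> K" using fK by (auto intro!: Qadj_sum)
    have "f i = sum f I + (- sum f (I - {i}))" using sum.remove[OF I i(1), of f] by simp
    hence "v (f i) \<le> max (v (sum f I)) (v (- sum f (I - {i})))"
      using ultrametric[OF K(1) Qadj_minus[OF K(2)]] by metis
    thus ?thesis using rest v_minus[OF K(2)] by (simp add: max_def split: if_splits)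
  qed
  thus ?thesis using i(2)[OF j] by simp
qed

text \<open>If no power of \<open>v \<alpha>\<close> up to the local degree \<open>n\<close> lay in the value group of \<open>\<rat>\<close>, the powers
  \<open>1, \<alpha>, \<dots>, \<alpha> ^ n\<close> would be linearly independent over the completion of \<open>\<rat>\<close>.\<close>
lemma local_contribution_ge:
  assumes "v \<alpha> > 1"
  shows "v \<alpha> ^ local_degree K v \<ge> 2"
proof -
  define n where "n = local_degree K v"
  have \<alpha>K: "\<alpha> \<in> K" by simp
  have p1: "real p > 1" using prime_gt_1_nat[OF p] by simp
  have "\<exists>k z. 1 \<le> k \<and> k \<le> n \<and> v \<alpha> ^ k = real p powi z"
  proof (rule ccontr)
    assume no: "\<not> ?thesis"
    have "Suc n \<le> local_degree K v"
    proof (rule local_degree_ge[where e = "\<lambda>j. \<alpha> ^ j"])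
      show "\<alpha> ^ j \<in> K" for j by (intro Qadj_power) auto
      fix c :: "nat \<Rightarrow> nat \<Rightarrow> complex" and j
      assume c: "\<And>j. j < Suc n \<Longrightarrow> c j \<in> cauchy_seqs \<rat> v"
        and null: "(\<lambda>m. v (\<Sum>j<Suc n. c j m * \<alpha> ^ j)) \<longlonglongrightarrow> 0" and j: "j < Suc n"
      have cQ: "c j m \<in> \<rat>" if "j < Suc n" for j m using cauchy_mem[OF c[OF that]] .
      have cK: "c j m \<in> K" if "j < Suc n" for j m using K_Rats[OF cQ[OF that]] .
      have tK: "c j m * \<alpha> ^ j \<in> K" if "j < Suc n" for j m
        using cK[OF that] by (intro Qadj_mult Qadj_power \<alpha>K)
      have vc: "\<exists>z. v (c j m) = real p powi z" if jn: "j < Suc n" and nz: "c j m \<noteq> 0" for j m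
      proof -
        obtain q where "c j m = of_rat q" using cQ[OF jn, of m] by (rule Rats_cases)
        thus ?thesis using nz vp padic_abs_eq_power by auto
      qed
      \<comment> \<open>Equal values of two terms would put v \<alpha> ^ (j - i), with exponent
        between 1 and n, into the value group of Q.\<close>
      have ne: False if ij: "i < j" "j < Suc n" "c i m \<noteq> 0" "c j m \<noteq> 0"
        "v (c i m * \<alpha> ^ i) = v (c j m * \<alpha> ^ j)" for i j m
      proof -
        obtain a b where ab: "v (c i m) = real p powi a" "v (c j m) = real p powi b"
          using vc[of i m] vc[of j m] ij by auto
        have "\<alpha> ^ j = \<alpha> ^ i * \<alpha> ^ (j - i)" using ij(1) by (simp flip: power_add)
        hence "v (\<alpha> ^ j) = v \<alpha> ^ i * v \<alpha> ^ (j - i)" by (simp add: v_mult v_power Qadj_power)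
        hence "v (c i m) * v \<alpha> ^ i = v (c j m) * (v \<alpha> ^ i * v \<alpha> ^ (j - i))"
          using ij cK by (simp add: v_mult v_power Qadj_power)
        hence "real p powi a = real p powi b * v \<alpha> ^ (j - i)" using assms ab by simp
        hence "v \<alpha> ^ (j - i) = real p powi (a - b)" using p1 by (simp add: power_int_diff)
        moreover have "1 \<le> j - i" "j - i \<le> n" using ij by auto
        ultimately show False using no by blast
      qed
      have le: "v (c j m) \<le> v (\<Sum>j<Suc n. c j m * \<alpha> ^ j)" for m
      proof -
        have "v (c j m) * 1 \<le> v (c j m) * v \<alpha> ^ j"
          using assms cK[OF j] by (intro mult_left_mono v_nonneg one_le_power) auto
        also have "\<dots> = v (c j m * \<alpha> ^ j)" using cK[OF j] by (simp add: v_mult v_power Qadj_power)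
        also have "\<dots> \<le> v (\<Sum>j<Suc n. c j m * \<alpha> ^ j)"
        proof (rule v_term_le_sum)
          fix i k assume ik: "i \<in> {..<Suc n}" "k \<in> {..<Suc n}" "i \<noteq> k"
            "c i m * \<alpha> ^ i \<noteq> 0" "c k m * \<alpha> ^ k \<noteq> 0"
          show "v (c i m * \<alpha> ^ i) \<noteq> v (c k m * \<alpha> ^ k)"
            using ne[of i k m] ne[of k i m] ik by (cases "i < k") auto
        qed (use tK j in auto)
        finally show ?thesis by simp
      qed
      show "(\<lambda>m. v (c j m)) \<longlonglongrightarrow> 0"
      proof (rule real_tendsto_sandwich[where f = "\<lambda>_. 0" and h = "\<lambda>m. v (\<Sum>j<Suc n. c j m * \<alpha> ^ j)"])
        show "eventually (\<lambda>m. 0 \<le> v (c j m)) sequentially"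
          using cK[OF j] by (intro always_eventually allI v_nonneg)
        show "eventually (\<lambda>m. v (c j m) \<le> v (\<Sum>j<Suc n. c j m * \<alpha> ^ j)) sequentially"
          using le by (intro always_eventually allI)
      qed (use null in auto)
    qed
    thus False by (simp add: n_def)
  qed
  then obtain k z where k: "1 \<le> k" "k \<le> n" "v \<alpha> ^ k = real p powi z" by blast
  have "v \<alpha> ^ k > 1" using assms k(1) by (intro one_less_power) auto
  \<comment> \<open>A power of p that exceeds 1 is at least p, and raising the exponent from k to n
    only enlarges it.\<close>
  have "z > 0"
  proof (rule ccontr)
    assume "\<not> z > 0"
    hence "real p powi z \<le> real p powi 0" using p1 by (intro power_int_increasing) auto
    thus False using \<open>v \<alpha> ^ k > 1\<close> k(3) by simp
  qed
  have "2 \<le> real p" using prime_ge_2_nat[OF p] by simp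
  also have "real p = real p powi 1" by simp
  also have "\<dots> \<le> real p powi z" using \<open>z > 0\<close> p1 by (intro power_int_increasing) auto
  also have "\<dots> \<le> v \<alpha> ^ n" unfolding k(3)[symmetric] using assms k by (intro power_increasing) auto
  finally show ?thesis by (simp add: n_def)
qed

text \<open>Otherwise the leading term of f(\<alpha>) strictly dominates and the sum cannot vanish.
  So only finitely many primes lie below places at which \<alpha> is large.\<close>

lemma prime_dvd_lead_coeff:
  assumes v: "v \<alpha> > 1" and f: "f \<noteq> 0" "poly (map_poly of_int f) \<alpha> = 0"
  shows "int p dvd lead_coeff f"
proof (rule ccontr)
  assume nd: "\<not> ?thesis"
  define n where "n = degree f"
  have deg: "degree (map_poly of_int f :: complex poly) = n" by (simp add: n_def degree_map_poly)
  have "0 = (\<Sum>i\<le>n. of_int (coeff f i) * \<alpha> ^ i)"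
    using f(2) deg by (simp add: poly_altdef coeff_map_poly)
  also have "{..n} = insert n {..<n}" by auto
  finally have eq: "of_int (lead_coeff f) * \<alpha> ^ n = - (\<Sum>i<n. of_int (coeff f i) * \<alpha> ^ i)"
    by (simp add: n_def eq_neg_iff_add_eq_0)
  have iK: "of_int k \<in> K" for k by (rule Qadj_of_int)
  have K: "(\<Sum>i<n. of_int (coeff f i) * \<alpha> ^ i) \<in> K" by (intro Qadj_sum Qadj_mult Qadj_power iK) auto
  have "v (of_int (lead_coeff f) * \<alpha> ^ n) = v \<alpha> ^ n"
    using v_of_int padic_abs_unit[OF nd] iK by (simp add: v_mult v_power Qadj_power)
  hence "v (\<Sum>i<n. of_int (coeff f i) * \<alpha> ^ i) = v \<alpha> ^ n" using eq v_minus[OF K] by simp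
  moreover have "v (\<Sum>i<n. of_int (coeff f i) * \<alpha> ^ i) < v \<alpha> ^ n"
  proof (rule v_sum_less)
    fix i assume "i \<in> {..<n}"
    have "v (of_int (coeff f i) * \<alpha> ^ i) = v (of_int (coeff f i)) * v \<alpha> ^ i"
      using iK by (simp add: v_mult v_power Qadj_power)
    also have "\<dots> \<le> 1 * v \<alpha> ^ i"
      using v_of_int padic_abs_of_int_le_1[OF p] v by (intro mult_right_mono) auto
    also have "\<dots> < v \<alpha> ^ n" using v \<open>i \<in> {..<n}\<close> by (simp add: power_strict_increasing)
    finally show "v (of_int (coeff f i) * \<alpha> ^ i) < v \<alpha> ^ n" .
  next
    fix i show "of_int (coeff f i) * \<alpha> ^ i \<in> K" by (intro Qadj_mult Qadj_power iK) auto
  qed (use v in auto)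
  ultimately show False by simp
qed

end

section \<open>Finiteness of the set of large places\<close>

lemma powi_between:
  fixes C a :: real
  assumes "C > 1" "a > 0"
  obtains k :: int where "a < C powi k" "C powi k \<le> C * a"
proof -
  define k where "k = \<lfloor>log C a\<rfloor> + 1"
  have a: "a = C powr log C a" using assms by simp
  have pk: "C powi k = C powr real_of_int k" using assms by (subst powr_real_of_int') auto
  have "C powr log C a < C powr real_of_int k"
    using assms(1) by (intro powr_less_mono) (auto simp: k_def)
  moreover have "C powr real_of_int k \<le> C powr (1 + log C a)"
    using assms(1) by (intro powr_mono) (auto simp: k_def)
  moreover have "C powr (1 + log C a) = C * a" using assms a by (simp only: powr_add) simp
  ultimately show thesis using that[of k] pk a by simp
qed

text \<open>As \<open>v\<close> and \<open>u\<close> agree on Q, powers of q rescale both in the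
  same way. In a high power of x, or of 1 / x, the two values differ by more than the factor C =
  v(q), so a power of C fits between them; dividing by that power of q moves the values to opposite
  sides of 1.\<close>

lemma separate_two:
  assumes V: "valued_adjoin \<alpha> v" and U: "valued_adjoin \<alpha> u"
    and agree: "\<And>q. v (of_rat q) = u (of_rat q)" and q: "v (of_rat q) > 1"
    and x: "x \<in> Qadj \<alpha>" "v x \<noteq> u x"
  obtains y where "y \<in> Qadj \<alpha>" "v y > 1" "u y < 1"
proof -
  interpret V: valued_adjoin \<alpha> v by (rule V)
  interpret U: valued_adjoin \<alpha> u by (rule U)
  obtain x where x: "x \<in> Qadj \<alpha>" "v x > u x"
  proof (cases "v x > u x")
    case False
    hence lt: "v x < u x" using x by simp
    have "x \<noteq> 0" using lt by auto
    hence "u (inverse x) < v (inverse x)"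
      using lt x V.v_pos[of x] by (simp add: V.v_inverse U.v_inverse)
    thus ?thesis using that V.K_inverse x by blast
  qed (use that x in auto)
  have "x \<noteq> 0" using x by auto
  hence ux: "u x > 0" using U.v_pos x by blast
  define r where "r = v x / u x"
  have r: "r > 1" using x ux by (simp add: r_def)
  define C where "C = v (of_rat q)"
  obtain n where n: "C < r ^ n" using real_arch_pow[OF r] by blast
  have C: "C > 1" using q by (simp add: C_def)
  have uxn: "u x ^ n > 0" using ux by simp
  obtain k where k: "u x ^ n < C powi k" "C powi k \<le> C * u x ^ n" using powi_between[OF C uxn] .
  define s where "s = (of_rat (q powi k) :: complex)"
  have s_eq: "s = (if k \<ge> 0 then of_rat q ^ nat k else inverse (of_rat q) ^ nat (- k))"
    by (simp add: s_def power_int_def of_rat_power of_rat_inverse)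
  have vs: "v s = C powi k" by (simp add: s_eq C_def power_int_def V.v_power V.v_inverse V.K_inverse)
  have us: "u s = C powi k"
    using agree[of q] by (simp add: s_eq C_def power_int_def U.v_power U.v_inverse U.K_inverse)
  have Ck: "C powi k > 0" using C by simp
  have sK: "s \<in> Qadj \<alpha>" by (simp add: s_def)
  have "v x ^ n = r ^ n * u x ^ n" using ux by (simp add: r_def power_divide)
  also have "\<dots> > C * u x ^ n" using n uxn by simp
  finally have "v x ^ n > C powi k" using k(2) by simp
  hence "v (x ^ n / s) > 1" using Ck x sK by (simp add: V.v_divide V.v_power vs Qadj_power)
  moreover have "u (x ^ n / s) < 1" using Ck k(1) x sK by (simp add: U.v_divide U.v_power us Qadj_power)
  moreover have "x ^ n / s \<in> Qadj \<alpha>" using x sK by (intro V.K_divide Qadj_power)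
  ultimately show thesis using that by blast
qed

lemma eventually_power_mult_less:
  fixes a b c :: real
  assumes "0 \<le> a" "a < 1" "c > 0"
  shows "eventually (\<lambda>r. b * a ^ r < c) sequentially"
proof -
  have "(\<lambda>r. b * a ^ r) \<longlonglongrightarrow> b * 0"
    using assms by (intro tendsto_mult tendsto_const LIMSEQ_realpow_zero) auto
  thus ?thesis using assms(3) by (intro order_tendstoD(2)) auto
qed

text \<open>The induction behind weak approximation. An x that works for S and a y that separates
  \<open>v\<close> from the new u are combined, for large r, into y x ^ r if u(x) = 1 and into y /
  (1 + x ^ -r) if u(x) > 1.\<close>

lemma separate_finite:
  assumes "finite S" and V: "valued_adjoin \<alpha> v" and S: "\<And>u. u \<in> S \<Longrightarrow> valued_adjoin \<alpha> u"
    and agree: "\<And>u q. u \<in> S \<Longrightarrow> v (of_rat q) = u (of_rat q)" and q: "v (of_rat q) > 1"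
    and diff: "\<And>u. u \<in> S \<Longrightarrow> \<exists>x\<in>Qadj \<alpha>. v x \<noteq> u x"
  shows "\<exists>x\<in>Qadj \<alpha>. v x > 1 \<and> (\<forall>u\<in>S. u x < 1)"
  using assms(1) S agree diff
proof (induction S rule: finite_induct)
  case empty
  show ?case using q by (intro bexI[of _ "of_rat q"]) auto
next
  case (insert u S)
  interpret V: valued_adjoin \<alpha> v by (rule V)
  interpret U: valued_adjoin \<alpha> u using insert.prems by auto
  obtain x where x: "x \<in> Qadj \<alpha>" "v x > 1" "\<And>w. w \<in> S \<Longrightarrow> w x < 1" using insert by auto
  obtain y where y: "y \<in> Qadj \<alpha>" "v y > 1" "u y < 1"
  proof -
    obtain x0 where "x0 \<in> Qadj \<alpha>" "v x0 \<noteq> u x0" using insert.prems(3)[of u] by auto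
    thus thesis using separate_two[OF V U.valued_adjoin_axioms _ q] insert.prems(2) that by blast
  qed
  have W: "valued_adjoin \<alpha> w" if "w \<in> S" for w using insert.prems that by auto
  have x0: "x \<noteq> 0" using x(2) by auto
  consider "u x < 1" | "u x = 1" | "u x > 1" by linarith
  thus ?case
  proof cases
    case 1
    thus ?thesis using x by auto
  next
    case 2
    have "eventually (\<lambda>r. \<forall>w\<in>S. w y * w x ^ r < 1) sequentially"
      using x W by (intro eventually_ball_finite insert.hyps ballI eventually_power_mult_less)
        (auto intro: valued_adjoin.v_nonneg)
    then obtain r where r: "\<And>w. w \<in> S \<Longrightarrow> w y * w x ^ r < 1" by (auto simp: eventually_sequentially)
    have K: "y * x ^ r \<in> Qadj \<alpha>" using x y by (intro Qadj_mult Qadj_power)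
    have "v y * v x ^ r > 1"
      using less_1_mult'[of "v y" "v x ^ r"] x y one_le_power[of "v x" r] by simp
    hence "v (y * x ^ r) > 1" using x y by (simp add: V.v_mult V.v_power Qadj_power)
    moreover have "u (y * x ^ r) < 1" using x y 2 by (simp add: U.v_mult U.v_power Qadj_power)
    moreover have "w (y * x ^ r) < 1" if "w \<in> S" for w
      using r[OF that] valued_adjoin.v_mult[OF W[OF that]] valued_adjoin.v_power[OF W[OF that]] x y
      by (simp add: Qadj_power)
    ultimately show ?thesis using K by auto
  next
    case 3
    define t where "t = inverse x"
    have tK: "t \<in> Qadj \<alpha>" using x V.K_inverse by (simp add: t_def)
    have vt: "v t = inverse (v x)" and ut: "u t = inverse (u x)"
      using x by (simp_all add: t_def V.v_inverse U.v_inverse)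
    have vt1: "v t < 1" "0 \<le> v t" and ut1: "u t < 1" "0 \<le> u t"
      using x(2) 3 by (auto simp: vt ut inverse_less_1_iff)
    have "eventually (\<lambda>r. \<forall>w\<in>S. (1 + w y) * w x ^ r < 1) sequentially"
      using x W by (intro eventually_ball_finite insert.hyps ballI eventually_power_mult_less)
        (auto intro: valued_adjoin.v_nonneg)
    moreover have "eventually (\<lambda>r. 1 * v t ^ r < v y - 1) sequentially"
      using vt1 y by (intro eventually_power_mult_less) auto
    moreover have "eventually (\<lambda>r. 1 * u t ^ r < 1 - u y) sequentially"
      using ut1 y by (intro eventually_power_mult_less) auto
    moreover have "eventually (\<lambda>r. 1 * v t ^ r < 1) sequentially"
      using vt1 by (intro eventually_power_mult_less) auto
    ultimately have "eventually (\<lambda>r. (\<forall>w\<in>S. (1 + w y) * w x ^ r < 1) \<and> v t ^ r < v y - 1 \<and>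
        u t ^ r < 1 - u y \<and> v t ^ r < 1) sequentially" by eventually_elim auto
    then obtain r where r: "\<And>w. w \<in> S \<Longrightarrow> (1 + w y) * w x ^ r < 1" "v t ^ r < v y - 1"
        "u t ^ r < 1 - u y" "v t ^ r < 1" by (auto simp: eventually_sequentially)
    \<comment> \<open>At v and u the power t ^ r is small and z is close to 1, so y / z inherits the
      behaviour of y; at the places of S it is large and makes y / z small.\<close>
    define z where "z = 1 + t ^ r"
    have zK: "z \<in> Qadj \<alpha>" using tK by (auto simp: z_def intro!: Qadj_add Qadj_power)
    have z0: "z \<noteq> 0"
    proof
      assume "z = 0"
      hence "t ^ r = - 1" by (simp add: z_def add_eq_0_iff)
      hence "v t ^ r = 1" using V.v_power[OF tK, of r] V.v_m1 by simp
      thus False using r(4) by simp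
    qed
    have lower: "w (t ^ r) - 1 \<le> w z \<and> 1 - w (t ^ r) \<le> w z \<and> w z \<le> 1 + w (t ^ r) \<and> w z > 0"
      if "valued_adjoin \<alpha> w" for w
    proof -
      interpret W: valued_adjoin \<alpha> w by (rule that)
      have "w (t ^ r) \<le> w z + w 1" using W.v_diff[OF zK, of 1] by (simp add: z_def)
      moreover have "w 1 \<le> w z + w (t ^ r)" using W.v_diff[OF zK, of "t ^ r"] tK by (simp add: z_def Qadj_power)
      moreover have "w z \<le> w 1 + w (t ^ r)" unfolding z_def using tK by (intro W.v_add Qadj_power) auto
      moreover have "w z > 0" using W.v_pos[OF zK z0] .
      ultimately show ?thesis by simp
    qed
    have "v (y / z) > 1" using lower[OF V] r(2) y zK tK by (simp add: V.v_divide V.v_power)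
    moreover have "u (y / z) < 1"
      using lower[OF U.valued_adjoin_axioms] r(3) y zK tK by (simp add: U.v_divide U.v_power)
    moreover have "w (y / z) < 1" if w: "w \<in> S" for w
    proof -
      interpret W: valued_adjoin \<alpha> w using W[OF w] .
      have wx: "w x > 0" using W.v_pos x x0 by blast
      have "1 + w y < inverse (w x ^ r)" using r(1)[OF w] wx by (simp add: field_simps)
      also have "inverse (w x ^ r) = w (t ^ r)"
        using x tK by (simp add: W.v_power) (simp add: t_def W.v_inverse power_inverse)
      finally have "w y < w z" using lower[OF W[OF w]] by simp
      thus ?thesis using y zK W.v_pos[OF zK z0] by (simp add: W.v_divide)
    qed
    moreover have "y / z \<in> Qadj \<alpha>" using y zK by (intro V.K_divide)
    ultimately show ?thesis by auto
  qed
qed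

text \<open>Elements that are large at one absolute value and small at all others are linearly
  independent over \<open>\<rat>\<close>.\<close>
lemma card_places_le_degree:
  assumes m: "is_minpoly m \<alpha>" and alg: "algebraic \<alpha>" and W: "finite W"
    and av: "\<And>v. v \<in> W \<Longrightarrow> abs_value_on (Qadj \<alpha>) v" and ext: "W \<subseteq> extensional (Qadj \<alpha>)"
    and base: "\<And>v q. v \<in> W \<Longrightarrow> v (of_rat q) = w q" and q: "w q > 1"
  shows "card W \<le> degree m"
proof -
  have va: "valued_adjoin \<alpha> v" if "v \<in> W" for v using alg av[OF that] by unfold_locales
  have "\<forall>v\<in>W. \<exists>x\<in>Qadj \<alpha>. v x > 1 \<and> (\<forall>u\<in>W - {v}. u x < 1)"
  proof
    fix v assume v: "v \<in> W"
    show "\<exists>x\<in>Qadj \<alpha>. v x > 1 \<and> (\<forall>u\<in>W - {v}. u x < 1)"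
    proof (rule separate_finite)
      fix u assume u: "u \<in> W - {v}"
      show "\<exists>x\<in>Qadj \<alpha>. v x \<noteq> u x"
      proof (rule ccontr)
        assume "\<not> ?thesis"
        hence "v = u" using u v ext by (intro extensionalityI[of _ "Qadj \<alpha>"]) auto
        thus False using u by simp
      qed
    next
      fix u q assume "u \<in> W - {v}"
      thus "v (of_rat q) = u (of_rat q)" using base[OF v, of q] base[of u q] by simp
    next
      show "v (of_rat q) > 1" using base[OF v] q by simp
    qed (use v W va in auto)
  qed
  then obtain x where x: "\<And>v. v \<in> W \<Longrightarrow> x v \<in> Qadj \<alpha>" "\<And>v. v \<in> W \<Longrightarrow> v (x v) > 1"
    "\<And>u v. v \<in> W \<Longrightarrow> u \<in> W \<Longrightarrow> u \<noteq> v \<Longrightarrow> u (x v) < 1" by (metis Diff_iff singletonD bchoice)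
  have xnn: "u (x v) \<ge> 0" if "u \<in> W" "v \<in> W" for u v
    using valued_adjoin.v_nonneg[OF va[OF that(1)] x(1)[OF that(2)]] .
  \<comment> \<open>High powers keep the value of x_v at its own place above 1 and push the values
    at the other places below 1 / card W, so that card W - 1 such terms together stay below
    1.\<close>
  have "eventually (\<lambda>r. \<forall>u\<in>W. \<forall>v\<in>W - {u}. real (card W) * u (x v) ^ r < 1) sequentially"
    using x(3) W xnn by (intro eventually_ball_finite ballI eventually_power_mult_less) auto
  then obtain r where r: "\<And>u v. u \<in> W \<Longrightarrow> v \<in> W \<Longrightarrow> u \<noteq> v \<Longrightarrow> real (card W) * u (x v) ^ r < 1"
    by (auto simp: eventually_sequentially)
  define y where "y = (\<lambda>v. x v ^ r)"
  have yK: "y v \<in> Qadj \<alpha>" if "v \<in> W" for v using x(1)[OF that] by (simp add: y_def Qadj_power)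
  have yv: "v (y v) \<ge> 1" if "v \<in> W" for v
    using valued_adjoin.v_power[OF va[OF that] x(1)[OF that]] x(2)[OF that] by (simp add: y_def one_le_power)
  have yu: "real (card W) * u (y v) < 1" if "u \<in> W" "v \<in> W" "u \<noteq> v" for u v
    using valued_adjoin.v_power[OF va[OF that(1)] x(1)[OF that(2)]] r[OF that] by (simp add: y_def)
  have indep: "c v = 0" if c: "(\<Sum>v\<in>W. of_rat (c v) * y v) = 0" and v: "v \<in> W" for c v
  proof (rule ccontr)
    assume cv: "c v \<noteq> 0"
    \<comment> \<open>The relation is tested at the place u with the largest coefficient, where the
      term of u outweighs all others together.\<close>
    have "\<exists>u\<in>W. \<forall>k\<in>W. w (c k) \<le> w (c u)"
    proof -
      have fin: "finite ((\<lambda>i. w (c i)) ` W)" and ne: "(\<lambda>i. w (c i)) ` W \<noteq> {}" using W v by auto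
      obtain i where "i \<in> W" "w (c i) = Max ((\<lambda>i. w (c i)) ` W)" using Max_in[OF fin ne] by auto
      thus ?thesis using Max_ge[OF fin] by (intro bexI[of _ i]) auto
    qed
    then obtain u where u: "u \<in> W" "\<And>k. k \<in> W \<Longrightarrow> w (c k) \<le> w (c u)" by blast
    interpret U: valued_adjoin \<alpha> u using va[OF u(1)] .
    have wnn: "w a \<ge> 0" for a using base[OF u(1), of a] U.v_nonneg[of "of_rat a"] by simp
    have "w (c v) > 0" using base[OF u(1), of "c v"] U.v_pos[of "of_rat (c v)"] cv by simp
    hence wcu: "w (c u) > 0" using u(2)[OF v] by simp
    have fin: "finite (W - {u})" using W by simp
    have "of_rat (c u) * y u = - (\<Sum>v\<in>W - {u}. of_rat (c v) * y v)"
      using c sum.remove[OF W u(1), of "\<lambda>v. of_rat (c v) * y v"] by (simp add: eq_neg_iff_add_eq_0)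
    moreover have "(\<Sum>v\<in>W - {u}. of_rat (c v) * y v) \<in> Qadj \<alpha>"
      using yK by (intro Qadj_sum Qadj_mult) auto
    ultimately have "u (of_rat (c u) * y u) = u (\<Sum>v\<in>W - {u}. of_rat (c v) * y v)"
      using U.v_minus by simp
    also have "\<dots> \<le> (\<Sum>v\<in>W - {u}. u (of_rat (c v) * y v))"
      using yK by (intro U.v_sum_le Qadj_mult) auto
    also have "\<dots> = (\<Sum>v\<in>W - {u}. w (c v) * u (y v))"
      using yK base[OF u(1)] by (intro sum.cong refl) (simp add: U.v_mult)
    also have "\<dots> \<le> (\<Sum>v\<in>W - {u}. w (c u) * (1 / real (card W)))"
    proof (rule sum_mono)
      fix v assume v: "v \<in> W - {u}"
      have "card W > 0" using W u(1) by (auto simp: card_gt_0_iff)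
      moreover have "real (card W) * u (y v) < 1" using yu[of u v] u(1) v by blast
      ultimately have "u (y v) \<le> 1 / real (card W)" by (simp add: field_simps)
      thus "w (c v) * u (y v) \<le> w (c u) * (1 / real (card W))"
        using u(2)[of v] v wnn yK U.v_nonneg by (intro mult_mono) auto
    qed
    also have "\<dots> = real (card W - 1) / real (card W) * w (c u)"
      using u(1) W by (simp add: card_Diff_singleton)
    also have "\<dots> < 1 * w (c u)"
    proof (rule mult_strict_right_mono[OF _ wcu])
      have "card W > 0" using W u(1) by (auto simp: card_gt_0_iff)
      thus "real (card W - 1) / real (card W) < 1" by simp
    qed
    also have "\<dots> \<le> w (c u) * u (y u)" using yv[OF u(1)] wcu by simp
    also have "\<dots> = u (of_rat (c u) * y u)" using base[OF u(1)] yK[OF u(1)] by (simp add: U.v_mult)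
    finally show False by simp
  qed
  interpret Q: vector_space "\<lambda>(q::rat) (z::complex). of_rat q * z"
    by unfold_locales (auto simp: algebra_simps of_rat_add of_rat_mult)
  have inj: "inj_on y W"
  proof (rule inj_onI, rule ccontr)
    fix u v assume uv: "u \<in> W" "v \<in> W" "y u = y v" "u \<noteq> v"
    have "card W \<ge> 1" using W uv(1) by (auto simp: Suc_le_eq card_gt_0_iff)
    have "u (y v) * 1 \<le> u (y v) * real (card W)"
      using \<open>card W \<ge> 1\<close> valued_adjoin.v_nonneg[OF va[OF uv(1)] yK[OF uv(2)]] by (intro mult_left_mono) auto
    hence "u (y v) < 1" using yu[OF uv(1,2,4)] by (simp add: mult.commute)
    thus False using yv[OF uv(1)] uv(3) by simp
  qed
  have "Q.independent (y ` W)"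
  proof (rule Q.independent_if_scalars_zero)
    show "finite (y ` W)" using W by simp
    fix f z assume f: "(\<Sum>x\<in>y ` W. of_rat (f x) * x) = 0" and z: "z \<in> y ` W"
    have "(\<Sum>v\<in>W. of_rat (f (y v)) * y v) = 0" using f inj by (simp add: sum.reindex)
    thus "f z = 0" using indep[of "\<lambda>v. f (y v)"] z by auto
  qed
  moreover have "y ` W \<subseteq> Q.span ((\<lambda>j. \<alpha> ^ j) ` {..<degree m})"
  proof
    fix z assume "z \<in> y ` W"
    hence "z \<in> Qadj \<alpha>" using yK by auto
    then obtain c where c: "z = (\<Sum>j<degree m. of_rat (c j) * \<alpha> ^ j)" using Qadj_span[OF m] by blast
    show "z \<in> Q.span ((\<lambda>j. \<alpha> ^ j) ` {..<degree m})"
      unfolding c by (intro Q.span_sum Q.span_scale Q.span_base) auto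
  qed
  ultimately have "card (y ` W) \<le> card ((\<lambda>j. \<alpha> ^ j) ` {..<degree m})"
    using Q.independent_span_bound by blast
  also have "\<dots> \<le> degree m" using card_image_le[of "{..<degree m}" "\<lambda>j. \<alpha> ^ j"] by simp
  finally show ?thesis using card_image[OF inj] by simp
qed

text \<open>The degree bounds the cardinality of every finite subset, which rules out an infinite
  set.\<close>

lemma finite_places_over:
  assumes alg: "algebraic \<alpha>" and q: "w q > 1"
  shows "finite {v \<in> extensional (Qadj \<alpha>). abs_value_on (Qadj \<alpha>) v \<and> (\<forall>q. v (of_rat q) = w q)}"
proof -
  define A where "A = {v \<in> extensional (Qadj \<alpha>). abs_value_on (Qadj \<alpha>) v \<and> (\<forall>q. v (of_rat q) = w q)}"
  obtain m where m: "is_minpoly m \<alpha>" using minpoly_exists[OF alg] .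
  have le: "card W \<le> degree m" if "W \<subseteq> A" "finite W" for W
  proof (rule card_places_le_degree[where w = w and q = q, OF m alg that(2)])
    show "W \<subseteq> extensional (Qadj \<alpha>)" using that(1) by (auto simp: A_def)
  qed (use that(1) q in \<open>auto simp: A_def\<close>)
  have "finite A"
  proof (rule ccontr)
    assume "infinite A"
    then obtain W where "finite W" "card W = Suc (degree m)" "W \<subseteq> A"
      by (metis infinite_arbitrarily_large)
    thus False using le[of W] by simp
  qed
  thus ?thesis by (simp add: A_def)
qed

lemma (in padic_valued_adjoin) padic_abs_inverse_p: "padic_abs p (inverse (of_int (int p))) > 1"
proof -
  have p1: "real p > 1" using prime_gt_1_nat[OF p] by simp
  have "multiplicity (int p) (int p) = 1" using prime_gt_1_nat[OF p] by (intro multiplicity_self) auto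
  hence "v (of_int (int p)) = inverse (real p)"
    unfolding v_of_int using p1 by (subst padic_abs_of_int) (auto simp: power_int_minus)
  hence "v (inverse (of_int (int p))) = real p" by (subst v_inverse) (auto simp: Qadj_of_int)
  moreover have "v (inverse (of_int (int p))) = padic_abs p (inverse (of_int (int p)))"
    using vp[of "inverse (of_int (int p))"] by (simp add: of_rat_inverse)
  ultimately show ?thesis using p1 by simp
qed

section \<open>The Mahler measure\<close>

lemma placesD:
  assumes "algebraic \<alpha>" "v \<in> places (Qadj \<alpha>)"
  shows "valued_adjoin \<alpha> v"
  using assms by unfold_locales (auto simp: places_def)

text \<open>This keeps the product in \<open>height_over\<close> from taking the default value 1 of
  an infinite product. Above each place of Q that matters there are finitely many places, and the
  primes below the large p-adic ones divide the leading coefficient of an integer polynomial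
  annihilating \<alpha>.\<close>

lemma finite_large_places:
  assumes alg: "algebraic \<alpha>"
  shows "finite {v \<in> places (Qadj \<alpha>). v \<alpha> > 1}"
proof -
  obtain f where f: "f \<noteq> 0" "poly (map_poly of_int f) \<alpha> = 0" using alg by (rule algebraicE')
  define A where "A = (\<lambda>w. {v \<in> extensional (Qadj \<alpha>). abs_value_on (Qadj \<alpha>) v \<and> (\<forall>q. v (of_rat q) = w q)})"
  define B where "B = {p. prime p \<and> int p dvd lead_coeff f}"
  have "finite {d. d dvd lead_coeff f}" using f(1) by (intro finite_divisors_int) simp
  hence "finite (int -` {d. d dvd lead_coeff f})" by (intro finite_vimageI) (auto simp: inj_on_def)
  hence finB: "finite B" by (rule rev_finite_subset) (auto simp: B_def)
  have arch: "finite (A (\<lambda>q. \<bar>of_rat q\<bar>))"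
    unfolding A_def by (rule finite_places_over[OF alg, of _ 2]) simp
  have padic: "finite (A (padic_abs p))" if p: "prime p" for p
  proof (cases "A (padic_abs p) = {}")
    case False
    then obtain v where v: "v \<in> A (padic_abs p)" by blast
    interpret padic_valued_adjoin \<alpha> v p using v p alg by unfold_locales (auto simp: A_def)
    show ?thesis unfolding A_def by (rule finite_places_over[where w = "padic_abs p", OF alg padic_abs_inverse_p])
  qed simp
  have "{v \<in> places (Qadj \<alpha>). v \<alpha> > 1} \<subseteq> A (\<lambda>q. \<bar>of_rat q\<bar>) \<union> (\<Union>p\<in>B. A (padic_abs p))"
  proof
    fix v assume v: "v \<in> {v \<in> places (Qadj \<alpha>). v \<alpha> > 1}"
    hence ext: "v \<in> extensional (Qadj \<alpha>)" "abs_value_on (Qadj \<alpha>) v" by (auto simp: places_def)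
    from v consider "\<forall>q. v (of_rat q) = \<bar>of_rat q\<bar>" | p where "prime p" "\<forall>q. v (of_rat q) = padic_abs p q"
      by (auto simp: places_def)
    thus "v \<in> A (\<lambda>q. \<bar>of_rat q\<bar>) \<union> (\<Union>p\<in>B. A (padic_abs p))"
    proof cases
      case 1
      thus ?thesis using ext by (simp add: A_def)
    next
      case (2 p)
      interpret padic_valued_adjoin \<alpha> v p using 2 ext alg by unfold_locales auto
      have "p \<in> B" using prime_dvd_lead_coeff[OF _ f] v 2 by (simp add: B_def)
      thus ?thesis using 2 ext by (auto simp: A_def)
    qed
  qed
  moreover have "finite (A (\<lambda>q. \<bar>of_rat q\<bar>) \<union> (\<Union>p\<in>B. A (padic_abs p)))"
    using arch padic finB by (auto simp: B_def)
  ultimately show ?thesis by (rule finite_subset)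
qed

lemma mahler_measure_ge_places:
  assumes alg: "algebraic \<alpha>" and T: "T \<subseteq> {v \<in> places (Qadj \<alpha>). v \<alpha> > 1}"
  shows "(\<Prod>v\<in>T. v \<alpha> ^ local_degree (Qadj \<alpha>) v) \<le> mahler_measure \<alpha>"
proof -
  define K where "K = Qadj \<alpha>"
  define d where "d = field_degree K"
  have d: "d > 0" using field_degree_pos[OF alg] by (simp add: d_def K_def)
  define h where "h = (\<lambda>v. max 1 (normalized_abs K v \<alpha>))"
  define A where "A = {v \<in> places K. h v \<noteq> 1}"
  have small: "h v = 1" if "v \<in> places K" "\<not> v \<alpha> > 1" for v
  proof -
    have "v \<alpha> \<ge> 0" using valued_adjoin.v_nonneg[OF placesD[OF alg]] that(1) by (simp add: K_def)
    hence "v \<alpha> powr (real (local_degree K v) / real (field_degree K)) \<le> 1"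
      using that(2) by (intro powr_le1) auto
    thus ?thesis by (simp add: h_def normalized_abs_def)
  qed
  have "A \<subseteq> {v \<in> places K. v \<alpha> > 1}" using small by (auto simp: A_def)
  hence finA: "finite A" using finite_large_places[OF alg] finite_subset unfolding K_def by blast
  have finT: "finite T" using finite_large_places[OF alg] T finite_subset by blast
  have M: "mahler_measure \<alpha> = (\<Prod>v\<in>A. h v ^ d)"
    by (simp add: mahler_measure_def weil_height_def height_over_def adjoin_rat_eq[OF alg] A_def h_def
        K_def d_def prod_power_distrib)
  have pow: "v \<alpha> ^ local_degree K v = h v ^ d" if "v \<in> T" for v
  proof -
    have v: "v \<alpha> > 1" using T that by auto
    have "normalized_abs K v \<alpha> \<ge> 1" using v by (simp add: normalized_abs_def ge_one_powr_ge_zero)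
    hence "h v ^ d = (v \<alpha> powr (real (local_degree K v) / real d)) ^ d"
      by (simp add: h_def normalized_abs_def d_def)
    also have "\<dots> = v \<alpha> powr (real (local_degree K v) / real d * real d)"
      using v by (simp add: powr_powr flip: powr_realpow)
    also have "\<dots> = v \<alpha> ^ local_degree K v" using d v by (simp add: powr_realpow)
    finally show ?thesis by simp
  qed
  have h1: "h v ^ d \<ge> 1" for v by (intro one_le_power) (simp add: h_def)
  have "(\<Prod>v\<in>T. v \<alpha> ^ local_degree K v) = (\<Prod>v\<in>T. h v ^ d)" using pow by (intro prod.cong) auto
  also have "\<dots> = (\<Prod>v\<in>T \<inter> A. h v ^ d)"
    using finT T by (intro prod.mono_neutral_right) (auto simp: A_def K_def)
  also have "\<dots> \<le> (\<Prod>v\<in>A. h v ^ d)"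
    using finA h1 by (intro prod_mono2) (auto intro: order.trans[OF zero_le_one])
  finally show ?thesis by (simp add: M K_def)
qed

lemma mahler_measure_ge_1: "algebraic \<alpha> \<Longrightarrow> mahler_measure \<alpha> \<ge> 1"
  using mahler_measure_ge_places[of \<alpha> "{}"] by simp

lemma mahler_measure_ge_2:
  assumes "algebraic \<alpha>" "\<not> algebraic_int \<alpha>"
  shows "mahler_measure \<alpha> \<ge> 2"
proof -
  obtain p u where pu: "prime p" "abs_value_on (Qadj \<alpha>) u" "\<And>q. u (of_rat q) = padic_abs p q" "u \<alpha> > 1"
    using padic_place_exists[OF assms] by blast
  \<comment> \<open>The absolute value lives on all complex numbers, whereas places are extensional
    on the field.\<close>
  define v where "v = restrict u (Qadj \<alpha>)"
  have "abs_value_on (Qadj \<alpha>) v"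
    using pu(2) by (simp add: abs_value_on_def v_def Qadj_mult Qadj_add)
  moreover have vq: "v (of_rat q) = padic_abs p q" for q using pu(3) by (simp add: v_def)
  ultimately have v: "v \<in> places (Qadj \<alpha>)" "v \<alpha> > 1" using pu by (auto simp: places_def v_def)
  interpret padic_valued_adjoin \<alpha> v p
    using assms(1) \<open>abs_value_on (Qadj \<alpha>) v\<close> pu(1) vq by unfold_locales
  show ?thesis
    using local_contribution_ge[OF v(2)] mahler_measure_ge_places[OF assms(1), of "{v}"] v by simp
qed

section \<open>Archimedean places from embeddings\<close>

lemma complex_of_rat_eq: "(of_rat q :: complex) = of_real (of_rat q)"
proof -
  obtain a b where "q = of_int a / of_int b" by (metis quotient_of_div surj_pair)
  thus ?thesis by (simp add: of_rat_divide)
qed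

text \<open>The complex modulus after the embedding of Q(\<alpha>) that sends \<alpha> to \<gamma>.
  The restriction lets complex conjugate embeddings give the same function, as \<open>places\<close>
  requires.\<close>

definition arch_place :: "complex \<Rightarrow> complex \<Rightarrow> complex \<Rightarrow> real" where
  "arch_place \<alpha> \<gamma> = restrict (\<lambda>x. norm (conj_map \<alpha> \<gamma> x)) (Qadj \<alpha>)"

context
  fixes \<alpha> \<gamma> :: complex
  assumes alg: "algebraic \<alpha>" and \<gamma>: "\<gamma> \<in> conjs \<alpha>"
begin

lemma arch_place_ev: "arch_place \<alpha> \<gamma> (ev p \<alpha>) = norm (ev p \<gamma>)"
  by (simp add: arch_place_def conj_map_ev[OF \<gamma>])

lemma arch_place_self: "arch_place \<alpha> \<gamma> \<alpha> = norm \<gamma>"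
  using arch_place_ev[of "[:0, 1:]"] by simp

lemma arch_place_of_rat: "arch_place \<alpha> \<gamma> (of_rat q) = \<bar>of_rat q\<bar>"
proof -
  have "arch_place \<alpha> \<gamma> (of_rat q) = norm (of_rat q :: complex)"
    using arch_place_ev[of "[:q:]"] by simp
  also have "\<dots> = \<bar>of_rat q\<bar>" unfolding complex_of_rat_eq by (rule norm_of_real)
  finally show ?thesis .
qed

lemma arch_place_in_places: "arch_place \<alpha> \<gamma> \<in> places (Qadj \<alpha>)"
proof -
  have "abs_value_on (Qadj \<alpha>) (arch_place \<alpha> \<gamma>)" unfolding abs_value_on_def
  proof (intro conjI ballI)
    fix x y assume xy: "x \<in> Qadj \<alpha>" "y \<in> Qadj \<alpha>"
    have c0: "conj_map \<alpha> \<gamma> 0 = 0" using conj_map_of_rat[OF \<gamma>, of 0] by simp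
    show "arch_place \<alpha> \<gamma> x \<ge> 0" using xy by (simp add: arch_place_def)
    show "arch_place \<alpha> \<gamma> x = 0 \<longleftrightarrow> x = 0"
      using xy c0 inj_onD[OF conj_map_inj_on[OF alg \<gamma>], of x 0] by (auto simp: arch_place_def)
    show "arch_place \<alpha> \<gamma> (x * y) = arch_place \<alpha> \<gamma> x * arch_place \<alpha> \<gamma> y"
      using xy by (simp add: arch_place_def Qadj_mult conj_map_mult[OF \<gamma>] norm_mult)
    show "arch_place \<alpha> \<gamma> (x + y) \<le> arch_place \<alpha> \<gamma> x + arch_place \<alpha> \<gamma> y"
      using xy by (simp add: arch_place_def Qadj_add conj_map_add[OF \<gamma>] norm_triangle_ineq)
  qed
  thus ?thesis using arch_place_of_rat by (auto simp: places_def arch_place_def)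
qed

text \<open>1 and \<alpha> stay independent over the completion of Q: if a + b \<gamma> is small for
  real a and b, its imaginary part makes b small, and then a is small too.\<close>

lemma local_degree_arch_place_complex:
  assumes "Im \<gamma> \<noteq> 0"
  shows "local_degree (Qadj \<alpha>) (arch_place \<alpha> \<gamma>) \<ge> 2"
proof -
  interpret valued_adjoin \<alpha> "arch_place \<alpha> \<gamma>" using placesD[OF alg arch_place_in_places] .
  show ?thesis
  proof (rule local_degree_ge[where e = "\<lambda>j. \<alpha> ^ j"])
    show "\<alpha> ^ j \<in> Qadj \<alpha>" for j by (intro Qadj_power) auto
    fix c :: "nat \<Rightarrow> nat \<Rightarrow> complex" and j :: nat
    assume c: "\<And>j. j < 2 \<Longrightarrow> c j \<in> cauchy_seqs \<rat> (arch_place \<alpha> \<gamma>)"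
      and null: "(\<lambda>m. arch_place \<alpha> \<gamma> (\<Sum>j<2. c j m * \<alpha> ^ j)) \<longlonglongrightarrow> 0" and j: "j < 2"
    have rat: "\<forall>m. \<exists>q. c j m = of_rat q" if "j < 2" for j
      using cauchy_mem[OF c[OF that]] by (auto elim: Rats_cases)
    obtain a where a: "\<And>m. c 0 m = of_rat (a m)" using choice[OF rat[of 0]] by auto
    obtain b where b: "\<And>m. c 1 m = of_rat (b m)" using choice[OF rat[of 1]] by auto
    note ab = a b
    define z where "z = (\<lambda>m. complex_of_real (of_rat (a m)) + of_real (of_rat (b m)) * \<gamma>)"
    have "(\<Sum>j<2. c j m * \<alpha> ^ j) = ev [:a m, b m:] \<alpha>" for m
      by (simp add: numeral_2_eq_2 ab[unfolded One_nat_def] mult.commute)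
    hence "arch_place \<alpha> \<gamma> (\<Sum>j<2. c j m * \<alpha> ^ j) = norm (z m)" for m
      by (simp only: arch_place_ev) (simp add: z_def mult.commute complex_of_rat_eq)
    hence z0: "(\<lambda>m. norm (z m)) \<longlonglongrightarrow> 0" using null by simp
    have b0: "(\<lambda>m. \<bar>of_rat (b m)\<bar> :: real) \<longlonglongrightarrow> 0"
    proof (rule real_tendsto_sandwich[where f = "\<lambda>_. 0" and h = "\<lambda>m. norm (z m) / \<bar>Im \<gamma>\<bar>"])
      have "\<bar>of_rat (b m)\<bar> \<le> norm (z m) / \<bar>Im \<gamma>\<bar>" for m
        using abs_Im_le_cmod[of "z m"] assms by (simp add: z_def abs_mult pos_le_divide_eq)
      thus "eventually (\<lambda>m. \<bar>of_rat (b m)\<bar> \<le> norm (z m) / \<bar>Im \<gamma>\<bar>) sequentially" by simp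
      show "(\<lambda>m. norm (z m) / \<bar>Im \<gamma>\<bar>) \<longlonglongrightarrow> 0" using tendsto_divide[OF z0 tendsto_const, of "\<bar>Im \<gamma>\<bar>"] assms by simp
    qed auto
    have a0: "(\<lambda>m. \<bar>of_rat (a m)\<bar> :: real) \<longlonglongrightarrow> 0"
    proof (rule real_tendsto_sandwich[where f = "\<lambda>_. 0" and h = "\<lambda>m. norm (z m) + \<bar>of_rat (b m)\<bar> * norm \<gamma>"])
      have "\<bar>of_rat (a m)\<bar> \<le> norm (z m) + \<bar>of_rat (b m)\<bar> * norm \<gamma>" for m
      proof -
        have "\<bar>of_rat (a m)\<bar> = norm (z m - of_real (of_rat (b m)) * \<gamma>)"
          by (simp only: z_def add_diff_cancel_right' norm_of_real)
        also have "\<dots> \<le> norm (z m) + norm (complex_of_real (of_rat (b m)) * \<gamma>)" by (rule norm_triangle_ineq4)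
        finally show ?thesis by (simp only: norm_mult norm_of_real)
      qed
      thus "eventually (\<lambda>m. \<bar>of_rat (a m)\<bar> \<le> norm (z m) + \<bar>of_rat (b m)\<bar> * norm \<gamma>) sequentially" by simp
      show "(\<lambda>m. norm (z m) + \<bar>of_rat (b m)\<bar> * norm \<gamma>) \<longlonglongrightarrow> 0"
        using tendsto_add[OF z0 tendsto_mult[OF b0 tendsto_const, of "norm \<gamma>"]] by simp
    qed auto
    from j have "j = 0 \<or> j = 1" by auto
    thus "(\<lambda>m. arch_place \<alpha> \<gamma> (c j m)) \<longlonglongrightarrow> 0"
      using a0 b0 by (auto simp: ab[unfolded One_nat_def] arch_place_of_rat)
  qed
qed

text \<open>Equal places give |z| = |\<gamma>| and |z - 1| = |\<gamma> - 1|, which determine the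
  real part and the square of the imaginary part.\<close>

lemma arch_place_eq:
  assumes "arch_place \<alpha> z = arch_place \<alpha> \<gamma>" "z \<in> conjs \<alpha>"
  shows "z = \<gamma> \<or> z = cnj \<gamma>"
proof -
  have eq: "norm (ev p z) = norm (ev p \<gamma>)" for p
    using assms conj_map_ev[OF assms(2)] arch_place_ev[of p] by (metis QadjI arch_place_def restrict_apply')
  have "norm z = norm \<gamma>" "norm (z - 1) = norm (\<gamma> - 1)"
    using eq[of "[:0, 1:]"] eq[of "[:- 1, 1:]"] by (simp_all add: of_rat_minus)
  hence 1: "(norm z)\<^sup>2 = (norm \<gamma>)\<^sup>2" "(norm (z - 1))\<^sup>2 = (norm (\<gamma> - 1))\<^sup>2" by auto
  have re: "Re z = Re \<gamma>" using 1 unfolding cmod_power2 by (simp add: power2_eq_square algebra_simps)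
  hence "(Im z)\<^sup>2 = (Im \<gamma>)\<^sup>2" using 1(1) unfolding cmod_power2 by simp
  hence "Im z = Im \<gamma> \<or> Im z = - Im \<gamma>" by (simp add: power2_eq_iff)
  thus ?thesis using re by (auto simp: complex_eq_iff)
qed

end

text \<open>Group the conjugates of modulus above 1 by the place they induce. A place collects one
  real conjugate or at most a complex conjugate pair, and its local degree is at least 1 or 2
  accordingly.\<close>

lemma mahler_measure_ge_conjs:
  assumes alg: "algebraic \<alpha>" and S: "S \<subseteq> conjs \<alpha>"
  shows "(\<Prod>z\<in>S. norm z) \<le> mahler_measure \<alpha>"
proof -
  define \<Gamma> where "\<Gamma> = {\<gamma> \<in> conjs \<alpha>. norm \<gamma> > 1}"
  have fin: "finite (conjs \<alpha>)" by (rule finite_conjs[OF alg])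
  have fin\<Gamma>: "finite \<Gamma>" using fin by (simp add: \<Gamma>_def)
  have finS: "finite S" using S fin finite_subset by blast
  define T where "T = arch_place \<alpha> ` \<Gamma>"
  \<comment> \<open>Raising small factors to 1 and then including the remaining conjugates can only
    enlarge the product.\<close>
  have "(\<Prod>z\<in>S. norm z) \<le> (\<Prod>z\<in>S. max 1 (norm z))" by (intro prod_mono) auto
  also have "\<dots> \<le> (\<Prod>z\<in>conjs \<alpha>. max 1 (norm z))" using S fin by (intro prod_mono2) auto
  also have "\<dots> = (\<Prod>z\<in>\<Gamma>. max 1 (norm z))"
    using fin by (intro prod.mono_neutral_right) (auto simp: \<Gamma>_def max_def)
  also have "\<dots> = (\<Prod>z\<in>\<Gamma>. norm z)" by (intro prod.cong refl) (simp add: \<Gamma>_def)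
  also have "\<dots> = (\<Prod>v\<in>T. \<Prod>z\<in>{z \<in> \<Gamma>. arch_place \<alpha> z = v}. norm z)"
    unfolding T_def by (rule prod.image_gen[OF fin\<Gamma>])
  also have "\<dots> \<le> (\<Prod>v\<in>T. v \<alpha> ^ local_degree (Qadj \<alpha>) v)"
  proof (intro prod_mono conjI prod_nonneg ballI norm_ge_zero)
    fix v assume "v \<in> T"
    then obtain \<gamma> where \<gamma>: "\<gamma> \<in> \<Gamma>" "v = arch_place \<alpha> \<gamma>" by (auto simp: T_def)
    have \<gamma>c: "\<gamma> \<in> conjs \<alpha>" "norm \<gamma> > 1" using \<gamma> by (auto simp: \<Gamma>_def)
    define E where "E = {z \<in> \<Gamma>. arch_place \<alpha> z = v}"
    have "(\<Prod>z\<in>E. norm z) = (\<Prod>z\<in>E. v \<alpha>)"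
      using arch_place_self[OF alg] by (intro prod.cong refl) (auto simp: E_def \<Gamma>_def)
    hence eq: "(\<Prod>z\<in>E. norm z) = v \<alpha> ^ card E" by simp
    have v\<alpha>: "v \<alpha> = norm \<gamma>" using arch_place_self[OF alg \<gamma>c(1)] \<gamma>(2) by simp
    have sub: "E \<subseteq> {\<gamma>, cnj \<gamma>}" using arch_place_eq[OF alg \<gamma>c(1)] \<gamma>(2) by (auto simp: E_def \<Gamma>_def)
    have "card E \<le> local_degree (Qadj \<alpha>) v"
    proof (cases "Im \<gamma> = 0")
      case True
      hence "cnj \<gamma> = \<gamma>" by (simp add: complex_eq_iff)
      hence "card E \<le> 1" using card_mono[OF _ sub] by simp
      also have "1 \<le> local_degree (Qadj \<alpha>) v"
        using valued_adjoin.local_degree_pos[OF placesD[OF alg arch_place_in_places[OF alg \<gamma>c(1)]]] \<gamma>(2) by simp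
      finally show ?thesis .
    next
      case False
      have "card E \<le> card {\<gamma>, cnj \<gamma>}" using card_mono[OF _ sub] by simp
      also have "\<dots> \<le> 2" by (simp add: card_insert_if)
      also have "2 \<le> local_degree (Qadj \<alpha>) v"
        using local_degree_arch_place_complex[OF alg \<gamma>c(1) False] \<gamma>(2) by simp
      finally show ?thesis .
    qed
    thus "(\<Prod>z\<in>{z \<in> \<Gamma>. arch_place \<alpha> z = v}. norm z) \<le> v \<alpha> ^ local_degree (Qadj \<alpha>) v"
      unfolding E_def[symmetric] eq using v\<alpha> \<gamma>c(2) by (intro power_increasing) auto
  qed
  also have "\<dots> \<le> mahler_measure \<alpha>" using arch_place_in_places[OF alg] arch_place_self[OF alg]
    by (intro mahler_measure_ge_places[OF alg]) (auto simp: T_def \<Gamma>_def)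
  finally show ?thesis .
qed

lemma mahler_measure_root_of_unity:
  assumes "algebraic \<alpha>" "n > 0" "\<alpha> ^ n = 1"
  shows "mahler_measure \<alpha> = 1"
proof -
  have "normalized_abs (Qadj \<alpha>) v \<alpha> = 1" if "v \<in> places (Qadj \<alpha>)" for v
  proof -
    interpret valued_adjoin \<alpha> v using placesD[OF assms(1) that] .
    have "v \<alpha> ^ n = 1 ^ n" using v_power[of \<alpha> n] assms(3) by simp
    hence "v \<alpha> = 1" by (rule power_eq_imp_eq_base) (use assms(2) in \<open>auto simp: v_nonneg\<close>)
    thus ?thesis by (simp add: normalized_abs_def)
  qed
  hence "{v. v \<in> places (Qadj \<alpha>) \<and> max 1 (normalized_abs (Qadj \<alpha>) v \<alpha>) \<noteq> 1} = {}" by auto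
  thus ?thesis
    by (simp only: mahler_measure_def weil_height_def height_over_def adjoin_rat_eq[OF assms(1)]) simp
qed

section \<open>The infimum over all factorizations\<close>

lemma finite_range_mahler_measure:
  assumes "a \<in> finite_seqs"
  shows "finite (range (\<lambda>n. mahler_measure (a n)))"
proof (rule finite_subset)
  show "range (\<lambda>n. mahler_measure (a n)) \<subseteq> insert (mahler_measure 1) ((\<lambda>n. mahler_measure (a n)) ` {n. a n \<noteq> 1})"
    by auto
  show "finite (insert (mahler_measure 1) ((\<lambda>n. mahler_measure (a n)) ` {n. a n \<noteq> 1}))"
    using assms by (auto simp: finite_seqs_def)
qed

theorem corollary1p2:
  fixes \<alpha> :: complex
  assumes "algebraic \<alpha>" and "\<alpha> \<noteq> 0"
  shows "metric_mahler \<alpha> = 1 \<longleftrightarrow> (\<exists>n::nat. n > 0 \<and> \<alpha> ^ n = 1)"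
proof -
  define S where "S = {Max (range (\<lambda>n. mahler_measure (a n))) | a. a \<in> finite_seqs \<and> seq_prod a = \<alpha>}"
  have M: "metric_mahler \<alpha> = Inf S" by (simp add: metric_mahler_def S_def)
  have le_Max: "mahler_measure (a n) \<le> Max (range (\<lambda>n. mahler_measure (a n)))" if "a \<in> finite_seqs" for a n
    using finite_range_mahler_measure[OF that] by (intro Max_ge) auto
  have S1: "s \<ge> 1" if sS: "s \<in> S" for s
  proof -
    obtain a where a: "a \<in> finite_seqs" "s = Max (range (\<lambda>n. mahler_measure (a n)))"
      using sS unfolding S_def by blast
    have "1 \<le> mahler_measure (a 0)" using a(1) by (intro mahler_measure_ge_1) (simp add: finite_seqs_def)
    also have "\<dots> \<le> s" unfolding a(2) by (rule le_Max[OF a(1)])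
    finally show ?thesis .
  qed
  \<comment> \<open>The factorization \<alpha>, 1, 1, ... shows that S is nonempty; for a root of
    unity it attains the lower bound 1.\<close>
  define b where "b = (\<lambda>i::nat. if i = 0 then \<alpha> else 1)"
  have supp: "{n. b n \<noteq> 1} = (if \<alpha> = 1 then {} else {0})" by (auto simp: b_def)
  have "b \<in> finite_seqs" using assms by (auto simp: finite_seqs_def supp) (auto simp: b_def split: if_splits)
  moreover have "seq_prod b = \<alpha>" by (simp add: seq_prod_def supp) (simp add: b_def)
  ultimately have bS: "Max (range (\<lambda>n. mahler_measure (b n))) \<in> S" by (auto simp: S_def)
  show ?thesis
  proof
    assume "\<exists>n::nat. n > 0 \<and> \<alpha> ^ n = 1"
    hence "mahler_measure \<alpha> = 1" using mahler_measure_root_of_unity[OF assms(1)] by blast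
    moreover have "mahler_measure 1 = 1" by (rule mahler_measure_root_of_unity[of _ 1]) auto
    ultimately have "(\<lambda>n. mahler_measure (b n)) = (\<lambda>_. 1)" by (auto simp: b_def)
    hence "Max (range (\<lambda>n. mahler_measure (b n))) = 1" by (simp only:) simp
    hence "1 \<in> S" using bS by metis
    thus "metric_mahler \<alpha> = 1" unfolding M using S1 by (intro cInf_eq_minimum)
  next
    assume one: "metric_mahler \<alpha> = 1"
    obtain c :: real where c: "c > 1"
      "\<And>(I :: nat set) a. finite I \<Longrightarrow> (\<And>i. i \<in> I \<Longrightarrow> algebraic_int (a i)) \<Longrightarrow>
       (\<And>i S. i \<in> I \<Longrightarrow> S \<subseteq> conjs (a i) \<Longrightarrow> (\<Prod>z\<in>S. norm z) \<le> c) \<Longrightarrow>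
       (\<Prod>i\<in>I. a i) = \<alpha> \<Longrightarrow> \<exists>n>0. \<alpha> ^ n = 1" using root_of_unity_of_small_factors[OF assms] by blast
    \<comment> \<open>Below 2 every factor is an algebraic integer; below c the products of its
      conjugates are small enough.\<close>
    have "Inf S < min c 2" using one c(1) by (simp add: M)
    then obtain s where s: "s \<in> S" "s < min c 2" using cInf_lessD[of S] bS by blast
    then obtain a where a: "a \<in> finite_seqs" "seq_prod a = \<alpha>" "s = Max (range (\<lambda>n. mahler_measure (a n)))"
      by (auto simp: S_def)
    have small: "mahler_measure (a n) < min c 2" for n using le_Max[OF a(1), of n] a(3) s(2) by simp
    have alg: "algebraic (a n)" for n using a(1) by (simp add: finite_seqs_def)
    show "\<exists>n::nat. n > 0 \<and> \<alpha> ^ n = 1"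
    proof (rule c(2)[of "{n. a n \<noteq> 1}" a])
      show "finite {n. a n \<noteq> 1}" using a(1) by (simp add: finite_seqs_def)
      show "algebraic_int (a n)" for n using mahler_measure_ge_2[OF alg, of n] small[of n] by force
      show "(\<Prod>z\<in>S. norm z) \<le> c" if "S \<subseteq> conjs (a n)" for n S
        using mahler_measure_ge_conjs[OF alg that] small[of n] by simp
      show "(\<Prod>n | a n \<noteq> 1. a n) = \<alpha>" using a(2) by (simp add: seq_prod_def)
    qed
  qed
qed

end
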